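(* Let $n,m\ge 1$ be integers and $\mathbb{K}$ a field. The set of apexes for simple $m\mathcal{TL}_n$-representations over $\mathbb{K}$ can be indexed by the poset $\{n,n-2,\dots\}$ (the integers $k$ with $0\le k\le n$, $k\equiv n \pmod 2$) under the reverse natural order. Moreover, there are at most $m$ simple $m\mathcal{TL}_n$-representations (up to isomorphism) of a fixed apex. In particular, there are exactly $m$ simple $m\mathcal{TL}_n$-representations of a fixed apex if $\mathbb{K}$ contains a primitive $m$-th root of unity.
   Context: For $p,q\ge 0$, let $C_p^q$ be the set of crossingless matchings from $p$ to $q$ points: non-crossing perfect matchings of the $p$ bottom points $(1,0),\dots,(p,0)$ and the $q$ top points $(1,1),\dots,(q,1)$, drawn by pairwise disjoint arcs in $\mathbb{R}\times[0,1]$ (identified if the same points are paired). For $a\in C_q^r$, $b\in C_p^q$, gluing $a$ on top of $b$ along the $q$ middle points gives a matching $ab\in C_p^r$ after deleting closed loops; $\Phi(a,b)$ is the number of closed loops deleted. The $m$-cyclic Temperley–Lieb monoid on $n$ strands is $m\mathcal{TL}_n=C_n^n\times\mathbb{Z}/m$ with product $(a,i)(b,j)=(ab,\,i+j+\Phi(a,b))$ and identity $(\mathrm{id}_n,0)$. For a monoid $\mathcal{S}$ write $a\le_{lr}b$ if $b=cad$ for some $c,d\in\mathcal{S}$; the equivalence classes of the associated equivalence relation ($a\le_{lr}b$ and $b\le_{lr}a$) are the $J$-cells, partially ordered by $\le_{lr}$. A $J$-cell is idempotent if it contains an idempotent. An apex of an $\mathcal{S}$-representation $M$ is a maximal (with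 respect to $\le_{lr}$) idempotent $J$-cell that does not annihilate $M$; every simple representation has a unique apex. *)

theory Defs
  imports
    "HOL-Analysis.Analysis"
    "HOL-Library.Disjoint_Sets"
    "HOL-Algebra.Elementary_Groups"
begin

section \<open>Crossingless matchings\<close>

text \<open>The pair \<open>(x, y)\<close> stands for the \<open>x\<close>-th point on the line of height \<open>y\<close>. Diagrams in
  \<open>crossingless p q\<close> use the heights 0 and 1; a stack of two diagrams uses 0, 1 and 2.\<close>

definition marked_points :: "nat \<Rightarrow> nat \<Rightarrow> (nat \<times> nat) set" where
  "marked_points p q = {1..p} \<times> {0} \<union> {1..q} \<times> {1}"

definition plane_point :: "nat \<times> nat \<Rightarrow> real \<times> real" where
  "plane_point v = (real (fst v), real (snd v))"

definition perfect_matching :: "'a set \<Rightarrow> 'a set set \<Rightarrow> bool" where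
  "perfect_matching P M \<longleftrightarrow> partition_on P M \<and> (\<forall>e\<in>M. card e = 2)"

definition crossingless :: "nat \<Rightarrow> nat \<Rightarrow> (nat \<times> nat) set set set" where
  "crossingless p q =
     {M. perfect_matching (marked_points p q) M \<and>
         (\<exists>\<gamma> :: (nat \<times> nat) set \<Rightarrow> real \<Rightarrow> real \<times> real.
            (\<forall>e\<in>M. arc (\<gamma> e) \<and> path_image (\<gamma> e) \<subseteq> UNIV \<times> {0..1} \<and>
                   {pathstart (\<gamma> e), pathfinish (\<gamma> e)} = plane_point ` e) \<and>
            disjoint_family_on (\<lambda>e. path_image (\<gamma> e)) M)}"

subsection \<open>Gluing\<close>

text \<open>In the stack of \<open>a\<close> on top of \<open>b\<close>, the matching \<open>b\<close> occupies the heights 0 and 1, and \<open>a\<close>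
  is moved up to the heights 1 and 2.\<close>

definition stack_vertices :: "nat \<Rightarrow> nat \<Rightarrow> nat \<Rightarrow> (nat \<times> nat) set" where
  "stack_vertices p q r = {1..p} \<times> {0} \<union> {1..q} \<times> {1} \<union> {1..r} \<times> {2}"

definition raise :: "nat \<times> nat \<Rightarrow> nat \<times> nat" where
  "raise v = (fst v, Suc (snd v))"

definition stack_edges ::
  "(nat \<times> nat) set set \<Rightarrow> (nat \<times> nat) set set \<Rightarrow> (nat \<times> nat) set set" where
  "stack_edges a b = b \<union> (image raise) ` a"

definition stack_components ::
  "nat \<Rightarrow> nat \<Rightarrow> nat \<Rightarrow> (nat \<times> nat) set set \<Rightarrow> (nat \<times> nat) set set \<Rightarrow> (nat \<times> nat) set set" where
  "stack_components p q r a b =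
     stack_vertices p q r // {(u, v). {u, v} \<in> stack_edges a b}\<^sup>*"

text \<open>A component of the stack is either a strand, meeting the bottom and top lines in its two
  endpoints, or a closed loop, all of whose vertices lie on the middle line.\<close>

definition loops ::
  "nat \<Rightarrow> nat \<Rightarrow> nat \<Rightarrow> (nat \<times> nat) set set \<Rightarrow> (nat \<times> nat) set set \<Rightarrow> nat" where
  "loops p q r a b = card {K \<in> stack_components p q r a b. \<forall>v\<in>K. snd v = 1}"

definition glue ::
  "nat \<Rightarrow> nat \<Rightarrow> nat \<Rightarrow> (nat \<times> nat) set set \<Rightarrow> (nat \<times> nat) set set \<Rightarrow> (nat \<times> nat) set set" where
  "glue p q r a b =
     {(\<lambda>(x, y). (x, y div 2)) ` {v \<in> K. snd v \<noteq> 1} | K.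
        K \<in> stack_components p q r a b \<and> (\<exists>v\<in>K. snd v \<noteq> 1)}"

definition id_diagram :: "nat \<Rightarrow> (nat \<times> nat) set set" where
  "id_diagram n = (\<lambda>x. {(x, 0), (x, 1)}) ` {1..n}"

section \<open>The cyclic Temperley--Lieb monoid\<close>

definition cyclic_TL :: "nat \<Rightarrow> nat \<Rightarrow> ((nat \<times> nat) set set \<times> int) monoid" where
  "cyclic_TL m n =
     \<lparr>carrier = crossingless n n \<times> carrier (integer_mod_group m),
      mult = (\<lambda>(a, i) (b, j). (glue n n n a b, (i + j + int (loops n n n a b)) mod int m)),
      one = (id_diagram n, 0)\<rparr>"

definition strand_numbers :: "nat \<Rightarrow> nat set" where
  "strand_numbers n = {k. k \<le> n \<and> k mod 2 = n mod 2}"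

section \<open>J-cells\<close>

definition lr_le :: "('s, 'x) monoid_scheme \<Rightarrow> 's \<Rightarrow> 's \<Rightarrow> bool" where
  "lr_le S a b \<longleftrightarrow> (\<exists>c\<in>carrier S. \<exists>d\<in>carrier S. b = c \<otimes>\<^bsub>S\<^esub> a \<otimes>\<^bsub>S\<^esub> d)"

definition J_cells :: "('s, 'x) monoid_scheme \<Rightarrow> 's set set" where
  "J_cells S =
     carrier S // {(a, b). a \<in> carrier S \<and> b \<in> carrier S \<and> lr_le S a b \<and> lr_le S b a}"

definition J_cell_le :: "('s, 'x) monoid_scheme \<Rightarrow> 's set \<Rightarrow> 's set \<Rightarrow> bool" where
  "J_cell_le S J J' \<longleftrightarrow> (\<exists>a\<in>J. \<exists>b\<in>J'. lr_le S a b)"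

definition idempotent_J_cells :: "('s, 'x) monoid_scheme \<Rightarrow> 's set set" where
  "idempotent_J_cells S = {J \<in> J_cells S. \<exists>e\<in>J. e \<otimes>\<^bsub>S\<^esub> e = e}"

section \<open>Representations\<close>

text \<open>A representation is a pair \<open>(V, \<rho>)\<close> of a subspace \<open>V\<close> of an ambient vector space and an
  action \<open>\<rho>\<close> of the monoid on \<open>V\<close>; the values of \<open>\<rho>\<close> outside the carrier of the monoid and
  outside \<open>V\<close> are irrelevant. The ambient space is only a universe in which representations of
  different dimensions can be collected into one set. Every vector space embeds into an
  infinite-dimensional one, and an infinite-dimensional ambient space contains spaces of every
  finite dimension, hence a copy of every simple representation of a finite monoid. No bound on
  the dimension of \<open>V\<close> is imposed.\<close>

type_synonym ('s, 'v) rep = "'v set \<times> ('s \<Rightarrow> 'v \<Rightarrow> 'v)"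

definition infinite_dimensional ::
  "('k::field \<Rightarrow> 'v::ab_group_add \<Rightarrow> 'v) \<Rightarrow> bool" where
  "infinite_dimensional smul \<longleftrightarrow> \<not> (\<exists>B. finite B \<and> module.span smul B = UNIV)"

definition linear_between ::
  "('k::field \<Rightarrow> 'v::ab_group_add \<Rightarrow> 'v) \<Rightarrow> 'v set \<Rightarrow> 'v set \<Rightarrow> ('v \<Rightarrow> 'v) \<Rightarrow> bool" where
  "linear_between smul V W f \<longleftrightarrow>
     f ` V \<subseteq> W \<and>
     (\<forall>x\<in>V. \<forall>y\<in>V. f (x + y) = f x + f y) \<and>
     (\<forall>c. \<forall>x\<in>V. f (smul c x) = smul c (f x))"

definition representation ::
  "('k::field \<Rightarrow> 'v::ab_group_add \<Rightarrow> 'v) \<Rightarrow> ('s, 'x) monoid_scheme \<Rightarrow> ('s, 'v) rep \<Rightarrow> bool" where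
  "representation smul S = (\<lambda>(V, \<rho>).
     module.subspace smul V \<and>
     (\<forall>s\<in>carrier S. linear_between smul V V (\<rho> s)) \<and>
     (\<forall>v\<in>V. \<rho> \<one>\<^bsub>S\<^esub> v = v) \<and>
     (\<forall>s\<in>carrier S. \<forall>t\<in>carrier S. \<forall>v\<in>V. \<rho> (s \<otimes>\<^bsub>S\<^esub> t) v = \<rho> s (\<rho> t v)))"

definition simple_rep ::
  "('k::field \<Rightarrow> 'v::ab_group_add \<Rightarrow> 'v) \<Rightarrow> ('s, 'x) monoid_scheme \<Rightarrow> ('s, 'v) rep \<Rightarrow> bool" where
  "simple_rep smul S = (\<lambda>(V, \<rho>).
     representation smul S (V, \<rho>) \<and> V \<noteq> {0} \<and>
     (\<forall>W. W \<subseteq> V \<and> representation smul S (W, \<rho>) \<longrightarrow> W = {0} \<or> W = V))"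

definition rep_iso ::
  "('k::field \<Rightarrow> 'v::ab_group_add \<Rightarrow> 'v) \<Rightarrow> ('s, 'x) monoid_scheme \<Rightarrow> ('s, 'v) rep rel" where
  "rep_iso smul S =
     {((V, \<rho>), (W, \<sigma>)). representation smul S (V, \<rho>) \<and> representation smul S (W, \<sigma>) \<and>
        (\<exists>f. linear_between smul V W f \<and> bij_betw f V W \<and>
             (\<forall>s\<in>carrier S. \<forall>v\<in>V. f (\<rho> s v) = \<sigma> s (f v)))}"

definition annihilates :: "'s set \<Rightarrow> ('s, 'v::zero) rep \<Rightarrow> bool" where
  "annihilates J = (\<lambda>(V, \<rho>). \<forall>s\<in>J. \<forall>v\<in>V. \<rho> s v = 0)"

definition is_apex ::
  "('k::field \<Rightarrow> 'v::ab_group_add \<Rightarrow> 'v) \<Rightarrow> ('s, 'x) monoid_scheme \<Rightarrow>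
   ('s, 'v) rep \<Rightarrow> 's set \<Rightarrow> bool" where
  "is_apex smul S M J \<longleftrightarrow>
     J \<in> idempotent_J_cells S \<and> \<not> annihilates J M \<and>
     (\<forall>J'\<in>idempotent_J_cells S. \<not> annihilates J' M \<and> J_cell_le S J J' \<longrightarrow> J' = J)"

definition simple_apexes ::
  "('k::field \<Rightarrow> 'v::ab_group_add \<Rightarrow> 'v) \<Rightarrow> ('s, 'x) monoid_scheme \<Rightarrow> 's set set" where
  "simple_apexes smul S = {J. \<exists>M. simple_rep smul S M \<and> is_apex smul S M J}"

definition simple_classes ::
  "('k::field \<Rightarrow> 'v::ab_group_add \<Rightarrow> 'v) \<Rightarrow> ('s, 'x) monoid_scheme \<Rightarrow>
   's set \<Rightarrow> ('s, 'v) rep set set" where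
  "simple_classes smul S J = {M. simple_rep smul S M \<and> is_apex smul S M J} // rep_iso smul S"

definition primitive_root_of_unity :: "nat \<Rightarrow> 'k::field \<Rightarrow> bool" where
  "primitive_root_of_unity m z \<longleftrightarrow> z ^ m = 1 \<and> (\<forall>j. 0 < j \<and> j < m \<longrightarrow> z ^ j \<noteq> 1)"

end

theory Submission
  imports Defs "HOL-Computational_Algebra.Polynomial"
begin
text \<open>
  Write \<open>z = (id, 1)\<close> for the central generator of order \<open>m\<close>. Two facts about the monoid decide
  everything. A diagram with at least as many through strands as another one can be multiplied
  on both sides to become the other one, so the J-cells are the sets of elements with \<open>k\<close> through
  strands and they form a chain. And for every \<open>k\<close> there is an idempotent \<open>e\<close> with \<open>k\<close> through strands
  such that every element of \<open>e S e\<close> with \<open>k\<close> through strands is a power of \<open>z\<close> times \<open>e\<close>. A simple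
  representation of apex \<open>k\<close> is then controlled by the cyclic group of these powers. Annihilation
  by polynomials in \<open>z\<close> is tested on one nonzero vector, the annihilating polynomials form a
  prime ideal that contains \<open>X^m - 1\<close>, and this ideal determines the representation up to
  isomorphism (\<open>rep_iso_of_annihilator_eq\<close>). There are at most \<open>m\<close> prime divisors of
  \<open>X^m - 1\<close> up to units. Conversely every scalar \<open>c\<close> with \<open>c^m = 1\<close> is the action of \<open>z\<close> on some simple
  representation of apex \<open>k\<close> (locale \<open>scalar_model\<close>); \<open>c = 1\<close> shows that every \<open>k\<close> is an apex, and
  the powers of a primitive root give \<open>m\<close> different representations.

  The facts about diagrams need three ingredients. The complex map \<open>exp(\<pi> w)\<close> turns the strip into a half
  plane, where the Fashoda theorem shows that arcs with interleaved endpoints meet, and where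
  semicircles draw every matching without interleaved blocks (\<open>crossingless_iff\<close>). The latter
  drawings can be stacked, hence a composite of crossingless matchings is crossingless
  (\<open>glue_crossingless\<close>). Finally the two-colourings that are constant on blocks turn matchings
  into relations and gluing into composition of relations: colours of the outer lines that are
  compatible with the composite extend to the middle line in \<open>2\<close> to the number of loops ways
  (\<open>card_middle_colourings\<close>). As a matching is
  determined by its relation, associativity, the cocycle rule for loops and all later identities
  between diagrams become identities between relations.

  With these tools an innermost cap can be split off until no cap or cup is left. This
  writes every diagram as \<open>u v*\<close>, where \<open>v*\<close> is the reflection of \<open>v\<close> and where \<open>u* u\<close> and \<open>v* v\<close> are
  identities up to loops (\<open>crossingless_factorisation\<close>); the two facts above follow from it.
\<close>


section \<open>Crossingless matchings are the noncrossing ones\<close>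

abbreviation matching :: "nat \<Rightarrow> nat \<Rightarrow> (nat \<times> nat) set set \<Rightarrow> bool" where
  "matching p q \<equiv> perfect_matching (marked_points p q)"

text \<open>Increasing values run through the top points from right to left and then through the bottom
  points from left to right, which is one tour along the boundary of the strip.\<close>

definition boundary_order :: "nat \<times> nat \<Rightarrow> int" where
  "boundary_order v = (if snd v = 0 then int (fst v) else - int (fst v))"

definition noncrossing :: "(nat \<times> nat) set set \<Rightarrow> bool" where
  "noncrossing M \<longleftrightarrow>
     (\<forall>e\<in>M. \<forall>f\<in>M. \<forall>a\<in>e. \<forall>b\<in>f. \<forall>c\<in>e. \<forall>d\<in>f.
        \<not> (boundary_order a < boundary_order b \<and> boundary_order b < boundary_order c \<and>
           boundary_order c < boundary_order d))"

lemma noncrossingD: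
  "noncrossing M \<Longrightarrow> e \<in> M \<Longrightarrow> f \<in> M \<Longrightarrow> a \<in> e \<Longrightarrow> b \<in> f \<Longrightarrow> c \<in> e \<Longrightarrow> d \<in> f \<Longrightarrow>
     \<not> (boundary_order a < boundary_order b \<and> boundary_order b < boundary_order c \<and>
        boundary_order c < boundary_order d)"
  unfolding noncrossing_def by blast

lemma finite_marked_points [simp]: "finite (marked_points p q)"
  by (simp add: marked_points_def)

lemma marked_points_iff:
  "v \<in> marked_points p q \<longleftrightarrow>
     snd v = 0 \<and> 1 \<le> fst v \<and> fst v \<le> p \<or> snd v = 1 \<and> 1 \<le> fst v \<and> fst v \<le> q"
  by (cases v) (auto simp: marked_points_def)

lemma inj_on_boundary_order: "inj_on boundary_order (marked_points p q)"
  by (auto simp: inj_on_def marked_points_iff boundary_order_def split: if_splits)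

lemma inj_plane_point: "inj plane_point"
  by (auto simp: inj_def plane_point_def)

lemma perfect_matching_block_subset:
  "perfect_matching P M \<Longrightarrow> e \<in> M \<Longrightarrow> e \<subseteq> P"
  by (auto simp: perfect_matching_def partition_on_def)

lemma perfect_matching_obtain_block:
  assumes "perfect_matching P M" "v \<in> P"
  obtains e where "e \<in> M" "v \<in> e"
  using assms by (auto simp: perfect_matching_def partition_on_def)

lemma perfect_matching_block_unique:
  "perfect_matching P M \<Longrightarrow> e \<in> M \<Longrightarrow> f \<in> M \<Longrightarrow> v \<in> e \<Longrightarrow> v \<in> f \<Longrightarrow> e = f"
  unfolding perfect_matching_def partition_on_def disjoint_def by blast

lemma marked_block_endpoints:
  assumes "matching p q M" "e \<in> M"
  obtains a c where "e = {a, c}" "boundary_order a < boundary_order c"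
    "a \<in> marked_points p q" "c \<in> marked_points p q"
proof -
  have "card e = 2" using assms by (auto simp: perfect_matching_def)
  then obtain a c where e: "e = {a, c}" "a \<noteq> c" by (auto simp: card_2_iff)
  have m: "a \<in> marked_points p q" "c \<in> marked_points p q"
    using perfect_matching_block_subset[OF assms] e by auto
  have "boundary_order a \<noteq> boundary_order c"
    using inj_onD[OF inj_on_boundary_order _ m] e by auto
  then show ?thesis using that[of a c] that[of c a] e m by (cases "boundary_order a < boundary_order c") auto
qed

subsection \<open>The strip as a half plane\<close>

text \<open>The complex map \<open>exp(\<pi> w)\<close> in real coordinates. It identifies the strip with the closed upper half plane without the
  origin, and the marked points appear on the real axis in the boundary order.\<close>

definition strip_to_plane :: "real \<times> real \<Rightarrow> real \<times> real" where
  "strip_to_plane z = (exp (pi * fst z) * cos (pi * snd z), exp (pi * fst z) * sin (pi * snd z))"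

definition plane_to_strip :: "real \<times> real \<Rightarrow> real \<times> real" where
  "plane_to_strip w =
     (ln (sqrt ((fst w)\<^sup>2 + (snd w)\<^sup>2)) / pi, arccos (fst w / sqrt ((fst w)\<^sup>2 + (snd w)\<^sup>2)) / pi)"

definition axis_position :: "nat \<times> nat \<Rightarrow> real" where
  "axis_position v = (if snd v = 0 then exp (pi * real (fst v)) else - exp (pi * real (fst v)))"

lemma strip_to_plane_plane_point:
  "v \<in> marked_points p q \<Longrightarrow> strip_to_plane (plane_point v) = (axis_position v, 0)"
  by (auto simp: marked_points_iff strip_to_plane_def plane_point_def axis_position_def)

lemma plane_to_strip_axis_position:
  "v \<in> marked_points p q \<Longrightarrow> plane_to_strip (axis_position v, 0) = plane_point v"
  by (auto simp: marked_points_iff plane_to_strip_def plane_point_def axis_position_def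
      real_sqrt_abs)

lemma axis_position_less:
  assumes "v \<in> marked_points p q" "w \<in> marked_points p q" "boundary_order v < boundary_order w"
  shows "axis_position v < axis_position w"
proof -
  have "- exp a < exp b" for a b :: real
    using exp_gt_zero[of a] exp_gt_zero[of b] by linarith
  then show ?thesis using assms
    by (auto simp: marked_points_iff boundary_order_def axis_position_def)
qed

lemma strip_to_plane_nonneg: "z \<in> UNIV \<times> {0..1} \<Longrightarrow> snd (strip_to_plane z) \<ge> 0"
  by (auto simp: strip_to_plane_def intro!: mult_nonneg_nonneg sin_ge_zero)

lemma polar_cos_bound:
  fixes u v :: real
  shows "- 1 \<le> u / sqrt (u\<^sup>2 + v\<^sup>2)" "u / sqrt (u\<^sup>2 + v\<^sup>2) \<le> 1"
proof -
  have "\<bar>u / sqrt (u\<^sup>2 + v\<^sup>2)\<bar> \<le> 1"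
proof (cases "u = 0 \<and> v = 0")
  case False
  have "\<bar>u\<bar> \<le> sqrt (u\<^sup>2 + v\<^sup>2)" by (rule real_le_rsqrt) simp
  moreover have "sqrt (u\<^sup>2 + v\<^sup>2) > 0"
    using False by (simp add: sum_power2_gt_zero_iff)
  ultimately show ?thesis by (simp add: abs_divide)
qed auto
  then show "- 1 \<le> u / sqrt (u\<^sup>2 + v\<^sup>2)" "u / sqrt (u\<^sup>2 + v\<^sup>2) \<le> 1"
    by (simp_all only: abs_le_iff) auto
qed

lemma strip_to_plane_plane_to_strip:
  assumes "snd w \<ge> 0" "w \<noteq> 0"
  shows "strip_to_plane (plane_to_strip w) = w"
proof -
  obtain u v where w: "w = (u, v)" by (cases w)
  define r where "r = sqrt (u\<^sup>2 + v\<^sup>2)"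
  have r: "r > 0" using assms by (auto simp: r_def w zero_prod_def sum_power2_gt_zero_iff)
  have r2: "r\<^sup>2 = u\<^sup>2 + v\<^sup>2" by (simp add: r_def)
  have b: "-1 \<le> u / r" "u / r \<le> 1" using polar_cos_bound[of u v] by (simp_all add: r_def)
  have "(u / r)\<^sup>2 + (v / r)\<^sup>2 = r\<^sup>2 / r\<^sup>2"
    by (simp only: r2 power_divide add_divide_distrib)
  then have sq: "(u / r)\<^sup>2 + (v / r)\<^sup>2 = 1" using r by simp
  have "sin (arccos (u / r)) = sqrt (1 - (u / r)\<^sup>2)" using b by (rule sin_arccos)
  also have "1 - (u / r)\<^sup>2 = (v / r)\<^sup>2"
    using sq by simp
  also have "sqrt ((v / r)\<^sup>2) = v / r" using r assms by (simp add: w)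
  finally have s: "sin (arccos (u / r)) = v / r" .
  have "plane_to_strip w = (ln r / pi, arccos (u / r) / pi)"
    by (simp add: plane_to_strip_def w r_def)
  then show ?thesis using r b s by (simp add: strip_to_plane_def w)
qed

lemma plane_to_strip_strip: "plane_to_strip w \<in> UNIV \<times> {0..1}"
  using polar_cos_bound[of "fst w" "snd w"]
  by (auto simp: plane_to_strip_def intro!: divide_nonneg_nonneg arccos_lbound arccos_ubound)

lemma plane_to_strip_boundary:
  assumes "snd w \<ge> 0" "w \<noteq> 0" "plane_to_strip w \<in> UNIV \<times> {0, 1}"
  shows "snd w = 0"
proof -
  have "snd (strip_to_plane (plane_to_strip w)) = 0"
    using assms(3) by (cases "plane_to_strip w") (auto simp: strip_to_plane_def)
  then show ?thesis using strip_to_plane_plane_to_strip[OF assms(1,2)] by simp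
qed

lemma continuous_on_plane_to_strip: "continuous_on (- {0}) plane_to_strip"
proof -
  have nz: "sqrt ((fst w)\<^sup>2 + (snd w)\<^sup>2) > 0" if "w \<in> - {0}" for w :: "real \<times> real"
    using that by (cases w) (auto simp: zero_prod_def sum_power2_gt_zero_iff)
  have nz': "\<forall>w \<in> - {0}. sqrt ((fst w)\<^sup>2 + (snd w)\<^sup>2) \<noteq> 0" for w :: "real \<times> real"
    using nz by (metis less_irrefl)
  have c: "continuous_on (- {0}) (\<lambda>w :: real \<times> real. sqrt ((fst w)\<^sup>2 + (snd w)\<^sup>2))"
    by (intro continuous_intros)
  have l: "continuous_on (- {0}) (\<lambda>w :: real \<times> real. ln (sqrt ((fst w)\<^sup>2 + (snd w)\<^sup>2)))"
    using c nz' by (rule continuous_on_ln)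
  have "continuous_on (- {0}) (\<lambda>w :: real \<times> real. fst w / sqrt ((fst w)\<^sup>2 + (snd w)\<^sup>2))"
    using _ c nz' by (rule continuous_on_divide) (intro continuous_intros)
  then have a: "continuous_on (- {0}) (\<lambda>w :: real \<times> real. arccos (fst w / sqrt ((fst w)\<^sup>2 + (snd w)\<^sup>2)))"
    by (rule continuous_on_arccos) (use polar_cos_bound in blast)
  show ?thesis
    unfolding plane_to_strip_def
    by (intro continuous_on_Pair continuous_on_divide continuous_on_const l a) simp_all
qed

lemma continuous_on_strip_to_plane: "continuous_on A strip_to_plane"
  unfolding strip_to_plane_def by (intro continuous_intros)

subsection \<open>Disjoint arcs do not link on the boundary\<close>

lemma arc_as_directed_path:
  assumes "arc g" "{pathstart g, pathfinish g} = {A, C}"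
  obtains h where "path h" "path_image h = path_image g" "pathstart h = A" "pathfinish h = C"
proof (cases "pathstart g = A")
  case True
  with assms have "pathfinish g = C" by (auto simp: doubleton_eq_iff)
  with True assms show ?thesis by (intro that[of g]) (auto simp: arc_imp_path)
next
  case False
  with assms have "pathfinish g = A" "pathstart g = C" by (auto simp: doubleton_eq_iff)
  with assms show ?thesis by (intro that[of "reversepath g"]) (auto simp: arc_imp_path)
qed

text \<open>A large box standing on the real axis contains both paths, and all four endpoints lie on its
  lower side, so this is the Fashoda theorem in its interlaced form.\<close>

lemma half_plane_interlace:
  fixes f g :: "real \<Rightarrow> real \<times> real"
  assumes f: "path f" "path_image f \<subseteq> UNIV \<times> {0..}" "pathstart f = (a, 0)" "pathfinish f = (c, 0)"
    and g: "path g" "path_image g \<subseteq> UNIV \<times> {0..}" "pathstart g = (b, 0)" "pathfinish g = (d, 0)"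
    and less: "a < b" "b < c" "c < d"
  shows "path_image f \<inter> path_image g \<noteq> {}"
proof -
  define V :: "real \<times> real \<Rightarrow> real^2" where "V = (\<lambda>z. \<chi> i. if i = 1 then fst z else snd z)"
  have V: "V z $ 1 = fst z" "V z $ 2 = snd z" for z by (auto simp: V_def)
  have contV: "continuous_on A V" for A
  proof -
    have "continuous_on A (\<lambda>z. if i = 1 then fst z else snd z)" for i :: 2
      by (cases "i = 1") (auto intro!: continuous_intros)
    then show ?thesis unfolding V_def by (intro continuous_on_vec_lambda)
  qed
  have injV: "V z = V w \<Longrightarrow> z = w" for z w
    by (metis V prod_eqI)
  have "bounded (path_image f \<union> path_image g)"
    using f g by (simp add: bounded_path_image)
  then obtain B where B: "\<And>z. z \<in> path_image f \<union> path_image g \<Longrightarrow> norm z \<le> B"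
    by (auto simp: bounded_iff)
  have box: "V z \<in> cbox (vector [-B, 0]) (vector [B, B])" if "z \<in> path_image f \<union> path_image g" for z
  proof -
    have "\<bar>fst z\<bar> \<le> B" "\<bar>snd z\<bar> \<le> B"
      using B[OF that] norm_fst_le[of "fst z" "snd z"] norm_snd_le[of "snd z" "fst z"] by auto
    moreover have "snd z \<ge> 0" using that f(2) g(2) by auto
    ultimately show ?thesis by (auto simp: mem_box_cart forall_2 V abs_le_iff)
  qed
  obtain w where "w \<in> path_image (V \<circ> f)" "w \<in> path_image (V \<circ> g)"
  proof (rule fashoda_interlace[of "V \<circ> f" "V \<circ> g" "vector [-B, 0]" "vector [B, B]"])
    show "path (V \<circ> f)" "path (V \<circ> g)"
      using f g by (auto intro!: path_continuous_image contV)
    show "path_image (V \<circ> f) \<subseteq> cbox (vector [-B, 0]) (vector [B, B])"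
      "path_image (V \<circ> g) \<subseteq> cbox (vector [-B, 0]) (vector [B, B])"
      using box by (auto simp: path_image_compose)
  qed (use f g less in \<open>auto simp: pathstart_compose pathfinish_compose V\<close>)
  then show ?thesis using injV by (auto simp: path_image_compose dest!: injV)
qed

lemma crossingless_imp_noncrossing:
  assumes "M \<in> crossingless p q"
  shows "noncrossing M"
proof (rule ccontr)
  assume "\<not> noncrossing M"
  then obtain e f a b c d where ef: "e \<in> M" "f \<in> M" and m: "a \<in> e" "b \<in> f" "c \<in> e" "d \<in> f"
    and less: "boundary_order a < boundary_order b" "boundary_order b < boundary_order c"
      "boundary_order c < boundary_order d"
    unfolding noncrossing_def by blast
  from assms obtain \<gamma> where pm: "matching p q M"
    and all: "\<forall>e\<in>M. arc (\<gamma> e) \<and> path_image (\<gamma> e) \<subseteq> UNIV \<times> {0..1} \<and>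
                   {pathstart (\<gamma> e), pathfinish (\<gamma> e)} = plane_point ` e"
    and dis: "disjoint_family_on (\<lambda>e. path_image (\<gamma> e)) M"
    unfolding crossingless_def by blast
  have \<gamma>: "\<And>e. e \<in> M \<Longrightarrow> arc (\<gamma> e)" "\<And>e. e \<in> M \<Longrightarrow> path_image (\<gamma> e) \<subseteq> UNIV \<times> {0..1}"
      "\<And>e. e \<in> M \<Longrightarrow> {pathstart (\<gamma> e), pathfinish (\<gamma> e)} = plane_point ` e"
    using all by auto
  have card: "card e = 2" "card f = 2" using pm ef by (auto simp: perfect_matching_def)
  have ac: "a \<noteq> c" "b \<noteq> d" using less by auto
  have e: "e = {a, c}" using card m ac by (auto simp: card_2_iff)
  have f: "f = {b, d}" using card m ac by (auto simp: card_2_iff)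
  have mp: "a \<in> marked_points p q" "b \<in> marked_points p q" "c \<in> marked_points p q" "d \<in> marked_points p q"
    using perfect_matching_block_subset[OF pm ef(1)] perfect_matching_block_subset[OF pm ef(2)] m by auto
  have "e \<noteq> f"
  proof
    assume "e = f"
    then have "b = a \<or> b = c" using e m by auto
    then show False using less by auto
  qed
  then have disj: "path_image (\<gamma> e) \<inter> path_image (\<gamma> f) = {}"
    using dis ef by (auto simp: disjoint_family_on_def)
  obtain g where g: "path g" "path_image g = path_image (\<gamma> e)"
      "pathstart g = plane_point a" "pathfinish g = plane_point c"
    using arc_as_directed_path[of "\<gamma> e" "plane_point a" "plane_point c"] \<gamma>[OF ef(1)] e by auto
  obtain h where h: "path h" "path_image h = path_image (\<gamma> f)"
      "pathstart h = plane_point b" "pathfinish h = plane_point d"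
    using arc_as_directed_path[of "\<gamma> f" "plane_point b" "plane_point d"] \<gamma>[OF ef(2)] f by auto
  have inj: "z = w" if "strip_to_plane z = strip_to_plane w" "z \<in> UNIV \<times> {0..1}" "w \<in> UNIV \<times> {0..1}" for z w
  proof -
    have n: "(fst (strip_to_plane z))\<^sup>2 + (snd (strip_to_plane z))\<^sup>2 = (exp (pi * fst z))\<^sup>2" for z
      by (simp add: strip_to_plane_def power_mult_distrib flip: distrib_left)
    have "(exp (pi * fst z))\<^sup>2 = (exp (pi * fst w))\<^sup>2" using n[of z] n[of w] that(1) by simp
    then have x: "fst z = fst w" by (simp add: power2_eq_iff_nonneg)
    then have "cos (pi * snd z) = cos (pi * snd w)"
      using that(1) by (simp add: strip_to_plane_def)
    then have "pi * snd z = pi * snd w"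
    proof (rule cos_inj_pi[rotated 4])
    qed (use that(2,3) in \<open>auto simp: mem_Times_iff\<close>)
    then show ?thesis using x by (simp add: prod_eqI)
  qed
  have "path_image (strip_to_plane \<circ> g) \<inter> path_image (strip_to_plane \<circ> h) \<noteq> {}"
  proof (rule half_plane_interlace)
    show "path (strip_to_plane \<circ> g)" "path (strip_to_plane \<circ> h)"
      using g h by (auto intro!: path_continuous_image continuous_on_strip_to_plane)
    have nn: "snd (strip_to_plane z) \<ge> 0" if "z \<in> path_image (\<gamma> e) \<union> path_image (\<gamma> f)" for z
      using that \<gamma>(2)[OF ef(1)] \<gamma>(2)[OF ef(2)] by (intro strip_to_plane_nonneg) blast
    show "path_image (strip_to_plane \<circ> g) \<subseteq> UNIV \<times> {0..}" "path_image (strip_to_plane \<circ> h) \<subseteq> UNIV \<times> {0..}"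
      using nn by (simp_all add: path_image_compose g(2) h(2) image_subset_iff mem_Times_iff)
    show "axis_position a < axis_position b" "axis_position b < axis_position c"
      "axis_position c < axis_position d"
      using axis_position_less mp less by auto
  qed (simp_all add: pathstart_compose pathfinish_compose g h strip_to_plane_plane_point[OF mp(1)]
      strip_to_plane_plane_point[OF mp(2)] strip_to_plane_plane_point[OF mp(3)] strip_to_plane_plane_point[OF mp(4)])
  then obtain z w where zw: "z \<in> path_image (\<gamma> e)" "w \<in> path_image (\<gamma> f)"
      "strip_to_plane z = strip_to_plane w"
    unfolding path_image_compose g(2) h(2) by blast
  have "z = w"
    using inj[OF zw(3)] zw \<gamma>(2)[OF ef(1)] \<gamma>(2)[OF ef(2)] by blast
  then show False using zw disj by blast
qed

subsection \<open>Drawing a noncrossing matching by semicircles\<close>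

text \<open>The arcs that witness a crossingless matching may touch the two boundary lines away from their
  endpoints, and then a drawing stacked on the other side of that line could meet them there.
  The last condition on each arc excludes this.\<close>

definition clean_drawing ::
  "(nat \<times> nat) set set \<Rightarrow> ((nat \<times> nat) set \<Rightarrow> real \<Rightarrow> real \<times> real) \<Rightarrow> bool" where
  "clean_drawing M \<gamma> \<longleftrightarrow>
     (\<forall>e\<in>M. arc (\<gamma> e) \<and> path_image (\<gamma> e) \<subseteq> UNIV \<times> {0..1} \<and>
        {pathstart (\<gamma> e), pathfinish (\<gamma> e)} = plane_point ` e \<and>
        path_image (\<gamma> e) \<inter> UNIV \<times> {0, 1} \<subseteq> plane_point ` e) \<and>
     disjoint_family_on (\<lambda>e. path_image (\<gamma> e)) M"

definition semicircle :: "real \<Rightarrow> real \<Rightarrow> real \<Rightarrow> real \<times> real" where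
  "semicircle s t \<tau> = (s + \<tau> * (t - s), (t - s) * sqrt (\<tau> * (1 - \<tau>)))"

lemma semicircle_points:
  assumes "s < t" "w \<in> path_image (semicircle s t)"
  shows "s \<le> fst w" "fst w \<le> t" "snd w \<ge> 0" "(snd w)\<^sup>2 = (fst w - s) * (t - fst w)"
proof -
  from assms(2) obtain \<tau> where \<tau>: "0 \<le> \<tau>" "\<tau> \<le> 1" and w: "w = semicircle s t \<tau>"
    by (auto simp: path_image_def)
  show "s \<le> fst w" "snd w \<ge> 0" using \<tau> assms(1) by (auto simp: w semicircle_def)
  have "\<tau> * (t - s) \<le> 1 * (t - s)" using \<tau> assms(1) by (intro mult_right_mono) auto
  then show "fst w \<le> t" by (simp add: w semicircle_def)
  have "(snd w)\<^sup>2 = (t - s)\<^sup>2 * (\<tau> * (1 - \<tau>))"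
    using \<tau> by (simp add: w semicircle_def power_mult_distrib)
  also have "\<dots> = (fst w - s) * (t - fst w)"
    by (simp add: w semicircle_def power2_eq_square algebra_simps)
  finally show "(snd w)\<^sup>2 = (fst w - s) * (t - fst w)" .
qed

lemma semicircle_nonzero:
  assumes "s < t" "s \<noteq> 0" "t \<noteq> 0" "w \<in> path_image (semicircle s t)"
  shows "w \<noteq> 0"
  using semicircle_points(4)[OF assms(1,4)] assms by auto

text \<open>At abscissa \<open>x\<close> the semicircle over \<open>[s, t]\<close> has squared height \<open>(x - s)(t - x)\<close>, which strictly
  increases when the interval grows on both sides.\<close>

lemma semicircles_disjoint:
  assumes st: "s < t" and st': "s' < t'" and ne: "s \<noteq> s'" "s \<noteq> t'" "t \<noteq> s'" "t \<noteq> t'"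
    and nc: "\<not> (s < s' \<and> s' < t \<and> t < t')" "\<not> (s' < s \<and> s < t' \<and> t' < t)"
  shows "path_image (semicircle s t) \<inter> path_image (semicircle s' t') = {}"
proof (rule ccontr)
  have nested: False if "s < s'" "t' < t" "s' \<le> x" "x \<le> t'" "(x - s) * (t - x) = (x - s') * (t' - x)"
    for s t s' t' x :: real
  proof -
    have "(x - s') * (t' - x) \<le> (x - s') * (t - x)" using that by (intro mult_left_mono) auto
    also have "\<dots> < (x - s) * (t - x)" using that by (intro mult_strict_right_mono) auto
    finally show False using that by simp
  qed
  assume "path_image (semicircle s t) \<inter> path_image (semicircle s' t') \<noteq> {}"
  then obtain w where w: "w \<in> path_image (semicircle s t)" "w \<in> path_image (semicircle s' t')"
    by blast
  note p = semicircle_points[OF st w(1)] semicircle_points[OF st' w(2)]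
  have eq: "(fst w - s) * (t - fst w) = (fst w - s') * (t' - fst w)" using p by simp
  consider "s < s'" "t' < t" | "s' < s" "t < t'" | "t < s' \<or> t' < s"
    using ne nc st st' by linarith
  then show False
  proof cases
    case 1 then show False using nested[of s s' t' t "fst w"] eq p by auto
  next
    case 2 then show False using nested[of s' s t t' "fst w"] eq p by auto
  next
    case 3 then show False using p by auto
  qed
qed

lemma plane_to_strip_semicircle:
  assumes "s < t" "s \<noteq> 0" "t \<noteq> 0"
  shows "arc (plane_to_strip \<circ> semicircle s t)"
    "pathstart (plane_to_strip \<circ> semicircle s t) = plane_to_strip (s, 0)"
    "pathfinish (plane_to_strip \<circ> semicircle s t) = plane_to_strip (t, 0)"
    "path_image (plane_to_strip \<circ> semicircle s t) \<inter> UNIV \<times> {0, 1} \<subseteq>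
       {plane_to_strip (s, 0), plane_to_strip (t, 0)}"
proof -
  have path: "path (semicircle s t)"
    unfolding path_def semicircle_def by (intro continuous_intros)
  have arc: "arc (semicircle s t)"
    using assms path by (auto simp: arc_def inj_on_def semicircle_def)
  note nz = semicircle_nonzero[OF assms]
  show "arc (plane_to_strip \<circ> semicircle s t)"
    unfolding arc_def
  proof (intro conjI path_continuous_image[OF path] comp_inj_on)
    show "continuous_on (path_image (semicircle s t)) plane_to_strip"
      by (rule continuous_on_subset[OF continuous_on_plane_to_strip]) (use nz in blast)
    show "inj_on (semicircle s t) {0..1}" using arc by (simp add: arc_def)
    show "inj_on plane_to_strip (semicircle s t ` {0..1})"
      unfolding path_image_def[symmetric]
      by (rule inj_on_inverseI[of _ strip_to_plane])
        (use nz semicircle_points[OF assms(1)] in \<open>blast intro: strip_to_plane_plane_to_strip\<close>)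
  qed
  show "pathstart (plane_to_strip \<circ> semicircle s t) = plane_to_strip (s, 0)"
    "pathfinish (plane_to_strip \<circ> semicircle s t) = plane_to_strip (t, 0)"
    by (simp_all add: pathstart_def pathfinish_def semicircle_def)
  show "path_image (plane_to_strip \<circ> semicircle s t) \<inter> UNIV \<times> {0, 1} \<subseteq>
       {plane_to_strip (s, 0), plane_to_strip (t, 0)}"
  proof
    fix z assume z: "z \<in> path_image (plane_to_strip \<circ> semicircle s t) \<inter> UNIV \<times> {0, 1}"
    then obtain w where w: "w \<in> path_image (semicircle s t)" "z = plane_to_strip w"
      unfolding path_image_compose by blast
    note p = semicircle_points[OF assms(1) w(1)]
    have y: "snd w = 0" using plane_to_strip_boundary[OF p(3) nz[OF w(1)]] z unfolding w(2) by simp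
    then have "fst w = s \<or> fst w = t" using p(4) by auto
    then have "w = (s, 0) \<or> w = (t, 0)" using y by (auto simp: prod_eq_iff)
    then show "z \<in> {plane_to_strip (s, 0), plane_to_strip (t, 0)}" using w(2) by auto
  qed
qed

lemma axis_position_nonzero: "axis_position v \<noteq> 0"
  by (simp add: axis_position_def)

lemma noncrossing_imp_clean_drawing:
  assumes pm: "matching p q M" and nc: "noncrossing M"
  obtains \<gamma> where "clean_drawing M \<gamma>"
proof
  define \<gamma> where "\<gamma> e = plane_to_strip \<circ> semicircle (Min (axis_position ` e)) (Max (axis_position ` e))"
    for e
  have blk: "\<exists>a c. e = {a, c} \<and> boundary_order a < boundary_order c \<and> axis_position a < axis_position c \<and>
        a \<in> marked_points p q \<and> c \<in> marked_points p q \<and>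
        \<gamma> e = plane_to_strip \<circ> semicircle (axis_position a) (axis_position c)" if e: "e \<in> M" for e
  proof -
    obtain a c where ac: "e = {a, c}" "boundary_order a < boundary_order c"
      "a \<in> marked_points p q" "c \<in> marked_points p q"
      using marked_block_endpoints[OF pm e] .
    then have "axis_position a < axis_position c" by (intro axis_position_less)
    moreover from this have "Min (axis_position ` e) = axis_position a" "Max (axis_position ` e) = axis_position c"
      using ac(1) by auto
    ultimately show ?thesis using ac unfolding \<gamma>_def by metis
  qed
  show "clean_drawing M \<gamma>"
    unfolding clean_drawing_def disjoint_family_on_def
  proof (intro conjI ballI impI)
    fix e assume "e \<in> M"
    then obtain a c where e: "e = {a, c}" "axis_position a < axis_position c"
        "a \<in> marked_points p q" "c \<in> marked_points p q"
        "\<gamma> e = plane_to_strip \<circ> semicircle (axis_position a) (axis_position c)"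
      using blk by blast
    note sc = plane_to_strip_semicircle[OF e(2) axis_position_nonzero axis_position_nonzero]
    have img: "plane_point ` e = {plane_point a, plane_point c}" using e(1) by simp
    show "arc (\<gamma> e)" using sc e(5) by simp
    show "path_image (\<gamma> e) \<subseteq> UNIV \<times> {0..1}"
      unfolding e(5) path_image_compose using plane_to_strip_strip by blast
    show "{pathstart (\<gamma> e), pathfinish (\<gamma> e)} = plane_point ` e"
      "path_image (\<gamma> e) \<inter> UNIV \<times> {0, 1} \<subseteq> plane_point ` e"
      using sc(2-4) unfolding img e(5) plane_to_strip_axis_position[OF e(3)]
        plane_to_strip_axis_position[OF e(4)] by auto
  next
    fix e f assume ef: "e \<in> M" "f \<in> M" "e \<noteq> f"
    obtain a c where e: "e = {a, c}" "axis_position a < axis_position c" "boundary_order a < boundary_order c"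
        "a \<in> marked_points p q" "c \<in> marked_points p q"
        "\<gamma> e = plane_to_strip \<circ> semicircle (axis_position a) (axis_position c)"
      using blk[OF ef(1)] by blast
    obtain b d where f: "f = {b, d}" "axis_position b < axis_position d" "boundary_order b < boundary_order d"
        "b \<in> marked_points p q" "d \<in> marked_points p q"
        "\<gamma> f = plane_to_strip \<circ> semicircle (axis_position b) (axis_position d)"
      using blk[OF ef(2)] by blast
    have ne: "a \<noteq> b" "a \<noteq> d" "c \<noteq> b" "c \<noteq> d"
      using perfect_matching_block_unique[OF pm ef(1,2)] ef(3) unfolding e(1) f(1) by blast+
    have iff: "axis_position v < axis_position w \<longleftrightarrow> boundary_order v < boundary_order w"
      if "v \<in> marked_points p q" "w \<in> marked_points p q" for v w
    proof
      assume less: "axis_position v < axis_position w"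
      show "boundary_order v < boundary_order w"
      proof (rule ccontr)
        assume "\<not> ?thesis"
        then have "boundary_order w < boundary_order v \<or> w = v"
          using inj_onD[OF inj_on_boundary_order _ that(2,1)] by linarith
        then show False using axis_position_less[OF that(2,1)] less by auto
      qed
    qed (rule axis_position_less[OF that])
    have neq: "axis_position v \<noteq> axis_position w"
      if "v \<in> marked_points p q" "w \<in> marked_points p q" "v \<noteq> w" for v w
    proof -
      have "boundary_order v \<noteq> boundary_order w"
        using inj_onD[OF inj_on_boundary_order _ that(1,2)] that(3) by blast
      then have "boundary_order v < boundary_order w \<or> boundary_order w < boundary_order v" by linarith
      then show ?thesis using axis_position_less[OF that(1,2)] axis_position_less[OF that(2,1)] by auto
    qed
    have dis: "path_image (semicircle (axis_position a) (axis_position c)) \<inter>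
        path_image (semicircle (axis_position b) (axis_position d)) = {}"
    proof (rule semicircles_disjoint[OF e(2) f(2)])
      show "axis_position a \<noteq> axis_position b" "axis_position a \<noteq> axis_position d"
        "axis_position c \<noteq> axis_position b" "axis_position c \<noteq> axis_position d"
        using neq e f ne by auto
      show "\<not> (axis_position a < axis_position b \<and> axis_position b < axis_position c \<and> axis_position c < axis_position d)"
        "\<not> (axis_position b < axis_position a \<and> axis_position a < axis_position d \<and> axis_position d < axis_position c)"
        using noncrossingD[OF nc ef(1,2), of a b c d] noncrossingD[OF nc ef(2,1), of b a d c]
          iff[OF e(4) f(4)] iff[OF f(4) e(5)] iff[OF e(5) f(5)]
          iff[OF f(4) e(4)] iff[OF e(4) f(5)] iff[OF f(5) e(5)]
        by (simp_all add: e(1) f(1))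
    qed
    have inv: "strip_to_plane (plane_to_strip w) = w"
      if "w \<in> path_image (semicircle s t)" "s < t" "s \<noteq> 0" "t \<noteq> 0" for w s t
      using strip_to_plane_plane_to_strip semicircle_points(3) semicircle_nonzero that by blast
    show "path_image (\<gamma> e) \<inter> path_image (\<gamma> f) = {}"
    proof (rule ccontr)
      assume "path_image (\<gamma> e) \<inter> path_image (\<gamma> f) \<noteq> {}"
      then obtain w w' where w: "w \<in> path_image (semicircle (axis_position a) (axis_position c))"
          "w' \<in> path_image (semicircle (axis_position b) (axis_position d))"
          "plane_to_strip w = plane_to_strip w'"
        unfolding e(6) f(6) path_image_compose by blast
      have "w = w'"
        using inv[OF w(1) e(2) axis_position_nonzero axis_position_nonzero]
          inv[OF w(2) f(2) axis_position_nonzero axis_position_nonzero] w(3) by metis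
      then have "w \<in> path_image (semicircle (axis_position a) (axis_position c)) \<inter>
          path_image (semicircle (axis_position b) (axis_position d))"
        using w(1,2) by simp
      then show False unfolding dis by simp
    qed
  qed
qed

theorem crossingless_iff:
  "M \<in> crossingless p q \<longleftrightarrow> matching p q M \<and> noncrossing M"
proof
  assume "M \<in> crossingless p q"
  then show "matching p q M \<and> noncrossing M"
    using crossingless_imp_noncrossing by (auto simp: crossingless_def)
next
  assume M: "matching p q M \<and> noncrossing M"
  then obtain \<gamma> where \<gamma>: "clean_drawing M \<gamma>" by (metis noncrossing_imp_clean_drawing)
  show "M \<in> crossingless p q"
    unfolding crossingless_def mem_Collect_eq
    by (intro conjI exI[of _ \<gamma>]) (use M \<gamma> in \<open>simp_all add: clean_drawing_def\<close>)
qed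

lemma crossingless_clean_drawing:
  assumes "M \<in> crossingless p q"
  obtains \<gamma> where "clean_drawing M \<gamma>"
proof -
  have "matching p q M" "noncrossing M"
    using assms by (simp_all add: crossingless_iff)
  then show thesis using that by (rule noncrossing_imp_clean_drawing)
qed

lemma crossingless_perfect_matching:
  "M \<in> crossingless p q \<Longrightarrow> matching p q M"
  by (simp add: crossingless_iff)


section \<open>Two-colourings of a partition\<close>

text \<open>The set of vertices of one colour in a two-colouring that is constant on the members of \<open>C\<close>.\<close>

definition saturated :: "'a set set \<Rightarrow> 'a set \<Rightarrow> bool" where
  "saturated C X \<longleftrightarrow> (\<forall>K\<in>C. K \<subseteq> X \<or> K \<inter> X = {})"

text \<open>A block is the smallest saturated set through each of its points.\<close>

lemma saturated_partition_eq:
  assumes P: "partition_on P C" "partition_on P D"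
    and sat: "\<And>X. X \<subseteq> P \<Longrightarrow> saturated C X \<longleftrightarrow> saturated D X"
  shows "C = D"
proof -
  have "C \<subseteq> D" if P: "partition_on P C" "partition_on P D"
    and sat: "\<And>X. X \<subseteq> P \<Longrightarrow> saturated C X \<longleftrightarrow> saturated D X" for C D
  proof
    fix e assume e: "e \<in> C"
    then have "e \<noteq> {}" "e \<subseteq> P" using P(1) by (auto simp: partition_on_def)
    then obtain x where x: "x \<in> e" "x \<in> P" by blast
    then obtain f where f: "f \<in> D" "x \<in> f" "f \<subseteq> P" using P(2) by (auto simp: partition_on_def)
    have "saturated C e" using e P(1) by (auto simp: saturated_def partition_on_def disjoint_def)
    then have "saturated D e" using sat \<open>e \<subseteq> P\<close> by blast
    then have "f \<subseteq> e" using f x by (auto simp: saturated_def)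
    have "saturated D f" using f P(2) by (auto simp: saturated_def partition_on_def disjoint_def)
    then have "saturated C f" using sat \<open>f \<subseteq> P\<close> by blast
    then have "e \<subseteq> f" using e f x by (auto simp: saturated_def)
    with \<open>f \<subseteq> e\<close> f show "e \<in> D" by simp
  qed
  from this[of C D] this[of D C] show ?thesis using assms by (intro equalityI) auto
qed

text \<open>The trace \<open>Q\<close> on \<open>U\<close> forces the colour of every block that meets \<open>U\<close>, and all other blocks are free.\<close>

lemma card_saturated:
  assumes C: "partition_on V C" "finite V" and Q: "Q \<subseteq> V \<inter> U"
  shows "card {X. X \<subseteq> V \<and> saturated C X \<and> X \<inter> U = Q} =
    (if \<forall>K\<in>C. K \<inter> U \<subseteq> Q \<or> K \<inter> Q = {} then 2 ^ card {K\<in>C. K \<inter> U = {}} else 0)"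
proof (cases "\<forall>K\<in>C. K \<inter> U \<subseteq> Q \<or> K \<inter> Q = {}")
  case False
  have "{X. X \<subseteq> V \<and> saturated C X \<and> X \<inter> U = Q} = {}"
  proof (rule ccontr)
    assume "{X. X \<subseteq> V \<and> saturated C X \<and> X \<inter> U = Q} \<noteq> {}"
    then obtain X where X: "saturated C X" "X \<inter> U = Q" by blast
    from False obtain K where K: "K \<in> C" "\<not> K \<inter> U \<subseteq> Q" "K \<inter> Q \<noteq> {}" by blast
    have "K \<subseteq> X \<or> K \<inter> X = {}" using X(1) K(1) by (simp add: saturated_def)
    then show False using K X(2) by blast
  qed
  then show ?thesis using False by (simp only: if_False) simp
next
  case True
  define L where "L = {K\<in>C. K \<inter> U = {}}"
  define Y where "Y = (\<lambda>F. \<Union> {K\<in>C. K \<inter> Q \<noteq> {}} \<union> \<Union> F)"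
  have dis: "K = K'" if "K \<in> C" "K' \<in> C" "x \<in> K" "x \<in> K'" for K K' x
    using C(1) that unfolding partition_on_def disjoint_def by blast
  have U: "\<Union> C = V" and ne: "{} \<notin> C" using C(1) by (auto simp: partition_on_def)
  have mem: "x \<in> Y F \<longleftrightarrow> K \<in> F \<or> K \<inter> Q \<noteq> {}" if "F \<subseteq> C" "K \<in> C" "x \<in> K" for F K x
    using that dis unfolding Y_def by blast
  have "bij_betw Y (Pow L) {X. X \<subseteq> V \<and> saturated C X \<and> X \<inter> U = Q}"
  proof (rule bij_betwI')
    fix F G assume "F \<in> Pow L" "G \<in> Pow L"
    then have FG: "F \<subseteq> L" "G \<subseteq> L" by auto
    show "Y F = Y G \<longleftrightarrow> F = G"
    proof
      assume eq: "Y F = Y G"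
      have *: "K \<in> F \<longleftrightarrow> K \<in> G" if "K \<in> L" for K
      proof -
        have K: "K \<in> C" "K \<inter> U = {}" using that by (auto simp: L_def)
        obtain x where "x \<in> K" using ne K by (metis ex_in_conv)
        moreover have "K \<inter> Q = {}" using K Q by blast
        ultimately show ?thesis using mem[of F K x] mem[of G K x] K FG eq unfolding L_def by blast
      qed
      then show "F = G" using FG by blast
    qed simp
  next
    fix F assume "F \<in> Pow L"
    then have F: "F \<subseteq> C" "\<And>K. K \<in> F \<Longrightarrow> K \<inter> U = {}" by (auto simp: L_def)
    have "Y F \<subseteq> V" using F U unfolding Y_def by blast
    moreover have "saturated C (Y F)" using mem[OF F(1)] unfolding saturated_def by blast
    moreover have "Y F \<inter> U = Q"
    proof (intro equalityI subsetI)
      fix x assume x: "x \<in> Y F \<inter> U"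
      then have "x \<in> V" using \<open>Y F \<subseteq> V\<close> by blast
      then obtain K where K: "K \<in> C" "x \<in> K" using U by blast
      then show "x \<in> Q" using mem[OF F(1) K] F(2)[of K] True x by blast
    next
      fix x assume x: "x \<in> Q"
      then have "x \<in> V" "x \<in> U" using Q by auto
      then obtain K where K: "K \<in> C" "x \<in> K" using U by blast
      then show "x \<in> Y F \<inter> U" using mem[OF F(1) K] x \<open>x \<in> U\<close> by blast
    qed
    ultimately show "Y F \<in> {X. X \<subseteq> V \<and> saturated C X \<and> X \<inter> U = Q}" by simp
  next
    fix X assume "X \<in> {X. X \<subseteq> V \<and> saturated C X \<and> X \<inter> U = Q}"
    then have X: "X \<subseteq> V" "saturated C X" "X \<inter> U = Q" by auto
    have "X = Y {K\<in>L. K \<subseteq> X}"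
    proof (rule Set.set_eqI)
      fix x
      show "x \<in> X \<longleftrightarrow> x \<in> Y {K\<in>L. K \<subseteq> X}"
      proof (cases "x \<in> V")
        case True
        then obtain K where K: "K \<in> C" "x \<in> K" using U by blast
        have s: "K \<subseteq> X \<or> K \<inter> X = {}" using X(2) K(1) by (simp add: saturated_def)
        have "x \<in> Y {K\<in>L. K \<subseteq> X} \<longleftrightarrow> K \<in> {K\<in>L. K \<subseteq> X} \<or> K \<inter> Q \<noteq> {}"
          by (rule mem) (use K in \<open>auto simp: L_def\<close>)
        then show ?thesis using s K X(3) unfolding L_def by blast
      next
        case False
        then show ?thesis using X(1) U unfolding Y_def L_def by blast
      qed
    qed
    then show "\<exists>F\<in>Pow L. X = Y F" by blast
  qed
  then have "card {X. X \<subseteq> V \<and> saturated C X \<and> X \<inter> U = Q} = card (Pow L)"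
    by (simp add: bij_betw_same_card)
  moreover have "finite L" using finite_elements[OF C(2,1)] by (simp add: L_def)
  ultimately show ?thesis using True by (simp add: card_Pow L_def)
qed

section \<open>Connected components\<close>

lemma sym_edge_relation: "sym ({(u, v). {u, v} \<in> E}\<^sup>*)"
  by (rule sym_rtrancl) (auto simp: sym_def insert_commute)

lemma partition_on_components:
  assumes "\<And>e. e \<in> E \<Longrightarrow> e \<subseteq> V"
  shows "partition_on V (V // {(u, v). {u, v} \<in> E}\<^sup>*)"
proof -
  let ?r = "{(u, v). {u, v} \<in> E}"
  have "v \<in> V" if "(u, v) \<in> ?r\<^sup>*" "u \<in> V" for u v
    using that by (induction rule: rtrancl_induct) (use assms in blast)+
  then have eq: "V // ?r\<^sup>* = V // (?r\<^sup>* \<inter> V \<times> V)"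
    unfolding quotient_def by blast
  have "equiv V (?r\<^sup>* \<inter> V \<times> V)"
  proof (rule equivI)
    show "sym (?r\<^sup>* \<inter> V \<times> V)"
      using sym_edge_relation[of E] by (auto simp: sym_def)
    show "trans (?r\<^sup>* \<inter> V \<times> V)"
      by (auto simp: trans_def)
    show "refl_on V (?r\<^sup>* \<inter> V \<times> V)" by (auto simp: refl_on_def)
  qed blast
  then show ?thesis unfolding eq by (rule partition_on_quotient)
qed

lemma component_closed:
  assumes "K \<in> V // {(u, v). {u, v} \<in> E}\<^sup>*" "u \<in> K" "{u, v} \<in> E"
  shows "v \<in> K"
  using assms by (auto simp: quotient_def intro: rtrancl_into_rtrancl)

lemma saturated_components_iff:
  assumes E: "\<And>e. e \<in> E \<Longrightarrow> e \<subseteq> V \<and> card e = 2"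
  shows "saturated (V // {(u, v). {u, v} \<in> E}\<^sup>*) X \<longleftrightarrow> saturated E X"
proof
  let ?r = "{(u, v). {u, v} \<in> E}"
  assume X: "saturated E X"
  have inv: "u \<in> X \<longleftrightarrow> v \<in> X" if "(u, v) \<in> ?r\<^sup>*" for u v
    using that
  proof (induction rule: rtrancl_induct)
    case (step v w)
    then have vw: "{v, w} \<in> E" by simp
    have "{v, w} \<subseteq> X \<or> {v, w} \<inter> X = {}" using X vw unfolding saturated_def by (rule bspec)
    then show ?case using step by blast
  qed simp
  show "saturated (V // ?r\<^sup>*) X"
    unfolding saturated_def quotient_def using inv by blast
next
  let ?r = "{(u, v). {u, v} \<in> E}"
  assume X: "saturated (V // ?r\<^sup>*) X"
  show "saturated E X"
    unfolding saturated_def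
  proof
    fix e assume e: "e \<in> E"
    then obtain u v where uv: "e = {u, v}" "u \<in> V" using E[OF e] by (auto simp: card_2_iff)
    then have "?r\<^sup>* `` {u} \<in> V // ?r\<^sup>*" by (auto simp: quotient_def)
    then have "?r\<^sup>* `` {u} \<subseteq> X \<or> ?r\<^sup>* `` {u} \<inter> X = {}" using X by (simp add: saturated_def)
    moreover have "(u, v) \<in> ?r\<^sup>*" using e uv by auto
    ultimately show "e \<subseteq> X \<or> e \<inter> X = {}" unfolding uv by blast
  qed
qed

text \<open>A connected set of vertices grows from one vertex by adding neighbours, and every new vertex
  brings at least one new edge.\<close>

lemma card_component_le:
  assumes E: "finite E" and K: "finite K" "K = {(u, v). {u, v} \<in> E}\<^sup>* `` {x}"
  shows "card K \<le> card {e \<in> E. e \<subseteq> K} + 1"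
proof -
  have *: "\<exists>R \<subseteq> K. x \<in> R \<and> card R = Suc k \<and> k \<le> card {e \<in> E. e \<subseteq> R}" if "Suc k \<le> card K" for k
    using that
  proof (induction k)
    case 0
    have "x \<in> K" unfolding K(2) by blast
    then show ?case by (intro exI[of _ "{x}"]) auto
  next
    case (Suc k)
    then obtain R where R: "R \<subseteq> K" "x \<in> R" "card R = Suc k" "k \<le> card {e \<in> E. e \<subseteq> R}" by auto
    have "\<exists>u w. u \<in> R \<and> w \<notin> R \<and> {u, w} \<in> E"
    proof (rule ccontr)
      assume "\<not> ?thesis"
      then have "{(u, v). {u, v} \<in> E} `` R \<subseteq> R" by blast
      then have "{(u, v). {u, v} \<in> E}\<^sup>* `` R = R" by (rule Image_closed_trancl)
      then have "K \<subseteq> R" using R(2) unfolding K(2) by blast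
      then have "K = R" using R(1) by blast
      then show False using R(3) Suc.prems by simp
    qed
    then obtain u w where uw: "u \<in> R" "w \<notin> R" "{u, w} \<in> E" by blast
    have "u \<in> K" using R uw by blast
    then have "w \<in> K" using uw(3) unfolding K(2) by (auto intro: rtrancl_into_rtrancl)
    have fin: "finite R" using R(1) K(1) finite_subset by blast
    have "Suc (card {e \<in> E. e \<subseteq> R}) = card (insert {u, w} {e \<in> E. e \<subseteq> R})"
      using E uw by (subst card_insert_disjoint) auto
    also have "\<dots> \<le> card {e \<in> E. e \<subseteq> insert w R}"
      using E uw by (intro card_mono) auto
    finally show ?case
      using R uw \<open>w \<in> K\<close> fin by (intro exI[of _ "insert w R"]) auto
  qed
  have "card K > 0" using K by (auto simp: card_gt_0_iff)
  then obtain k where k: "card K = Suc k" by (cases "card K") auto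
  with *[of k] obtain R where R: "R \<subseteq> K" "card R = card K" "k \<le> card {e \<in> E. e \<subseteq> R}" by auto
  then have "R = K" using K(1) card_subset_eq by blast
  then show ?thesis using R k by simp
qed

section \<open>Stacking two perfect matchings\<close>

lemma inj_raise: "inj raise"
  by (auto simp: inj_def raise_def prod_eq_iff)

lemma partition_on_image:
  assumes "partition_on A P" "inj_on f A"
  shows "partition_on (f ` A) ((image f) ` P)"
proof -
  have "{} \<notin> (image f) ` P" using assms(1) by (auto simp: partition_on_def)
  then show ?thesis using partition_on_inj_image[OF assms] by simp
qed

lemma card_inside_perfect_matching:
  assumes pm: "perfect_matching P M" and fin: "finite P"
    and K: "\<And>e. e \<in> M \<Longrightarrow> e \<subseteq> K \<or> e \<inter> K = {}"
  shows "card (K \<inter> P) = 2 * card {e \<in> M. e \<subseteq> K}"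
proof -
  have M: "\<Union> M = P" "\<And>e. e \<in> M \<Longrightarrow> card e = 2"
    using pm by (auto simp: perfect_matching_def partition_on_def)
  have "K \<inter> P = \<Union> {e \<in> M. e \<subseteq> K}" using M(1) K by blast
  moreover have "finite {e \<in> M. e \<subseteq> K}"
    by (rule finite_subset[of _ "Pow P"]) (use fin M(1) in auto)
  moreover have "2 * card {e \<in> M. e \<subseteq> K} = card (\<Union> {e \<in> M. e \<subseteq> K})"
  proof (rule card_partition)
    show "finite (\<Union> {e \<in> M. e \<subseteq> K})" 
      by (rule finite_subset[of _ P]) (use fin M(1) in auto)
    show "c1 \<inter> c2 = {}" if "c1 \<in> {e \<in> M. e \<subseteq> K}" "c2 \<in> {e \<in> M. e \<subseteq> K}" "c1 \<noteq> c2" for c1 c2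
      using perfect_matching_block_unique[OF pm] that by blast
  qed (use M calculation in auto)
  ultimately show ?thesis by simp
qed

locale stacked_matchings =
  fixes p q r :: nat and a b :: "(nat \<times> nat) set set"
  assumes upper: "matching q r a"
    and lower: "matching p q b"
begin

definition outer :: "(nat \<times> nat) set" where "outer = {v. snd v \<noteq> 1}"

lemma raise_marked_points:
  "raise ` marked_points q r = {v \<in> stack_vertices p q r. snd v \<ge> 1}"
proof -
  have "v \<in> raise ` marked_points q r \<longleftrightarrow> v \<in> {v \<in> stack_vertices p q r. snd v \<ge> 1}" for v
  proof (cases v)
    case (Pair x y)
    show ?thesis
    proof (cases y)
      case 0 then show ?thesis using Pair by (auto simp: raise_def)
    next
      case (Suc z)
      then have "v \<in> raise ` marked_points q r \<longleftrightarrow> (x, z) \<in> marked_points q r"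
        using Pair inj_image_mem_iff[OF inj_raise, of "(x, z)" "marked_points q r"] by (simp add: raise_def)
      then show ?thesis using Pair Suc by (auto simp: marked_points_def stack_vertices_def)
    qed
  qed
  then show ?thesis by blast
qed

lemma lower_marked_points:
  "marked_points p q = {v \<in> stack_vertices p q r. snd v \<le> 1}"
  by (auto simp: marked_points_def stack_vertices_def)

lemma raised_matching:
  "perfect_matching {v \<in> stack_vertices p q r. snd v \<ge> 1} ((image raise) ` a)"
proof -
  have "partition_on (raise ` marked_points q r) ((image raise) ` a)"
    using upper inj_on_subset[OF inj_raise subset_UNIV] unfolding perfect_matching_def
    by (intro partition_on_image) auto
  moreover have "card (raise ` e) = card e" for e
    by (rule card_image) (rule inj_on_subset[OF inj_raise subset_UNIV])
  ultimately show ?thesis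
    using upper unfolding perfect_matching_def raise_marked_points by auto
qed

lemma stack_edge:
  assumes "e \<in> stack_edges a b"
  shows "e \<subseteq> stack_vertices p q r \<and> card e = 2"
proof -
  from assms consider "e \<in> b" | "e \<in> (image raise) ` a" unfolding stack_edges_def by blast
  then show ?thesis
  proof cases
    case 1
    then show ?thesis using perfect_matching_block_subset[OF lower, of e] lower
      unfolding lower_marked_points by (auto simp: perfect_matching_def)
  next
    case 2
    then show ?thesis using perfect_matching_block_subset[OF raised_matching, of e] raised_matching
      by (auto simp: perfect_matching_def)
  qed
qed

lemma finite_stack_vertices: "finite (stack_vertices p q r)"
  by (simp add: stack_vertices_def)

lemma partition_on_stack_components:
  "partition_on (stack_vertices p q r) (stack_components p q r a b)"
  unfolding stack_components_def using stack_edge by (intro partition_on_components) blast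

lemma stack_component_edge:
  assumes K: "K \<in> stack_components p q r a b" and e: "e \<in> stack_edges a b"
  shows "e \<subseteq> K \<or> e \<inter> K = {}"
proof -
  obtain u v where "e = {u, v}" using stack_edge[OF e] by (auto simp: card_2_iff)
  then show ?thesis
    using component_closed[of K "stack_vertices p q r" "stack_edges a b" u v]
      component_closed[of K "stack_vertices p q r" "stack_edges a b" v u] K e
    unfolding stack_components_def by (auto simp: insert_commute)
qed

text \<open>In a component with \<open>t\<close> outer and \<open>c\<close> middle vertices every outer vertex lies on one edge and every
  middle vertex on two, so there are \<open>c + t / 2\<close> edges, while connectedness requires at least
  \<open>c + t - 1\<close>. Hence \<open>t\<close> is even and at most 2.\<close>

lemma card_outer_component:
  assumes K: "K \<in> stack_components p q r a b"
  shows "card (K \<inter> outer) = 0 \<or> card (K \<inter> outer) = 2"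
proof -
  let ?V = "stack_vertices p q r" and ?E = "stack_edges a b"
  have KV: "K \<subseteq> ?V" using K partition_on_stack_components by (auto simp: partition_on_def)
  have fK: "finite K" using KV finite_stack_vertices finite_subset by blast
  have "card (K \<inter> {v \<in> ?V. snd v \<le> 1}) = 2 * card {e \<in> b. e \<subseteq> K}"
    unfolding lower_marked_points[symmetric] using stack_component_edge[OF K]
    by (intro card_inside_perfect_matching[OF lower]) (auto simp: stack_edges_def)
  moreover have "card (K \<inter> {v \<in> ?V. snd v \<ge> 1}) = 2 * card {e \<in> (image raise) ` a. e \<subseteq> K}"
    using stack_component_edge[OF K] finite_stack_vertices
    by (intro card_inside_perfect_matching[OF raised_matching]) (auto simp: stack_edges_def)
  moreover have "card (K \<inter> {v \<in> ?V. snd v \<le> 1}) + card (K \<inter> {v \<in> ?V. snd v \<ge> 1}) =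
      2 * card (K - outer) + card (K \<inter> outer)"
  proof -
    have "card (K \<inter> {v \<in> ?V. snd v \<le> 1}) + card (K \<inter> {v \<in> ?V. snd v \<ge> 1}) =
       card ((K \<inter> {v \<in> ?V. snd v \<le> 1}) \<union> (K \<inter> {v \<in> ?V. snd v \<ge> 1})) +
       card ((K \<inter> {v \<in> ?V. snd v \<le> 1}) \<inter> (K \<inter> {v \<in> ?V. snd v \<ge> 1}))"
      using fK by (intro card_Un_Int) auto
    also have "(K \<inter> {v \<in> ?V. snd v \<le> 1}) \<union> (K \<inter> {v \<in> ?V. snd v \<ge> 1}) = (K - outer) \<union> (K \<inter> outer)"
      using KV by auto
    also have "(K \<inter> {v \<in> ?V. snd v \<le> 1}) \<inter> (K \<inter> {v \<in> ?V. snd v \<ge> 1}) = K - outer"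
      using KV by (auto simp: outer_def)
    also have "card ((K - outer) \<union> (K \<inter> outer)) = card (K - outer) + card (K \<inter> outer)"
      using fK by (intro card_Un_disjoint) auto
    finally show ?thesis by simp
  qed
  moreover have "card K = card (K - outer) + card (K \<inter> outer)"
    using fK by (subst card_Un_disjoint[symmetric]) (auto intro: arg_cong[where f = card])
  moreover have "card K \<le> card {e \<in> b. e \<subseteq> K} + card {e \<in> (image raise) ` a. e \<subseteq> K} + 1"
  proof -
    have "finite ?E"
      by (rule finite_subset[of _ "Pow ?V"]) (use stack_edge finite_stack_vertices in auto)
    moreover obtain x where "K = {(u, v). {u, v} \<in> ?E}\<^sup>* `` {x}"
      using K unfolding stack_components_def quotient_def by blast
    ultimately have "card K \<le> card {e \<in> ?E. e \<subseteq> K} + 1" using fK by (intro card_component_le)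
    also have "{e \<in> ?E. e \<subseteq> K} = {e \<in> b. e \<subseteq> K} \<union> {e \<in> (image raise) ` a. e \<subseteq> K}"
      by (auto simp: stack_edges_def)
    also have "card \<dots> \<le> card {e \<in> b. e \<subseteq> K} + card {e \<in> (image raise) ` a. e \<subseteq> K}"
      by (rule card_Un_le)
    finally show ?thesis by simp
  qed
  ultimately have "card (K \<inter> outer) \<le> 2" "even (card (K \<inter> outer))" by presburger+
  then show ?thesis by presburger
qed

definition collapse :: "nat \<times> nat \<Rightarrow> nat \<times> nat" where "collapse = (\<lambda>(x, y). (x, y div 2))"

lemma inj_on_collapse: "inj_on collapse (stack_vertices p q r \<inter> outer)"
  by (auto simp: inj_on_def collapse_def stack_vertices_def outer_def)

lemma collapse_outer: "collapse ` (stack_vertices p q r \<inter> outer) = marked_points p r"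
proof
  show "collapse ` (stack_vertices p q r \<inter> outer) \<subseteq> marked_points p r"
    by (auto simp: collapse_def stack_vertices_def outer_def marked_points_def)
  show "marked_points p r \<subseteq> collapse ` (stack_vertices p q r \<inter> outer)"
  proof
    fix v assume "v \<in> marked_points p r"
    then have "v = collapse (fst v, 2 * snd v)" "(fst v, 2 * snd v) \<in> stack_vertices p q r \<inter> outer"
      by (auto simp: collapse_def stack_vertices_def outer_def marked_points_def)
    then show "v \<in> collapse ` (stack_vertices p q r \<inter> outer)" by blast
  qed
qed

lemma glue_eq:
  "glue p q r a b =
     (\<lambda>K. collapse ` (K \<inter> outer)) ` {K \<in> stack_components p q r a b. K \<inter> outer \<noteq> {}}"
proof -
  have "{v \<in> K. snd v \<noteq> 1} = K \<inter> outer" "(\<exists>v\<in>K. snd v \<noteq> 1) \<longleftrightarrow> K \<inter> outer \<noteq> {}" for K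
    by (auto simp: outer_def)
  then show ?thesis unfolding glue_def collapse_def by auto
qed

lemma loops_eq: "loops p q r a b = card {K \<in> stack_components p q r a b. K \<inter> outer = {}}"
proof -
  have "(\<forall>v\<in>K. snd v = 1) \<longleftrightarrow> K \<inter> outer = {}" for K
    by (auto simp: outer_def)
  then show ?thesis unfolding loops_def by simp
qed

lemma perfect_matching_glue: "matching p r (glue p q r a b)"
proof -
  let ?C = "stack_components p q r a b" and ?V = "stack_vertices p q r"
  note part = partition_on_stack_components
  have "partition_on (?V \<inter> outer) ((\<lambda>K. outer \<inter> K) ` ?C - {{}})"
    using partition_on_restrict[OF part, of outer] by (simp add: Int_commute)
  then have "partition_on (collapse ` (?V \<inter> outer)) ((`) collapse ` ((\<lambda>K. outer \<inter> K) ` ?C - {{}}))"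
    by (rule partition_on_image) (rule inj_on_collapse)
  moreover have "(`) collapse ` ((\<lambda>K. outer \<inter> K) ` ?C - {{}}) = glue p q r a b"
    unfolding glue_eq by (auto simp: Int_commute)
  ultimately have "partition_on (marked_points p r) (glue p q r a b)"
    by (simp add: collapse_outer)
  moreover have "card e = 2" if e: "e \<in> glue p q r a b" for e
  proof -
    obtain K where K: "K \<in> ?C" "K \<inter> outer \<noteq> {}" "e = collapse ` (K \<inter> outer)"
      using e unfolding glue_eq by blast
    have KV: "K \<subseteq> ?V" using K(1) part by (auto simp: partition_on_def)
    then have "finite (K \<inter> outer)" using finite_stack_vertices finite_subset by blast
    then have "card (K \<inter> outer) = 2" using card_outer_component[OF K(1)] K(2) by auto
    moreover have "inj_on collapse (K \<inter> outer)"
      by (rule inj_on_subset[OF inj_on_collapse]) (use KV in blast)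
    ultimately show ?thesis unfolding K(3) by (simp add: card_image)
  qed
  ultimately show ?thesis by (simp add: perfect_matching_def)
qed

lemma saturated_glue_iff:
  assumes B: "B \<subseteq> {1..p}" and T: "T \<subseteq> {1..r}"
  shows "saturated (glue p q r a b) (B \<times> {0} \<union> T \<times> {1}) \<longleftrightarrow>
    (\<forall>K\<in>stack_components p q r a b.
       K \<inter> outer \<subseteq> B \<times> {0} \<union> T \<times> {2} \<or> K \<inter> (B \<times> {0} \<union> T \<times> {2}) = {})"
proof -
  let ?Q = "B \<times> {0} \<union> T \<times> {2 :: nat}" and ?C = "stack_components p q r a b"
  have Q: "?Q \<subseteq> stack_vertices p q r \<inter> outer"
    using B T by (auto simp: stack_vertices_def outer_def)
  have img: "collapse ` ?Q = B \<times> {0} \<union> T \<times> {1}"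
  proof -
    have "collapse ` (B \<times> {0}) = B \<times> {0}" "collapse ` (T \<times> {2}) = T \<times> {1}"
      by (force simp: collapse_def)+
    then show ?thesis by (simp add: image_Un)
  qed
  have sub: "collapse ` A \<subseteq> collapse ` ?Q \<longleftrightarrow> A \<subseteq> ?Q" "collapse ` A \<inter> collapse ` ?Q = {} \<longleftrightarrow> A \<inter> ?Q = {}"
    if A: "A \<subseteq> stack_vertices p q r \<inter> outer" for A
    by (rule inj_on_image_subset_iff[OF inj_on_collapse A Q])
      (simp only: inj_on_image_Int[OF inj_on_collapse A Q, symmetric] image_is_empty)
  have KV: "K \<inter> outer \<subseteq> stack_vertices p q r \<inter> outer" if "K \<in> ?C" for K
    using that partition_on_stack_components by (auto simp: partition_on_def)
  have KQ: "K \<inter> ?Q = K \<inter> outer \<inter> ?Q" for K using Q by blast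
  have gen: "(\<forall>e\<in>f ` {K\<in>C. g K}. P e) \<longleftrightarrow> (\<forall>K\<in>C. g K \<longrightarrow> P (f K))"
    for f :: "(nat \<times> nat) set \<Rightarrow> (nat \<times> nat) set" and C g P by blast
  have "saturated (glue p q r a b) (collapse ` ?Q) \<longleftrightarrow>
     (\<forall>K\<in>?C. K \<inter> outer \<noteq> {} \<longrightarrow> collapse ` (K \<inter> outer) \<subseteq> collapse ` ?Q \<or>
        collapse ` (K \<inter> outer) \<inter> collapse ` ?Q = {})"
    unfolding saturated_def glue_eq by (simp only: gen)
  also have "\<dots> \<longleftrightarrow> (\<forall>K\<in>?C. K \<inter> outer \<noteq> {} \<longrightarrow> K \<inter> outer \<subseteq> ?Q \<or> K \<inter> outer \<inter> ?Q = {})"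
    using sub[OF KV] by (intro ball_cong refl) simp
  also have "\<dots> \<longleftrightarrow> (\<forall>K\<in>?C. K \<inter> outer \<subseteq> ?Q \<or> K \<inter> ?Q = {})"
  proof (intro ball_cong refl)
    fix K
    have "K \<inter> outer = {} \<Longrightarrow> K \<inter> outer \<subseteq> ?Q" by simp
    then show "(K \<inter> outer \<noteq> {} \<longrightarrow> K \<inter> outer \<subseteq> ?Q \<or> K \<inter> outer \<inter> ?Q = {}) \<longleftrightarrow>
        K \<inter> outer \<subseteq> ?Q \<or> K \<inter> ?Q = {}"
      unfolding KQ[of K] by argo
  qed
  finally show ?thesis unfolding img .
qed

text \<open>The two sides count the colourings of the stack with prescribed colours on the outer lines:
  on the left by their restriction to the middle line, on the right by components, where exactly
  the closed loops are free.\<close>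

lemma card_middle_colourings:
  assumes B: "B \<subseteq> {1..p}" and T: "T \<subseteq> {1..r}"
  shows "card {M. M \<subseteq> {1..q} \<and> saturated b (B \<times> {0} \<union> M \<times> {1}) \<and> saturated a (M \<times> {0} \<union> T \<times> {1})} =
    (if saturated (glue p q r a b) (B \<times> {0} \<union> T \<times> {1}) then 2 ^ loops p q r a b else 0)"
proof -
  let ?Q = "B \<times> {0} \<union> T \<times> {2 :: nat}" and ?C = "stack_components p q r a b" and ?V = "stack_vertices p q r"
  define X where "X M = ?Q \<union> M \<times> {1}" for M
  have X1: "(x, Suc 0) \<in> X M \<longleftrightarrow> x \<in> M" for x M by (auto simp: X_def)
  have Q: "?Q \<subseteq> ?V \<inter> outer"
    using B T by (auto simp: stack_vertices_def outer_def)
  have lower_iff: "saturated b (X M) \<longleftrightarrow> saturated b (B \<times> {0} \<union> M \<times> {1})" if M: "M \<subseteq> {1..q}" for M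
  proof -
    have l: "v \<in> X M \<longleftrightarrow> v \<in> B \<times> {0} \<union> M \<times> {1}" if "v \<in> marked_points p q" for v
      using that by (cases v) (auto simp: X_def marked_points_def)
    have "e \<subseteq> X M \<longleftrightarrow> e \<subseteq> B \<times> {0} \<union> M \<times> {1}" "e \<inter> X M = {} \<longleftrightarrow> e \<inter> (B \<times> {0} \<union> M \<times> {1}) = {}"
      if "e \<in> b" for e
      using perfect_matching_block_subset[OF lower that] l by blast+
    then show ?thesis by (simp add: saturated_def)
  qed
  have upper_iff: "saturated ((image raise) ` a) (X M) \<longleftrightarrow> saturated a (M \<times> {0} \<union> T \<times> {1})"
    if M: "M \<subseteq> {1..q}" for M
  proof -
    have r: "raise v \<in> X M \<longleftrightarrow> v \<in> M \<times> {0} \<union> T \<times> {1}" for v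
      by (cases v) (auto simp: X_def raise_def)
    then have "raise ` e \<subseteq> X M \<longleftrightarrow> e \<subseteq> M \<times> {0} \<union> T \<times> {1}"
      "raise ` e \<inter> X M = {} \<longleftrightarrow> e \<inter> (M \<times> {0} \<union> T \<times> {1}) = {}" for e
      by blast+
    then show ?thesis by (simp add: saturated_def)
  qed
  have "bij_betw X {M. M \<subseteq> {1..q} \<and> saturated b (B \<times> {0} \<union> M \<times> {1}) \<and> saturated a (M \<times> {0} \<union> T \<times> {1})}
      {Y. Y \<subseteq> ?V \<and> saturated ?C Y \<and> Y \<inter> outer = ?Q}"
  proof (rule bij_betwI')
    fix M N show "X M = X N \<longleftrightarrow> M = N" using X1 by (metis subsetI subset_antisym)
  next
    fix M assume M: "M \<in> {M. M \<subseteq> {1..q} \<and> saturated b (B \<times> {0} \<union> M \<times> {1}) \<and> saturated a (M \<times> {0} \<union> T \<times> {1})}"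
    then have "saturated (stack_edges a b) (X M)"
      using lower_iff[of M] upper_iff[of M] by (auto simp: stack_edges_def saturated_def)
    then have "saturated ?C (X M)"
      unfolding stack_components_def by (subst saturated_components_iff) (rule stack_edge)
    moreover have "X M \<subseteq> ?V" using Q M by (auto simp: X_def stack_vertices_def)
    moreover have "X M \<inter> outer = ?Q" using Q by (auto simp: X_def outer_def)
    ultimately show "X M \<in> {Y. Y \<subseteq> ?V \<and> saturated ?C Y \<and> Y \<inter> outer = ?Q}" by simp
  next
    fix Y assume "Y \<in> {Y. Y \<subseteq> ?V \<and> saturated ?C Y \<and> Y \<inter> outer = ?Q}"
    then have Y: "Y \<subseteq> ?V" "saturated ?C Y" "Y \<inter> outer = ?Q" by auto
    define M where "M = {x. (x, 1) \<in> Y}"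
    have eq: "Y = X M"
    proof (rule Set.set_eqI)
      fix v :: "nat \<times> nat"
      have "v \<in> X M \<longleftrightarrow> v \<in> Y \<inter> outer \<or> (snd v = 1 \<and> v \<in> Y)"
        unfolding Y(3) by (cases v) (auto simp: X_def M_def)
      then show "v \<in> Y \<longleftrightarrow> v \<in> X M" by (auto simp: outer_def)
    qed
    have M: "M \<subseteq> {1..q}" using Y(1) by (auto simp: M_def stack_vertices_def)
    have "saturated (stack_edges a b) Y"
      using Y(2) saturated_components_iff[of "stack_edges a b" ?V Y] stack_edge
      unfolding stack_components_def by blast
    then have "saturated b (X M)" "saturated ((image raise) ` a) (X M)"
      unfolding eq[symmetric] by (auto simp: stack_edges_def saturated_def)
    then show "\<exists>M\<in>{M. M \<subseteq> {1..q} \<and> saturated b (B \<times> {0} \<union> M \<times> {1}) \<and> saturated a (M \<times> {0} \<union> T \<times> {1})}. Y = X M"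
      using M eq lower_iff upper_iff by blast
  qed
  then show ?thesis
    using card_saturated[OF partition_on_stack_components finite_stack_vertices Q]
    unfolding saturated_glue_iff[OF B T] loops_eq by (simp add: bij_betw_same_card)
qed

end


section \<open>Matchings as relations between colourings\<close>

text \<open>The pairs of colourings of the bottom and of the top line that extend to a colouring of the
  strands. Composition is read from bottom to top, so \<open>glue\<close> reverses the order of factors.\<close>

definition colourings :: "nat \<Rightarrow> nat \<Rightarrow> (nat \<times> nat) set set \<Rightarrow> (nat set \<times> nat set) set" where
  "colourings p q a =
     {(B, T). B \<subseteq> {1..p} \<and> T \<subseteq> {1..q} \<and> saturated a (B \<times> {0} \<union> T \<times> {1})}"

lemma subset_marked_points:
  assumes "X \<subseteq> marked_points p q"
  obtains B T where "B \<subseteq> {1..p}" "T \<subseteq> {1..q}" "X = B \<times> {0} \<union> T \<times> {1}"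
proof
  show "{x. (x, 0) \<in> X} \<subseteq> {1..p}" "{x. (x, 1) \<in> X} \<subseteq> {1..q}"
    using assms by (auto simp: marked_points_def)
  show "X = {x. (x, 0) \<in> X} \<times> {0} \<union> {x. (x, 1) \<in> X} \<times> {1}"
    using assms by (auto simp: marked_points_def)
qed

lemma colourings_inject:
  assumes "matching p q a" "matching p q b"
    and eq: "colourings p q a = colourings p q b"
  shows "a = b"
proof (rule saturated_partition_eq)
  show "partition_on (marked_points p q) a" "partition_on (marked_points p q) b"
    using assms by (auto simp: perfect_matching_def)
  fix X assume "X \<subseteq> marked_points p q"
  then obtain B T where X: "B \<subseteq> {1..p}" "T \<subseteq> {1..q}" "X = B \<times> {0} \<union> T \<times> {1}"
    by (rule subset_marked_points)
  have "(B, T) \<in> colourings p q a \<longleftrightarrow> (B, T) \<in> colourings p q b" by (simp only: eq)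
  then show "saturated a X \<longleftrightarrow> saturated b X" using X by (simp add: colourings_def)
qed

lemma colourings_empty: "({}, {}) \<in> colourings p q a"
  by (simp add: colourings_def saturated_def)

lemma card_colourings_glue:
  assumes pm: "matching q r a" "matching p q b"
  shows "card {M. (B, M) \<in> colourings p q b \<and> (M, T) \<in> colourings q r a} =
    (if (B, T) \<in> colourings p r (glue p q r a b) then 2 ^ loops p q r a b else 0)"
proof -
  interpret stacked_matchings p q r a b using pm by unfold_locales
  show ?thesis
  proof (cases "B \<subseteq> {1..p} \<and> T \<subseteq> {1..r}")
    case True
    then have "{M. (B, M) \<in> colourings p q b \<and> (M, T) \<in> colourings q r a} =
      {M. M \<subseteq> {1..q} \<and> saturated b (B \<times> {0} \<union> M \<times> {1}) \<and> saturated a (M \<times> {0} \<union> T \<times> {1})}"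
      by (auto simp: colourings_def)
    then show ?thesis using card_middle_colourings[of B T] True by (simp add: colourings_def)
  next
    case False
    then have "{M. (B, M) \<in> colourings p q b \<and> (M, T) \<in> colourings q r a} = {}"
      by (auto simp: colourings_def)
    then show ?thesis using False by (simp only: card.empty) (auto simp: colourings_def)
  qed
qed

lemma colourings_glue:
  assumes pm: "matching q r a" "matching p q b"
  shows "colourings p r (glue p q r a b) = colourings p q b O colourings q r a"
proof -
  have "(B, T) \<in> colourings p r (glue p q r a b) \<longleftrightarrow> (B, T) \<in> colourings p q b O colourings q r a" for B T
  proof -
    have "finite {M. (B, M) \<in> colourings p q b \<and> (M, T) \<in> colourings q r a}"
      by (rule finite_subset[of _ "Pow {1..q}"]) (auto simp: colourings_def)
    then have "card {M. (B, M) \<in> colourings p q b \<and> (M, T) \<in> colourings q r a} \<noteq> 0 \<longleftrightarrow>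
      (B, T) \<in> colourings p q b O colourings q r a"
      by auto
    then show ?thesis unfolding card_colourings_glue[OF pm] by (simp split: if_splits)
  qed
  then show ?thesis by (intro Set.set_eqI) (simp only: split_paired_all)
qed

lemma perfect_matching_glue:
  assumes "matching q r a" "matching p q b"
  shows "matching p r (glue p q r a b)"
proof -
  interpret stacked_matchings p q r a b using assms by unfold_locales
  show ?thesis by (rule perfect_matching_glue)
qed

lemma glue_assoc:
  assumes a: "matching r s a" and b: "matching q r b"
    and c: "matching p q c"
  shows "glue p q s (glue q r s a b) c = glue p r s a (glue p q r b c)"
proof (rule colourings_inject)
  note ab = perfect_matching_glue[OF a b] and bc = perfect_matching_glue[OF b c]
  show "matching p s (glue p q s (glue q r s a b) c)"
    "matching p s (glue p r s a (glue p q r b c))"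
    using perfect_matching_glue a c ab bc by blast+
  show "colourings p s (glue p q s (glue q r s a b) c) = colourings p s (glue p r s a (glue p q r b c))"
    by (simp add: colourings_glue[OF ab c] colourings_glue[OF a bc] colourings_glue[OF a b]
        colourings_glue[OF b c] O_assoc)
qed

text \<open>Both sides are the exponent in the number of colourings of the two middle lines of a stack of
  three matchings when all outer points have the same colour; the lines are summed in either order.\<close>

lemma loops_cocycle:
  assumes a: "matching r s a" and b: "matching q r b"
    and c: "matching p q c"
  shows "loops q r s a b + loops p q s (glue q r s a b) c = loops p q r b c + loops p r s a (glue p q r b c)"
proof -
  note ab = perfect_matching_glue[OF a b] and bc = perfect_matching_glue[OF b c]
  let ?A = "colourings r s a" and ?B = "colourings q r b" and ?C = "colourings p q c"
  let ?P = "{(M, N). ({}, M) \<in> ?C \<and> (M, N) \<in> ?B \<and> (N, {}) \<in> ?A}"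
  let ?AB = "{M. ({}, M) \<in> ?C \<and> (M, {}) \<in> colourings q s (glue q r s a b)}"
  let ?BC = "{N. ({}, N) \<in> colourings p r (glue p q r b c) \<and> (N, {}) \<in> ?A}"
  have fC: "finite {M. ({}, M) \<in> ?C}"
    by (rule finite_subset[of _ "Pow {1..q}"]) (auto simp: colourings_def)
  have fA: "finite {N. (N, {}) \<in> ?A}"
    by (rule finite_subset[of _ "Pow {1..r}"]) (auto simp: colourings_def)
  have fM: "finite {N. (M, N) \<in> ?B \<and> (N, {}) \<in> ?A}" for M
    by (rule finite_subset[OF _ fA]) auto
  have fN: "finite {M. ({}, M) \<in> ?C \<and> (M, N) \<in> ?B}" for N
    by (rule finite_subset[OF _ fC]) auto
  have count: "(\<Sum>x\<in>A. if R x then k else 0) = k * card {x \<in> A. R x}" if "finite A"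
    for A :: "nat set set" and R and k :: nat
    using that by (simp flip: sum.inter_filter)
  have "card ?P = card (SIGMA M:{M. ({}, M) \<in> ?C}. {N. (M, N) \<in> ?B \<and> (N, {}) \<in> ?A})"
    by (rule arg_cong[where f = card]) auto
  also have "\<dots> = (\<Sum>M | ({}, M) \<in> ?C. card {N. (M, N) \<in> ?B \<and> (N, {}) \<in> ?A})"
    using fC fM by (subst card_SigmaI) auto
  also have "\<dots> = (\<Sum>M | ({}, M) \<in> ?C. if (M, {}) \<in> colourings q s (glue q r s a b) then 2 ^ loops q r s a b else 0)"
    by (simp only: card_colourings_glue[OF a b])
  also have "\<dots> = 2 ^ loops q r s a b * card ?AB"
    using count[OF fC] by simp
  also have "\<dots> = 2 ^ (loops q r s a b + loops p q s (glue q r s a b) c)"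
    unfolding card_colourings_glue[OF ab c] by (simp add: colourings_empty power_add)
  finally have 1: "card ?P = 2 ^ (loops q r s a b + loops p q s (glue q r s a b) c)" .
  have "card ?P = card (SIGMA N:{N. (N, {}) \<in> ?A}. {M. ({}, M) \<in> ?C \<and> (M, N) \<in> ?B})"
    by (rule bij_betw_same_card[of prod.swap]) (auto simp: bij_betw_def inj_on_def image_iff)
  also have "\<dots> = (\<Sum>N | (N, {}) \<in> ?A. card {M. ({}, M) \<in> ?C \<and> (M, N) \<in> ?B})"
    using fA fN by (subst card_SigmaI) auto
  also have "\<dots> = (\<Sum>N | (N, {}) \<in> ?A. if ({}, N) \<in> colourings p r (glue p q r b c) then 2 ^ loops p q r b c else 0)"
    by (simp only: card_colourings_glue[OF b c])
  also have "\<dots> = 2 ^ loops p q r b c * card ?BC"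
    using count[OF fA] by (simp add: conj_commute)
  also have "\<dots> = 2 ^ (loops p q r b c + loops p r s a (glue p q r b c))"
    unfolding card_colourings_glue[OF a bc] by (simp add: colourings_empty power_add)
  finally show ?thesis unfolding 1 by simp
qed

subsection \<open>Identity and reflection\<close>

lemma perfect_matching_id_diagram: "matching n n (id_diagram n)"
proof -
  have "partition_on (marked_points n n) (id_diagram n)"
    by (rule partition_onI) (auto simp: id_diagram_def marked_points_def disjnt_def)
  then show ?thesis by (auto simp: perfect_matching_def id_diagram_def)
qed

lemma id_diagram_crossingless: "id_diagram n \<in> crossingless n n"
proof -
  have "noncrossing (id_diagram n)"
    by (auto simp: noncrossing_def id_diagram_def boundary_order_def)
  then show ?thesis by (simp add: crossingless_iff perfect_matching_id_diagram)
qed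

lemma colourings_id_diagram: "colourings n n (id_diagram n) = Id_on (Pow {1..n})"
proof -
  have "saturated (id_diagram n) (B \<times> {0} \<union> T \<times> {1}) \<longleftrightarrow> (\<forall>x\<in>{1..n}. x \<in> B \<longleftrightarrow> x \<in> T)" for B T
    unfolding saturated_def id_diagram_def by auto
  then have "(B, T) \<in> colourings n n (id_diagram n) \<longleftrightarrow> (B, T) \<in> Id_on (Pow {1..n})" for B T
    unfolding colourings_def mem_Collect_eq prod.case Id_on_iff by blast
  then show ?thesis by (intro Set.set_eqI) (simp only: split_paired_all)
qed

lemma colourings_subset: "colourings p q a \<subseteq> Pow {1..p} \<times> Pow {1..q}"
  by (auto simp: colourings_def)

lemma colourings_id_left: "Id_on (Pow {1..p}) O colourings p q a = colourings p q a"
  and colourings_id_right: "colourings p q a O Id_on (Pow {1..q}) = colourings p q a"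
  using colourings_subset[of p q a] by blast+

lemma glue_id_right:
  assumes a: "matching p q a"
  shows "glue p p q a (id_diagram p) = a" "loops p p q a (id_diagram p) = 0"
proof -
  note id = perfect_matching_id_diagram
  show "glue p p q a (id_diagram p) = a"
    by (rule colourings_inject[OF perfect_matching_glue[OF a id] a])
      (simp only: colourings_glue[OF a id] colourings_id_diagram colourings_id_left)
  have "{M. ({}, M) \<in> colourings p p (id_diagram p) \<and> (M, {}) \<in> colourings p q a} = {{}}"
    using colourings_empty[of p q a] by (auto simp: colourings_id_diagram)
  then have "(2 :: nat) ^ loops p p q a (id_diagram p) = 1"
    using card_colourings_glue[OF a id, of "{}" "{}"] by (simp add: colourings_empty)
  then show "loops p p q a (id_diagram p) = 0" by simp
qed

lemma glue_id_left:
  assumes a: "matching p q a"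
  shows "glue p q q (id_diagram q) a = a" "loops p q q (id_diagram q) a = 0"
proof -
  note id = perfect_matching_id_diagram
  show "glue p q q (id_diagram q) a = a"
    by (rule colourings_inject[OF perfect_matching_glue[OF id a] a])
      (simp only: colourings_glue[OF id a] colourings_id_diagram colourings_id_right)
  have "{M. ({}, M) \<in> colourings p q a \<and> (M, {}) \<in> colourings q q (id_diagram q)} = {{}}"
    using colourings_empty[of p q a] by (auto simp: colourings_id_diagram)
  then have "(2 :: nat) ^ loops p q q (id_diagram q) a = 1"
    using card_colourings_glue[OF id a, of "{}" "{}"] by (simp add: colourings_empty)
  then show "loops p q q (id_diagram q) a = 0" by simp
qed

definition flip_vertex :: "nat \<times> nat \<Rightarrow> nat \<times> nat" where
  "flip_vertex v = (fst v, 1 - snd v)"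

definition flip :: "(nat \<times> nat) set set \<Rightarrow> (nat \<times> nat) set set" where
  "flip a = (image flip_vertex) ` a"

lemma inj_on_flip_vertex: "inj_on flip_vertex (marked_points p q)"
  by (auto simp: inj_on_def flip_vertex_def marked_points_def)

lemma flip_vertex_flip_vertex: "v \<in> marked_points p q \<Longrightarrow> flip_vertex (flip_vertex v) = v"
  by (auto simp: flip_vertex_def marked_points_iff prod_eq_iff)

lemma flip_vertex_marked_points: "flip_vertex ` marked_points p q = marked_points q p"
proof
  have sub: "flip_vertex v \<in> marked_points q p" if "v \<in> marked_points p q" for v p q
    using that by (auto simp: marked_points_iff flip_vertex_def)
  show "flip_vertex ` marked_points p q \<subseteq> marked_points q p" using sub by blast
  show "marked_points q p \<subseteq> flip_vertex ` marked_points p q"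
  proof
    fix v assume v: "v \<in> marked_points q p"
    show "v \<in> flip_vertex ` marked_points p q"
      using flip_vertex_flip_vertex[OF v] sub[OF v] by (metis imageI)
  qed
qed

lemma perfect_matching_flip:
  assumes "matching p q a"
  shows "matching q p (flip a)"
proof -
  have "partition_on (flip_vertex ` marked_points p q) ((image flip_vertex) ` a)"
    using assms by (intro partition_on_image inj_on_flip_vertex) (simp add: perfect_matching_def)
  moreover have "card (flip_vertex ` e) = 2" if "e \<in> a" for e
    using card_image[OF inj_on_subset[OF inj_on_flip_vertex perfect_matching_block_subset[OF assms that]]]
      assms that by (simp add: perfect_matching_def)
  ultimately show ?thesis by (auto simp: perfect_matching_def flip_def flip_vertex_marked_points)
qed

lemma colourings_flip:
  assumes a: "matching p q a"
  shows "colourings q p (flip a) = (colourings p q a)\<inverse>"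
proof -
  have "saturated (flip a) (T \<times> {0} \<union> B \<times> {1}) \<longleftrightarrow> saturated a (B \<times> {0} \<union> T \<times> {1})" for B T
  proof -
    have v: "flip_vertex v \<in> T \<times> {0} \<union> B \<times> {1} \<longleftrightarrow> v \<in> B \<times> {0} \<union> T \<times> {1}"
      if "v \<in> marked_points p q" for v
      using that by (auto simp: flip_vertex_def marked_points_def)
    have "flip_vertex ` e \<subseteq> T \<times> {0} \<union> B \<times> {1} \<longleftrightarrow> e \<subseteq> B \<times> {0} \<union> T \<times> {1}"
      "flip_vertex ` e \<inter> (T \<times> {0} \<union> B \<times> {1}) = {} \<longleftrightarrow> e \<inter> (B \<times> {0} \<union> T \<times> {1}) = {}"
      if "e \<in> a" for e
    proof -
      have ev: "flip_vertex x \<in> T \<times> {0} \<union> B \<times> {1} \<longleftrightarrow> x \<in> B \<times> {0} \<union> T \<times> {1}" if "x \<in> e" for x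
        by (rule v) (rule subsetD[OF perfect_matching_block_subset[OF a \<open>e \<in> a\<close>] that])
      have dis: "f ` e \<inter> Q = {} \<longleftrightarrow> (\<forall>x\<in>e. f x \<notin> Q)" for f and Q :: "(nat \<times> nat) set" by blast
      show "flip_vertex ` e \<subseteq> T \<times> {0} \<union> B \<times> {1} \<longleftrightarrow> e \<subseteq> B \<times> {0} \<union> T \<times> {1}"
        unfolding image_subset_iff subset_eq[of e] using ev by (intro ball_cong refl)
      show "flip_vertex ` e \<inter> (T \<times> {0} \<union> B \<times> {1}) = {} \<longleftrightarrow> e \<inter> (B \<times> {0} \<union> T \<times> {1}) = {}"
        unfolding dis[of flip_vertex] dis[of "\<lambda>x. x", unfolded image_ident]
        by (intro ball_cong refl) (simp only: ev)
    qed
    then show ?thesis by (simp add: saturated_def flip_def)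
  qed
  then show ?thesis by (auto simp: colourings_def)
qed

lemma flip_crossingless:
  assumes "a \<in> crossingless p q"
  shows "flip a \<in> crossingless q p"
proof -
  have a: "matching p q a" "noncrossing a"
    using assms by (simp_all add: crossingless_iff)
  have o: "boundary_order (flip_vertex v) = - boundary_order v" if "v \<in> e" "e \<in> a" for v e
    using perfect_matching_block_subset[OF a(1) that(2)] that(1)
    by (auto simp: boundary_order_def flip_vertex_def marked_points_iff)
  have "noncrossing (flip a)"
    unfolding noncrossing_def flip_def
  proof (intro ballI notI)
    fix e f u v w x
    assume "e \<in> (image flip_vertex) ` a" "f \<in> (image flip_vertex) ` a" "u \<in> e" "v \<in> f" "w \<in> e" "x \<in> f"
      and less: "boundary_order u < boundary_order v \<and> boundary_order v < boundary_order w \<and>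
        boundary_order w < boundary_order x"
    then obtain e' f' u' v' w' x' where *: "e' \<in> a" "f' \<in> a" "u' \<in> e'" "v' \<in> f'" "w' \<in> e'" "x' \<in> f'"
      "u = flip_vertex u'" "v = flip_vertex v'" "w = flip_vertex w'" "x = flip_vertex x'"
      by blast
    then show False
      using noncrossingD[OF a(2) *(2,1,6,5,4,3)] less o by simp
  qed
  then show ?thesis using perfect_matching_flip[OF a(1)] by (simp add: crossingless_iff)
qed

subsection \<open>Through strands\<close>

text \<open>The block of \<open>x\<close> is itself a colouring, and it separates \<open>x\<close> from all points but its partner.\<close>

lemma bottom_block_iff:
  assumes a: "matching p q a" and xy: "x \<in> {1..p}" "y \<in> {1..p}" "x \<noteq> y"
  shows "{(x, 0), (y, 0)} \<in> a \<longleftrightarrow> (\<forall>(B, T)\<in>colourings p q a. x \<in> B \<longleftrightarrow> y \<in> B)"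
proof
  assume e: "{(x, 0), (y, 0)} \<in> a"
  show "\<forall>(B, T)\<in>colourings p q a. x \<in> B \<longleftrightarrow> y \<in> B"
  proof clarify
    fix B T assume "(B, T) \<in> colourings p q a"
    then have "saturated a (B \<times> {0} \<union> T \<times> {1})" by (simp add: colourings_def)
    from bspec[OF this[unfolded saturated_def] e]
    have "{(x, 0), (y, 0)} \<subseteq> B \<times> {0 :: nat} \<union> T \<times> {1} \<or> {(x, 0), (y, 0)} \<inter> (B \<times> {0 :: nat} \<union> T \<times> {1}) = {}" .
    then show "x \<in> B \<longleftrightarrow> y \<in> B" by auto
  qed
next
  assume *: "\<forall>(B, T)\<in>colourings p q a. x \<in> B \<longleftrightarrow> y \<in> B"
  have "(x, 0) \<in> marked_points p q" using xy by (simp add: marked_points_def)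
  then obtain e where e: "e \<in> a" "(x, 0) \<in> e" using perfect_matching_obtain_block[OF a] by blast
  obtain B T where BT: "B \<subseteq> {1..p}" "T \<subseteq> {1..q}" "e = B \<times> {0} \<union> T \<times> {1}"
    using subset_marked_points[OF perfect_matching_block_subset[OF a e(1)]] by blast
  have "saturated a e" using perfect_matching_block_unique[OF a] e(1) unfolding saturated_def by blast
  then have "(B, T) \<in> colourings p q a" using BT by (simp add: colourings_def)
  then have "x \<in> B \<longleftrightarrow> y \<in> B" using * by blast
  moreover have "x \<in> B" using e(2) BT(3) by auto
  ultimately have "(y, 0) \<in> e" using BT(3) by auto
  moreover have "card e = 2" using a e(1) by (simp add: perfect_matching_def)
  ultimately have "e = {(x, 0), (y, 0)}" using e(2) xy(3) by (auto simp: card_2_iff)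
  then show "{(x, 0), (y, 0)} \<in> a" using e(1) by simp
qed

text \<open>The lower endpoints of the through strands.\<close>

definition through :: "(nat \<times> nat) set set \<Rightarrow> nat set" where
  "through a = {x. \<exists>y. {(x, 0), (y, 1)} \<in> a}"

lemma not_through_iff:
  assumes a: "matching p q a" and x: "x \<in> {1..p}"
  shows "x \<notin> through a \<longleftrightarrow> (\<exists>y\<in>{1..p}. y \<noteq> x \<and> {(x, 0), (y, 0)} \<in> a)"
proof
  assume nt: "x \<notin> through a"
  have "(x, 0) \<in> marked_points p q" using x by (simp add: marked_points_def)
  then obtain e where e: "e \<in> a" "(x, 0) \<in> e" using perfect_matching_obtain_block[OF a] by blast
  moreover have "card e = 2" using a e(1) by (simp add: perfect_matching_def)
  ultimately obtain v where v: "e = {(x, 0), v}" "v \<noteq> (x, 0)" by (auto simp: card_2_iff)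
  then have vm: "v \<in> marked_points p q" using perfect_matching_block_subset[OF a e(1)] by blast
  have "snd v \<noteq> 1" using nt e(1) v unfolding through_def by (cases v) auto
  then have "snd v = 0" "fst v \<in> {1..p}" using vm by (auto simp: marked_points_def)
  then show "\<exists>y\<in>{1..p}. y \<noteq> x \<and> {(x, 0), (y, 0)} \<in> a"
    using e(1) v by (intro bexI[of _ "fst v"]) (cases v, auto)+
next
  assume "\<exists>y\<in>{1..p}. y \<noteq> x \<and> {(x, 0), (y, 0)} \<in> a"
  then obtain y where y: "y \<noteq> x" "{(x, 0), (y, 0)} \<in> a" by blast
  show "x \<notin> through a"
  proof
    assume "x \<in> through a"
    then obtain z where z: "{(x, 0), (z, 1)} \<in> a" by (auto simp: through_def)
    have "{(x, 0), (z, 1 :: nat)} = {(x, 0), (y, 0)}"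
      by (rule perfect_matching_block_unique[OF a z y(2), of "(x, 0)"]) auto
    then show False by (auto simp: doubleton_eq_iff)
  qed
qed

lemma through_subset:
  assumes "matching p q a"
  shows "through a \<subseteq> {1..p}"
  using perfect_matching_block_subset[OF assms] by (fastforce simp: through_def marked_points_def)

text \<open>A cap at the bottom of \<open>b\<close> forces its two endpoints to have equal colours in \<open>b\<close>, hence in every
  composite with \<open>b\<close>.\<close>

lemma through_glue_subset:
  assumes a: "matching q r a" and b: "matching p q b"
  shows "through (glue p q r a b) \<subseteq> through b"
proof
  fix x assume x: "x \<in> through (glue p q r a b)"
  note ab = perfect_matching_glue[OF a b]
  have xp: "x \<in> {1..p}" using x through_subset[OF ab] by blast
  show "x \<in> through b"
  proof (rule ccontr)
    assume "x \<notin> through b"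
    then obtain y where y: "y \<in> {1..p}" "y \<noteq> x" "{(x, 0), (y, 0)} \<in> b"
      using not_through_iff[OF b xp] by blast
    then have "{(x, 0), (y, 0)} \<in> glue p q r a b"
      using bottom_block_iff[OF b xp y(1)] bottom_block_iff[OF ab xp y(1)]
      unfolding colourings_glue[OF a b] by fastforce
    then show False using x y not_through_iff[OF ab xp] by blast
  qed
qed

definition through_number :: "(nat \<times> nat) set set \<Rightarrow> nat" where
  "through_number a = card (through a)"

lemma through_top_eq:
  assumes a: "matching p q a"
    and e: "{(x, 0), (y, 1)} \<in> a" "{(x', 0), (y', 1)} \<in> a"
  shows "x = x' \<longleftrightarrow> y = y'"
proof -
  have "x = x' \<Longrightarrow> {(x, 0), (y, 1 :: nat)} = {(x', 0), (y', 1)}"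
    by (rule perfect_matching_block_unique[OF a e, of "(x, 0)"]) auto
  moreover have "y = y' \<Longrightarrow> {(x, 0), (y, 1 :: nat)} = {(x', 0), (y', 1)}"
    by (rule perfect_matching_block_unique[OF a e, of "(y, 1)"]) auto
  ultimately show ?thesis by (auto simp: doubleton_eq_iff)
qed

lemma flip_through_block:
  assumes a: "matching p q a"
  shows "{(y, 0), (x, 1)} \<in> flip a \<longleftrightarrow> {(x, 0), (y, 1)} \<in> a"
proof
  assume "{(x, 0), (y, 1)} \<in> a"
  then have "flip_vertex ` {(x, 0), (y, 1)} \<in> flip a" unfolding flip_def by (rule imageI)
  then show "{(y, 0), (x, 1)} \<in> flip a" by (simp add: flip_vertex_def insert_commute)
next
  assume "{(y, 0), (x, 1)} \<in> flip a"
  then obtain e where e: "e \<in> a" "flip_vertex ` e = {(y, 0), (x, 1)}" unfolding flip_def by force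
  have em: "e \<subseteq> marked_points p q" using perfect_matching_block_subset[OF a e(1)] .
  have "flip_vertex ` flip_vertex ` e = e"
  proof -
    have "flip_vertex (flip_vertex v) = v" if "v \<in> e" for v
      using that em flip_vertex_flip_vertex by blast
    then show ?thesis by (simp add: image_image)
  qed
  then have "e = {(x, 0), (y, 1)}" unfolding e(2) by (simp add: flip_vertex_def insert_commute)
  then show "{(x, 0), (y, 1)} \<in> a" using e(1) by simp
qed

lemma through_number_flip:
  assumes a: "matching p q a"
  shows "through_number (flip a) = through_number a"
proof -
  have "\<forall>x\<in>through a. \<exists>y. {(x, 0), (y, 1)} \<in> a" by (simp add: through_def)
  then obtain t where t: "\<And>x. x \<in> through a \<Longrightarrow> {(x, 0), (t x, 1)} \<in> a" by metis
  have "bij_betw t (through a) (through (flip a))"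
  proof (rule bij_betwI')
    fix x x' assume "x \<in> through a" "x' \<in> through a"
    then show "t x = t x' \<longleftrightarrow> x = x'" using through_top_eq[OF a t t] by blast
  next
    fix x assume "x \<in> through a"
    then show "t x \<in> through (flip a)" using t flip_through_block[OF a] by (auto simp: through_def)
  next
    fix y assume "y \<in> through (flip a)"
    then obtain x where x: "{(x, 0), (y, 1)} \<in> a" using flip_through_block[OF a] by (auto simp: through_def)
    then have "x \<in> through a" by (auto simp: through_def)
    then show "\<exists>x\<in>through a. y = t x" using through_top_eq[OF a x t] by blast
  qed
  then show ?thesis unfolding through_number_def by (simp add: bij_betw_same_card)
qed

lemma through_number_glue_le_lower:
  assumes "matching q r a" "matching p q b"
  shows "through_number (glue p q r a b) \<le> through_number b"
  unfolding through_number_def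
  using through_glue_subset[OF assms] through_subset[OF assms(2)] by (intro card_mono) (auto intro: finite_subset)

lemma flip_glue:
  assumes a: "matching q r a" and b: "matching p q b"
  shows "flip (glue p q r a b) = glue r q p (flip b) (flip a)"
proof (rule colourings_inject)
  note fa = perfect_matching_flip[OF a] and fb = perfect_matching_flip[OF b] and ab = perfect_matching_glue[OF a b]
  show "matching r p (flip (glue p q r a b))"
    by (rule perfect_matching_flip[OF ab])
  show "matching r p (glue r q p (flip b) (flip a))"
    by (rule perfect_matching_glue[OF fb fa])
  show "colourings r p (flip (glue p q r a b)) = colourings r p (glue r q p (flip b) (flip a))"
    by (simp add: colourings_flip[OF ab] colourings_glue[OF a b] colourings_glue[OF fb fa]
        colourings_flip[OF a] colourings_flip[OF b] converse_relcomp)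
qed

lemma flip_flip:
  assumes a: "matching p q a"
  shows "flip (flip a) = a"
  by (rule colourings_inject[OF perfect_matching_flip[OF perfect_matching_flip[OF a]] a])
    (simp add: colourings_flip[OF perfect_matching_flip[OF a]] colourings_flip[OF a])

lemma through_number_glue_le_upper:
  assumes a: "matching q r a" and b: "matching p q b"
  shows "through_number (glue p q r a b) \<le> through_number a"
proof -
  have "through_number (glue p q r a b) = through_number (glue r q p (flip b) (flip a))"
    using through_number_flip[OF perfect_matching_glue[OF a b]] flip_glue[OF a b] by simp
  also have "\<dots> \<le> through_number (flip a)"
    by (rule through_number_glue_le_lower) (use a b perfect_matching_flip in blast)+
  finally show ?thesis using through_number_flip[OF a] by simp
qed

lemma through_number_le:
  assumes "matching p q a"
  shows "through_number a \<le> p"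
  unfolding through_number_def using card_mono[OF _ through_subset[OF assms]] by simp

lemma through_number_id_diagram: "through_number (id_diagram n) = n"
proof -
  have "through (id_diagram n) = {1..n}"
  proof -
    have "{(x, 0), (y, 1)} \<in> id_diagram n \<longleftrightarrow> x = y \<and> x \<in> {1..n}" for x y
      unfolding id_diagram_def image_iff by (simp only: doubleton_eq_iff) auto
    then show ?thesis unfolding through_def by auto
  qed
  then show ?thesis by (simp add: through_number_def)
qed


section \<open>Gluing crossingless matchings\<close>

lemma path_component_ends:
  assumes "path g" "path_image g \<subseteq> S" "{pathstart g, pathfinish g} = {A, B}"
  shows "path_component S A B"
proof -
  have "path_component S (pathstart g) (pathfinish g)"
    using assms(1,2) unfolding path_component_def by blast
  then show ?thesis using assms(3) path_component_sym by (metis doubleton_eq_iff)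
qed

context stacked_matchings
begin

text \<open>All arcs of one component of the stack, with the drawing of \<open>a\<close> moved up by 1. It need not be an
  arc, but it is path connected, and a path between two points contains an arc between them.\<close>

definition drawn_component ::
  "((nat \<times> nat) set \<Rightarrow> real \<Rightarrow> real \<times> real) \<Rightarrow> ((nat \<times> nat) set \<Rightarrow> real \<Rightarrow> real \<times> real) \<Rightarrow>
     (nat \<times> nat) set \<Rightarrow> (real \<times> real) set" where
  "drawn_component \<alpha> \<beta> K =
     (\<Union>e\<in>{e\<in>b. e \<subseteq> K}. path_image (\<beta> e)) \<union>
     (\<Union>e\<in>{e\<in>a. raise ` e \<subseteq> K}. (\<lambda>z. z + (0, 1)) ` path_image (\<alpha> e))"

lemma plane_point_raise: "plane_point (raise v) = plane_point v + (0, 1)"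
  by (simp add: plane_point_def raise_def)

lemma drawn_edge:
  assumes \<alpha>: "clean_drawing a \<alpha>" and \<beta>: "clean_drawing b \<beta>"
    and e: "{u, v} \<in> stack_edges a b" "{u, v} \<subseteq> K"
  shows "path_component (drawn_component \<alpha> \<beta> K) (plane_point u) (plane_point v)"
proof -
  consider "{u, v} \<in> b" | f where "f \<in> a" "{u, v} = raise ` f" using e(1) unfolding stack_edges_def by blast
  then show ?thesis
  proof cases
    case 1
    show ?thesis
    proof (rule path_component_ends)
      show "path (\<beta> {u, v})" "{pathstart (\<beta> {u, v}), pathfinish (\<beta> {u, v})} = {plane_point u, plane_point v}"
        using \<beta> 1 by (auto simp: clean_drawing_def arc_imp_path)
      show "path_image (\<beta> {u, v}) \<subseteq> drawn_component \<alpha> \<beta> K"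
        using 1 e(2) unfolding drawn_component_def by blast
    qed
  next
    case 2
    let ?g = "(\<lambda>z. z + (0, 1)) \<circ> \<alpha> f"
    show ?thesis
    proof (rule path_component_ends)
      have "path (\<alpha> f)" and ends: "{pathstart (\<alpha> f), pathfinish (\<alpha> f)} = plane_point ` f"
        using \<alpha> 2(1) by (auto simp: clean_drawing_def arc_imp_path)
      then show "path ?g" by (intro path_continuous_image continuous_intros)
      have "{pathstart ?g, pathfinish ?g} = (\<lambda>z. z + (0, 1)) ` plane_point ` f"
        unfolding ends[symmetric] by (simp add: pathstart_compose pathfinish_compose)
      also have "\<dots> = plane_point ` raise ` f" by (simp add: image_image plane_point_raise)
      also have "\<dots> = {plane_point u, plane_point v}" unfolding 2(2)[symmetric] by simp
      finally show "{pathstart ?g, pathfinish ?g} = {plane_point u, plane_point v}" .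
      have "raise ` f \<subseteq> K" using 2(2) e(2) by simp
      then show "path_image ?g \<subseteq> drawn_component \<alpha> \<beta> K"
        using 2(1) unfolding drawn_component_def path_image_compose by blast
    qed
  qed
qed

lemma stack_vertex_on_edge:
  assumes "v \<in> stack_vertices p q r"
  obtains e where "e \<in> stack_edges a b" "v \<in> e"
proof (cases "snd v \<le> 1")
  case True
  then have "v \<in> marked_points p q" using assms lower_marked_points by simp
  then obtain e where "e \<in> b" "v \<in> e" by (rule perfect_matching_obtain_block[OF lower])
  then show ?thesis by (intro that[of e]) (simp_all add: stack_edges_def)
next
  case False
  then have "v \<in> {v \<in> stack_vertices p q r. snd v \<ge> 1}" using assms by simp
  then obtain e where "e \<in> (image raise) ` a" "v \<in> e" by (rule perfect_matching_obtain_block[OF raised_matching])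
  then show ?thesis by (intro that[of e]) (simp_all add: stack_edges_def)
qed

lemma drawn_component_connected:
  assumes \<alpha>: "clean_drawing a \<alpha>" and \<beta>: "clean_drawing b \<beta>"
    and K: "K \<in> stack_components p q r a b" and uv: "u \<in> K" "v \<in> K"
  shows "path_component (drawn_component \<alpha> \<beta> K) (plane_point u) (plane_point v)"
proof -
  obtain x where x: "x \<in> stack_vertices p q r" "K = {(u, v). {u, v} \<in> stack_edges a b}\<^sup>* `` {x}"
    using K unfolding stack_components_def quotient_def by blast
  have xK: "x \<in> K" unfolding x(2) by blast
  have from_x: "path_component (drawn_component \<alpha> \<beta> K) (plane_point x) (plane_point w)" if "w \<in> K" for w
  proof -
    have "(x, w) \<in> {(u, v). {u, v} \<in> stack_edges a b}\<^sup>*" using that unfolding x(2) by blast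
    then show ?thesis
    proof (induction rule: rtrancl_induct)
      case base
      obtain e where e: "e \<in> stack_edges a b" "x \<in> e" using stack_vertex_on_edge[OF x(1)] .
      then obtain y where y: "e = {x, y}" using stack_edge[OF e(1)] by (auto simp: card_2_iff)
      have "e \<subseteq> K" using stack_component_edge[OF K e(1)] e(2) xK by blast
      then have "path_component (drawn_component \<alpha> \<beta> K) (plane_point x) (plane_point y)"
        using drawn_edge[OF \<alpha> \<beta>] e(1) unfolding y by blast
      then show ?case using path_component_mem(1) path_component_refl_eq by metis
    next
      case (step y w)
      have e: "{y, w} \<in> stack_edges a b" using step(2) by simp
      have "y \<in> K" using step(1) unfolding x(2) by blast
      then have "{y, w} \<subseteq> K" using stack_component_edge[OF K e] by blast
      then show ?case using drawn_edge[OF \<alpha> \<beta> e] step(3) path_component_trans by metis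
    qed
  qed
  then show ?thesis using uv path_component_sym path_component_trans by metis
qed

text \<open>Arcs of the two layers can only meet on the middle line. As the drawings are clean, they meet in
  a common vertex, which puts them into the same component.\<close>

lemma drawn_components_disjoint:
  assumes \<alpha>: "clean_drawing a \<alpha>" and \<beta>: "clean_drawing b \<beta>"
    and disj: "K \<inter> K' = {}"
  shows "drawn_component \<alpha> \<beta> K \<inter> drawn_component \<alpha> \<beta> K' = {}"
proof -
  have mixed: False
    if e: "e \<in> b" "e \<subseteq> K" "z \<in> path_image (\<beta> e)" and f: "f \<in> a" "raise ` f \<subseteq> K'" "z \<in> (\<lambda>z. z + (0, 1)) ` path_image (\<alpha> f)"
      and KK: "K \<inter> K' = {}" for e f z K K'
  proof -
    obtain w where w: "w \<in> path_image (\<alpha> f)" "z = w + (0, 1)" using f(3) by blast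
    have "z \<in> UNIV \<times> {0..1}" "w \<in> UNIV \<times> {0..1}"
      using \<alpha> \<beta> e f w unfolding clean_drawing_def by blast+
    then have "z \<in> UNIV \<times> {0, 1}" "w \<in> UNIV \<times> {0, 1}" unfolding w(2) by (auto simp: mem_Times_iff)
    then have "z \<in> plane_point ` e" "w \<in> plane_point ` f"
      using \<alpha> \<beta> e f w unfolding clean_drawing_def by blast+
    then obtain u v where uv: "u \<in> e" "z = plane_point u" "v \<in> f" "w = plane_point v" by blast
    then have "plane_point u = plane_point (raise v)" using w(2) plane_point_raise by metis
    then have "u = raise v" using inj_plane_point by (simp add: inj_eq)
    then show False using uv e(2) f(2) KK by blast
  qed
  have ne: "e \<noteq> {}" if "e \<in> a \<or> e \<in> b" for e
    using that upper lower by (auto simp: perfect_matching_def partition_on_def)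
  show ?thesis
  proof (rule ccontr)
    assume "drawn_component \<alpha> \<beta> K \<inter> drawn_component \<alpha> \<beta> K' \<noteq> {}"
    then obtain z where z: "z \<in> drawn_component \<alpha> \<beta> K" "z \<in> drawn_component \<alpha> \<beta> K'" by blast
    have cases: "(\<exists>e\<in>b. e \<subseteq> K \<and> z \<in> path_image (\<beta> e)) \<or> (\<exists>e\<in>a. raise ` e \<subseteq> K \<and> z \<in> (\<lambda>z. z + (0, 1)) ` path_image (\<alpha> e))"
      if "z \<in> drawn_component \<alpha> \<beta> K" for K
      using that unfolding drawn_component_def by blast
    from cases[OF z(1)] cases[OF z(2)] show False
    proof (elim disjE bexE conjE)
      fix e f assume ef: "e \<in> b" "e \<subseteq> K" "z \<in> path_image (\<beta> e)" "f \<in> b" "f \<subseteq> K'" "z \<in> path_image (\<beta> f)"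
      then have "e \<noteq> f" using ne disj by blast
      then show False using \<beta> ef unfolding clean_drawing_def disjoint_family_on_def by blast
    next
      fix e f assume "e \<in> b" "e \<subseteq> K" "z \<in> path_image (\<beta> e)"
        "f \<in> a" "raise ` f \<subseteq> K'" "z \<in> (\<lambda>z. z + (0, 1)) ` path_image (\<alpha> f)"
      then show False using mixed disj by blast
    next
      fix e f assume "e \<in> a" "raise ` e \<subseteq> K" "z \<in> (\<lambda>z. z + (0, 1)) ` path_image (\<alpha> e)"
        "f \<in> b" "f \<subseteq> K'" "z \<in> path_image (\<beta> f)"
      then show False using mixed[of f K' z e K] disj by blast
    next
      fix e f assume ef: "e \<in> a" "raise ` e \<subseteq> K" "z \<in> (\<lambda>z. z + (0, 1)) ` path_image (\<alpha> e)"
        "f \<in> a" "raise ` f \<subseteq> K'" "z \<in> (\<lambda>z. z + (0, 1)) ` path_image (\<alpha> f)"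
      then obtain w w' where w: "w \<in> path_image (\<alpha> e)" "w' \<in> path_image (\<alpha> f)" "z = w + (0, 1)" "z = w' + (0, 1)"
        by blast
      then have "w = w'" by simp
      moreover have "e \<noteq> f" using ef ne disj by blast
      ultimately show False using \<alpha> ef w unfolding clean_drawing_def disjoint_family_on_def by blast
    qed
  qed
qed

lemma drawn_component_strip:
  assumes \<alpha>: "clean_drawing a \<alpha>" and \<beta>: "clean_drawing b \<beta>"
  shows "drawn_component \<alpha> \<beta> K \<subseteq> UNIV \<times> {0..2}"
proof -
  have "path_image (\<beta> e) \<subseteq> UNIV \<times> {0..2}" if "e \<in> b" for e
  proof -
    have "path_image (\<beta> e) \<subseteq> UNIV \<times> {0..1}" using \<beta> that by (simp add: clean_drawing_def)
    also have "\<dots> \<subseteq> UNIV \<times> {0..2}" by auto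
    finally show ?thesis .
  qed
  moreover have "(\<lambda>z. z + (0, 1)) ` path_image (\<alpha> e) \<subseteq> UNIV \<times> {0..2}" if "e \<in> a" for e
  proof -
    have "(\<lambda>z. z + (0, 1)) ` path_image (\<alpha> e) \<subseteq> (\<lambda>z. z + (0, 1)) ` (UNIV \<times> {0..1})"
      using \<alpha> that by (intro image_mono) (simp add: clean_drawing_def)
    also have "\<dots> \<subseteq> UNIV \<times> {0..2}" by auto
    finally show ?thesis .
  qed
  ultimately show ?thesis unfolding drawn_component_def by blast
qed

definition squash :: "real \<times> real \<Rightarrow> real \<times> real" where "squash z = (fst z, snd z / 2)"

lemma inj_squash: "inj squash"
  by (auto simp: inj_def squash_def prod_eq_iff)

lemma glue_drawing:
  assumes \<alpha>: "clean_drawing a \<alpha>" and \<beta>: "clean_drawing b \<beta>" and f: "f \<in> glue p q r a b"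
  shows "\<exists>K \<gamma>. K \<in> stack_components p q r a b \<and> f = collapse ` (K \<inter> outer) \<and> arc \<gamma> \<and>
    path_image \<gamma> \<subseteq> squash ` drawn_component \<alpha> \<beta> K \<and> {pathstart \<gamma>, pathfinish \<gamma>} = plane_point ` f"
proof -
  obtain K where K: "K \<in> stack_components p q r a b" "K \<inter> outer \<noteq> {}" "f = collapse ` (K \<inter> outer)"
    using f unfolding glue_eq by blast
  have KV: "K \<subseteq> stack_vertices p q r" using K(1) partition_on_stack_components by (auto simp: partition_on_def)
  have fin: "finite (K \<inter> outer)" using KV finite_stack_vertices finite_subset by blast
  then have "card (K \<inter> outer) \<noteq> 0" using K(2) by simp
  then have "card (K \<inter> outer) = 2" using card_outer_component[OF K(1)] by simp
  then obtain u v where uv: "K \<inter> outer = {u, v}" "u \<noteq> v" by (auto simp: card_2_iff)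
  have ne: "plane_point u \<noteq> plane_point v" using uv(2) inj_plane_point by (simp add: inj_eq)
  have "path_component (drawn_component \<alpha> \<beta> K) (plane_point u) (plane_point v)"
    using uv by (intro drawn_component_connected[OF \<alpha> \<beta> K(1)]) blast+
  then obtain g where "path g" "path_image g \<subseteq> drawn_component \<alpha> \<beta> K" "pathstart g = plane_point u" "pathfinish g = plane_point v"
    unfolding path_component_def by blast
  with ne obtain h where h: "arc h" "path_image h \<subseteq> drawn_component \<alpha> \<beta> K" "pathstart h = plane_point u" "pathfinish h = plane_point v"
    using path_contains_arc[of g] by (metis order_trans)
  have sq: "squash (plane_point w) = plane_point (collapse w)" if "w \<in> {u, v}" for w
  proof -
    have "w \<in> stack_vertices p q r \<inter> outer" using that uv KV by blast
    then have "snd w = 0 \<or> snd w = 2" by (auto simp: stack_vertices_def outer_def)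
    then show ?thesis by (cases w) (auto simp: squash_def plane_point_def collapse_def)
  qed
  have "arc (squash \<circ> h)"
    unfolding arc_def
  proof (intro conjI path_continuous_image comp_inj_on)
    show "path h" "inj_on h {0..1}" using h(1) by (auto simp: arc_def)
    show "continuous_on (path_image h) squash" unfolding squash_def by (intro continuous_intros) simp
    show "inj_on squash (h ` {0..1})" by (rule inj_on_subset[OF inj_squash subset_UNIV])
  qed
  moreover have "path_image (squash \<circ> h) \<subseteq> squash ` drawn_component \<alpha> \<beta> K"
    unfolding path_image_compose using h(2) by blast
  moreover have "{pathstart (squash \<circ> h), pathfinish (squash \<circ> h)} = plane_point ` f"
    unfolding K(3) uv(1) by (simp add: pathstart_compose pathfinish_compose h sq)
  ultimately show ?thesis using K by blast
qed

lemma glue_crossingless_drawing: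
  assumes \<alpha>: "clean_drawing a \<alpha>" and \<beta>: "clean_drawing b \<beta>"
  shows "glue p q r a b \<in> crossingless p r"
proof -
  obtain \<kappa> \<gamma> where *: "\<And>f. f \<in> glue p q r a b \<Longrightarrow> \<kappa> f \<in> stack_components p q r a b \<and> f = collapse ` (\<kappa> f \<inter> outer) \<and> arc (\<gamma> f) \<and>
    path_image (\<gamma> f) \<subseteq> squash ` drawn_component \<alpha> \<beta> (\<kappa> f) \<and> {pathstart (\<gamma> f), pathfinish (\<gamma> f)} = plane_point ` f"
    using glue_drawing[OF \<alpha> \<beta>] by metis
  show ?thesis
    unfolding crossingless_def mem_Collect_eq
  proof (intro conjI exI[of _ \<gamma>] ballI perfect_matching_glue)
    fix f assume f: "f \<in> glue p q r a b"
    show "arc (\<gamma> f)" "{pathstart (\<gamma> f), pathfinish (\<gamma> f)} = plane_point ` f" using *[OF f] by blast+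
    have "path_image (\<gamma> f) \<subseteq> squash ` drawn_component \<alpha> \<beta> (\<kappa> f)" using *[OF f] by blast
    also have "\<dots> \<subseteq> squash ` (UNIV \<times> {0..2})" by (intro image_mono drawn_component_strip[OF \<alpha> \<beta>])
    also have "\<dots> \<subseteq> UNIV \<times> {0..1}" by (auto simp: squash_def)
    finally show "path_image (\<gamma> f) \<subseteq> UNIV \<times> {0..1}" .
  next
    show "disjoint_family_on (\<lambda>f. path_image (\<gamma> f)) (glue p q r a b)"
      unfolding disjoint_family_on_def
    proof (intro ballI impI)
      fix f g assume fg: "f \<in> glue p q r a b" "g \<in> glue p q r a b" "f \<noteq> g"
      then have "\<kappa> f \<noteq> \<kappa> g" using * by metis
      then have "\<kappa> f \<inter> \<kappa> g = {}"
        using * fg partition_on_stack_components unfolding partition_on_def disjoint_def by blast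
      then have "drawn_component \<alpha> \<beta> (\<kappa> f) \<inter> drawn_component \<alpha> \<beta> (\<kappa> g) = {}"
        by (rule drawn_components_disjoint[OF \<alpha> \<beta>])
      then have "squash ` drawn_component \<alpha> \<beta> (\<kappa> f) \<inter> squash ` drawn_component \<alpha> \<beta> (\<kappa> g) = {}"
        using inj_squash by (simp flip: image_Int)
      moreover have "path_image (\<gamma> f) \<subseteq> squash ` drawn_component \<alpha> \<beta> (\<kappa> f)"
        "path_image (\<gamma> g) \<subseteq> squash ` drawn_component \<alpha> \<beta> (\<kappa> g)" using * fg by blast+
      ultimately show "path_image (\<gamma> f) \<inter> path_image (\<gamma> g) = {}" by blast
    qed
  qed
qed

end

theorem glue_crossingless:
  assumes a: "a \<in> crossingless q r" and b: "b \<in> crossingless p q"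
  shows "glue p q r a b \<in> crossingless p r"
proof -
  interpret stacked_matchings p q r a b
    using a b by unfold_locales (simp_all add: crossingless_iff)
  obtain \<alpha> where \<alpha>: "clean_drawing a \<alpha>" using crossingless_clean_drawing[OF a] .
  obtain \<beta> where \<beta>: "clean_drawing b \<beta>" using crossingless_clean_drawing[OF b] .
  show ?thesis by (rule glue_crossingless_drawing[OF \<alpha> \<beta>])
qed


section \<open>Splitting off a cap\<close>

text \<open>The increasing enumeration of the positive integers other than \<open>i\<close> and \<open>i + 1\<close>.\<close>

definition skip :: "nat \<Rightarrow> nat \<Rightarrow> nat" where
  "skip i x = (if x < i then x else x + 2)"

definition cap :: "nat \<Rightarrow> nat \<Rightarrow> (nat \<times> nat) set set" where
  "cap p i = insert {(i, 0), (i + 1, 0)} ((\<lambda>x. {(skip i x, 0), (x, 1)}) ` {1..p - 2})"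

lemma skip_less_iff: "skip i x < skip i y \<longleftrightarrow> x < y"
  and skip_eq_iff: "skip i x = skip i y \<longleftrightarrow> x = y"
  and skip_neq: "skip i x \<noteq> i" "skip i x \<noteq> Suc i" "i \<noteq> skip i x" "Suc i \<noteq> skip i x"
  by (auto simp: skip_def)

lemma skip_range:
  assumes "1 \<le> i" "i < p"
  shows "skip i ` {1..p - 2} = {1..p} - {i, i + 1}"
proof
  show "skip i ` {1..p - 2} \<subseteq> {1..p} - {i, i + 1}"
    using assms by (auto simp: skip_def split: if_splits)
  show "{1..p} - {i, i + 1} \<subseteq> skip i ` {1..p - 2}"
  proof
    fix y assume y: "y \<in> {1..p} - {i, i + 1}"
    show "y \<in> skip i ` {1..p - 2}"
    proof (cases "y < i")
      case True
      then show ?thesis using y assms by (intro image_eqI[of _ _ y]) (auto simp: skip_def)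
    next
      case False
      then show ?thesis using y assms by (intro image_eqI[of _ _ "y - 2"]) (auto simp: skip_def)
    qed
  qed
qed

lemma perfect_matching_cap:
  assumes i: "1 \<le> i" "i < p"
  shows "matching p (p - 2) (cap p i)"
proof -
  have "partition_on (marked_points p (p - 2)) (cap p i)"
  proof (rule partition_onI)
    have "\<Union> (cap p i) = {(i, 0), (i + 1, 0)} \<union> (skip i ` {1..p - 2}) \<times> {0} \<union> {1..p - 2} \<times> {1}"
      unfolding cap_def by auto
    also have "\<dots> = marked_points p (p - 2)"
      unfolding skip_range[OF i] marked_points_def using i by auto
    finally show "\<Union> (cap p i) = marked_points p (p - 2)" .
  next
    fix e f assume "e \<in> cap p i" "f \<in> cap p i" "e \<noteq> f"
    then show "disjnt e f"
      unfolding cap_def by (auto simp: disjnt_def skip_eq_iff skip_neq)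
  qed (auto simp: cap_def)
  moreover have "card e = 2" if "e \<in> cap p i" for e
    using that by (auto simp: cap_def)
  ultimately show ?thesis by (simp add: perfect_matching_def)
qed

lemma cap_crossingless:
  assumes i: "1 \<le> i" "i < p"
  shows "cap p i \<in> crossingless p (p - 2)"
proof -
  have blk: "(a = (i, 0) \<or> a = (i + 1, 0)) \<and> (c = (i, 0) \<or> c = (i + 1, 0)) \<or>
      (\<exists>x. (a = (skip i x, 0) \<or> a = (x, 1)) \<and> (c = (skip i x, 0) \<or> c = (x, 1)))"
    if "e \<in> cap p i" "a \<in> e" "c \<in> e" for e a c
    using that unfolding cap_def by blast
  have "noncrossing (cap p i)"
    unfolding noncrossing_def
  proof (intro ballI notI)
    fix e f a b c d
    assume m: "e \<in> cap p i" "f \<in> cap p i" "a \<in> e" "b \<in> f" "c \<in> e" "d \<in> f"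
      and less: "boundary_order a < boundary_order b \<and> boundary_order b < boundary_order c \<and>
        boundary_order c < boundary_order d"
    show False
      using blk[OF m(1,3,5)] blk[OF m(2,4,6)] less
      by (elim disjE exE conjE) (auto simp: boundary_order_def skip_less_iff)
  qed
  then show ?thesis using perfect_matching_cap[OF i] by (simp add: crossingless_iff)
qed

lemma colourings_cap:
  assumes i: "1 \<le> i" "i < p"
  shows "(B, T) \<in> colourings p (p - 2) (cap p i) \<longleftrightarrow>
    B \<subseteq> {1..p} \<and> T \<subseteq> {1..p - 2} \<and> (i \<in> B \<longleftrightarrow> i + 1 \<in> B) \<and> (\<forall>x\<in>{1..p - 2}. skip i x \<in> B \<longleftrightarrow> x \<in> T)"
proof -
  have "saturated (cap p i) (B \<times> {0} \<union> T \<times> {1}) \<longleftrightarrow>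
     (i \<in> B \<longleftrightarrow> i + 1 \<in> B) \<and> (\<forall>x\<in>{1..p - 2}. skip i x \<in> B \<longleftrightarrow> x \<in> T)"
    unfolding saturated_def cap_def by auto
  then show ?thesis by (simp add: colourings_def)
qed

lemma cap_flip_cap:
  assumes i: "1 \<le> i" "i < p"
  shows "glue (p - 2) p (p - 2) (cap p i) (flip (cap p i)) = id_diagram (p - 2)"
proof (rule colourings_inject)
  note c = perfect_matching_cap[OF i] and f = perfect_matching_flip[OF perfect_matching_cap[OF i]]
  show "matching (p - 2) (p - 2) (glue (p - 2) p (p - 2) (cap p i) (flip (cap p i)))"
    by (rule perfect_matching_glue[OF c f])
  show "matching (p - 2) (p - 2) (id_diagram (p - 2))"
    by (rule perfect_matching_id_diagram)
  have "(T, T') \<in> (colourings p (p - 2) (cap p i))\<inverse> O colourings p (p - 2) (cap p i) \<longleftrightarrow>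
      (T, T') \<in> Id_on (Pow {1..p - 2})" for T T'
  proof
    assume "(T, T') \<in> (colourings p (p - 2) (cap p i))\<inverse> O colourings p (p - 2) (cap p i)"
    then obtain B where "(B, T) \<in> colourings p (p - 2) (cap p i)" "(B, T') \<in> colourings p (p - 2) (cap p i)"
      by blast
    then have "T \<subseteq> {1..p - 2}" "T' \<subseteq> {1..p - 2}" "\<forall>x\<in>{1..p - 2}. x \<in> T \<longleftrightarrow> x \<in> T'"
      unfolding colourings_cap[OF i] by blast+
    then show "(T, T') \<in> Id_on (Pow {1..p - 2})" unfolding Id_on_iff by blast
  next
    assume "(T, T') \<in> Id_on (Pow {1..p - 2})"
    then have T: "T' = T" "T \<subseteq> {1..p - 2}" by auto
    have "skip i ` T \<subseteq> {1..p}" using T(2) skip_range[OF i] by blast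
    moreover have "skip i x \<in> skip i ` T \<longleftrightarrow> x \<in> T" for x by (simp add: image_iff skip_eq_iff)
    moreover have "i \<notin> skip i ` T" "i + 1 \<notin> skip i ` T" by (auto simp: skip_neq)
    ultimately have "(skip i ` T, T) \<in> colourings p (p - 2) (cap p i)"
      using T(2) unfolding colourings_cap[OF i] by blast
    then show "(T, T') \<in> (colourings p (p - 2) (cap p i))\<inverse> O colourings p (p - 2) (cap p i)"
      unfolding T(1) by blast
  qed
  then show "colourings (p - 2) (p - 2) (glue (p - 2) p (p - 2) (cap p i) (flip (cap p i))) =
      colourings (p - 2) (p - 2) (id_diagram (p - 2))"
    unfolding colourings_glue[OF c f] colourings_flip[OF c] colourings_id_diagram
    by (intro Set.set_eqI) (simp only: split_paired_all)
qed

text \<open>Composing with the reflected cap and the cap leaves colours outside \<open>i\<close> and \<open>i + 1\<close> alone and makes the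
  colours of these two points equal but otherwise arbitrary. If \<open>a\<close> joins the two points, it allows
  both colours for them.\<close>

lemma absorb_cap:
  assumes i: "1 \<le> i" "i < p" and a: "matching p q a" and e: "{(i, 0), (i + 1, 0)} \<in> a"
  shows "glue p (p - 2) q (glue (p - 2) p q a (flip (cap p i))) (cap p i) = a"
proof (rule colourings_inject)
  note c = perfect_matching_cap[OF i] and f = perfect_matching_flip[OF perfect_matching_cap[OF i]]
  note af = perfect_matching_glue[OF a f]
  show "matching p q (glue p (p - 2) q (glue (p - 2) p q a (flip (cap p i))) (cap p i))"
    by (rule perfect_matching_glue[OF af c])
  show "matching p q a" by (rule a)
  let ?C = "colourings p (p - 2) (cap p i)" and ?A = "colourings p q a"
  have "(B, W) \<in> ?C O ?C\<inverse> O ?A \<longleftrightarrow> (B, W) \<in> ?A" for B W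
  proof
    assume "(B, W) \<in> ?C O ?C\<inverse> O ?A"
    then obtain T B' where T: "(B, T) \<in> ?C" "(B', T) \<in> ?C" and B': "(B', W) \<in> ?A" by blast
    have BT: "B \<subseteq> {1..p}" "i \<in> B \<longleftrightarrow> i + 1 \<in> B" using T(1) unfolding colourings_cap[OF i] by blast+
    have agree: "y \<in> B \<longleftrightarrow> y \<in> B'" if y: "y \<noteq> i" "y \<noteq> i + 1" for y
    proof (cases "y \<in> {1..p}")
      case True
      then have "y \<in> skip i ` {1..p - 2}" unfolding skip_range[OF i] using y by blast
      then obtain x where "x \<in> {1..p - 2}" "y = skip i x" by blast
      then show ?thesis using T unfolding colourings_cap[OF i] by blast
    next
      case False
      then show ?thesis using T unfolding colourings_cap[OF i] by blast
    qed
    have sat: "saturated a (B' \<times> {0} \<union> W \<times> {1})" and W: "W \<subseteq> {1..q}" using B' by (auto simp: colourings_def)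
    have "saturated a (B \<times> {0} \<union> W \<times> {1})"
      unfolding saturated_def
    proof
      fix f assume f: "f \<in> a"
      show "f \<subseteq> B \<times> {0} \<union> W \<times> {1} \<or> f \<inter> (B \<times> {0} \<union> W \<times> {1}) = {}"
      proof (cases "f = {(i, 0), (i + 1, 0)}")
        case True
        then show ?thesis using BT(2) by auto
      next
        case False
        have nin: "(i, 0) \<notin> f" "(i + 1, 0) \<notin> f"
          using perfect_matching_block_unique[OF a e f] False by blast+
        have mem: "v \<in> B \<times> {0} \<union> W \<times> {1} \<longleftrightarrow> v \<in> B' \<times> {0} \<union> W \<times> {1}" if "v \<in> f" for v
        proof (cases v)
          case (Pair x y)
          then have "y = 0 \<Longrightarrow> x \<noteq> i \<and> x \<noteq> i + 1" using nin that by blast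
          then show ?thesis using agree[of x] Pair by auto
        qed
        have "f \<subseteq> B' \<times> {0} \<union> W \<times> {1} \<or> f \<inter> (B' \<times> {0} \<union> W \<times> {1}) = {}"
          using sat f unfolding saturated_def by (rule bspec)
        then have "(\<forall>v\<in>f. v \<in> B' \<times> {0} \<union> W \<times> {1}) \<or> (\<forall>v\<in>f. v \<notin> B' \<times> {0} \<union> W \<times> {1})" by blast
        then have "(\<forall>v\<in>f. v \<in> B \<times> {0} \<union> W \<times> {1}) \<or> (\<forall>v\<in>f. v \<notin> B \<times> {0} \<union> W \<times> {1})"
          by (simp only: mem cong: ball_cong)
        then show ?thesis by blast
      qed
    qed
    then show "(B, W) \<in> ?A" using BT(1) W by (simp add: colourings_def)
  next
    assume BW: "(B, W) \<in> ?A"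
    then have B: "B \<subseteq> {1..p}" by (simp add: colourings_def)
    have "i \<in> {1..p}" "i + 1 \<in> {1..p}" "i \<noteq> i + 1" using i by auto
    then have "i \<in> B \<longleftrightarrow> i + 1 \<in> B" using bottom_block_iff[OF a] e BW by blast
    then have "(B, {x\<in>{1..p - 2}. skip i x \<in> B}) \<in> ?C" using B unfolding colourings_cap[OF i] by blast
    then show "(B, W) \<in> ?C O ?C\<inverse> O ?A" using BW by blast
  qed
  then show "colourings p q (glue p (p - 2) q (glue (p - 2) p q a (flip (cap p i))) (cap p i)) = ?A"
    unfolding colourings_glue[OF af c] colourings_glue[OF a f] colourings_flip[OF c]
    by (intro Set.set_eqI) (simp only: split_paired_all)
qed

text \<open>Take a cap of minimal width. If it were wider than 1, the strand that starts right inside it could not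
  leave it without crossing, so it would be a narrower cap.\<close>

lemma adjacent_cap_exists:
  assumes a: "a \<in> crossingless p q" and x: "x \<in> {1..p}" "x \<notin> through a"
  obtains i where "1 \<le> i" "i < p" "{(i, 0), (i + 1, 0)} \<in> a"
proof -
  have pm: "matching p q a" and nc: "noncrossing a"
    using a by (auto simp: crossingless_iff)
  define Q where "Q = (\<lambda>d. \<exists>i. 1 \<le> i \<and> 0 < d \<and> i + d \<le> p \<and> {(i, 0), (i + d, 0)} \<in> a)"
  obtain y where y: "y \<in> {1..p}" "y \<noteq> x" "{(x, 0), (y, 0)} \<in> a"
    using not_through_iff[OF pm x(1)] x(2) by blast
  have "\<exists>d. Q d"
  proof (cases "x < y")
    case True
    then have "Q (y - x)" using x(1) y unfolding Q_def by (intro exI[of _ x]) auto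
    then show ?thesis ..
  next
    case False
    then have "Q (x - y)" using x(1) y unfolding Q_def by (intro exI[of _ y]) (auto simp: insert_commute)
    then show ?thesis ..
  qed
  then obtain d where d: "Q d" "\<And>d'. d' < d \<Longrightarrow> \<not> Q d'" by (metis exists_least_iff)
  from d(1) obtain i where i: "1 \<le> i" "0 < d" "i + d \<le> p" "{(i, 0), (i + d, 0)} \<in> a" unfolding Q_def by blast
  have "d = 1"
  proof (rule ccontr)
    assume "d \<noteq> 1"
    then have d1: "d > 1" using i(2) by simp
    have "(i + 1, 0) \<in> marked_points p q" using i d1 by (simp add: marked_points_iff)
    then obtain f where f: "f \<in> a" "(i + 1, 0) \<in> f" by (rule perfect_matching_obtain_block[OF pm])
    moreover have "card f = 2" using pm f(1) by (simp add: perfect_matching_def)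
    ultimately obtain v where v: "f = {(i + 1, 0), v}" "v \<noteq> (i + 1, 0)" by (auto simp: card_2_iff)
    have fne: "f \<noteq> {(i, 0), (i + d, 0)}" using f(2) d1 by auto
    have vn: "v \<noteq> (i, 0)" "v \<noteq> (i + d, 0)"
      using perfect_matching_block_unique[OF pm f(1) i(4), of v] fne v(1) by blast+
    have vm: "v \<in> marked_points p q" using perfect_matching_block_subset[OF pm f(1)] v(1) by blast
    have inj: "w = v" if "boundary_order w = boundary_order v" "w \<in> marked_points p q" for w
      using inj_onD[OF inj_on_boundary_order that vm] .
    have bottom: "boundary_order (j, 0) = int j" for j by (simp add: boundary_order_def)
    have mp: "(i, 0) \<in> marked_points p q" "(i + d, 0) \<in> marked_points p q"
      using i by (auto simp: marked_points_iff)
    have "\<not> boundary_order v < int i"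
      using noncrossingD[OF nc f(1) i(4), of v "(i, 0)" "(i + 1, 0)" "(i + d, 0)"] v(1) d1
      by (auto simp: boundary_order_def)
    moreover have "\<not> boundary_order v > int (i + d)"
      using noncrossingD[OF nc i(4) f(1), of "(i, 0)" "(i + 1, 0)" "(i + d, 0)" v] v(1) d1
      by (auto simp: boundary_order_def)
    moreover have "boundary_order v \<noteq> int i" "boundary_order v \<noteq> int (i + d)"
      using inj[OF _ mp(1)] inj[OF _ mp(2)] vn bottom by metis+
    ultimately have less: "int i < boundary_order v" "boundary_order v < int (i + d)" by linarith+
    then obtain j where j: "v = (j, 0)" "i < j" "j < i + d"
      by (cases v) (auto simp: boundary_order_def split: if_splits)
    then have "i + 1 < j" using v(2) by (cases "j = i + 1") auto
    then have "Q (j - (i + 1))" using f(1) v(1) j i unfolding Q_def by (intro exI[of _ "i + 1"]) auto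
    moreover have "j - (i + 1) < d" using j by linarith
    ultimately show False using d(2) by blast
  qed
  then show ?thesis using that[of i] i by auto
qed

text \<open>The strands define an increasing map from \<open>{1..p}\<close> to itself.\<close>

lemma all_through_imp_id:
  assumes a: "a \<in> crossingless p p" and th: "through a = {1..p}"
  shows "a = id_diagram p"
proof -
  have pm: "matching p p a" and nc: "noncrossing a"
    using a by (auto simp: crossingless_iff)
  have "\<forall>x\<in>{1..p}. \<exists>y. {(x, 0), (y, 1)} \<in> a" using th unfolding through_def by blast
  then obtain t where t: "\<And>x. x \<in> {1..p} \<Longrightarrow> {(x, 0), (t x, 1)} \<in> a" by metis
  have tr: "t x \<in> {1..p}" if "x \<in> {1..p}" for x
    using perfect_matching_block_subset[OF pm t[OF that]] by (auto simp: marked_points_iff)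
  have mono: "t x < t y" if "x \<in> {1..p}" "y \<in> {1..p}" "x < y" for x y
  proof (rule ccontr)
    assume "\<not> t x < t y"
    moreover have "t x \<noteq> t y" using through_top_eq[OF pm t[OF that(1)] t[OF that(2)]] that(3) by simp
    ultimately have "t y < t x" by simp
    then show False
      using noncrossingD[OF nc t[OF that(1)] t[OF that(2)], of "(t x, 1)" "(t y, 1)" "(x, 0)" "(y, 0)"] that tr[OF that(2)]
      by (simp add: boundary_order_def)
  qed
  have ge: "x \<le> t x" if "x \<in> {1..p}" for x
    using that
  proof (induction x)
    case (Suc x)
    show ?case
    proof (cases "x = 0")
      case True then show ?thesis using tr[OF Suc.prems] by simp
    next
      case False
      then have "x \<in> {1..p}" using Suc.prems by simp
      then show ?thesis using Suc.IH mono[of x "Suc x"] Suc.prems by fastforce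
    qed
  qed simp
  have le: "t x \<le> x" if "x + d = p" "1 \<le> x" for x d
    using that
  proof (induction d arbitrary: x)
    case 0 then show ?case using tr[of x] by simp
  next
    case (Suc d)
    then have "t (x + 1) \<le> x + 1" by simp
    moreover have "t x < t (x + 1)" using Suc.prems by (intro mono) auto
    ultimately show ?case by simp
  qed
  have tx: "t x = x" if "x \<in> {1..p}" for x
    using ge[OF that] le[of x "p - x"] that by fastforce
  have sub: "id_diagram p \<subseteq> a" using t tx unfolding id_diagram_def by fastforce
  have "a \<subseteq> id_diagram p"
  proof
    fix e assume e: "e \<in> a"
    then have "e \<noteq> {}" using pm by (auto simp: perfect_matching_def)
    then obtain v where v: "v \<in> e" by blast
    then have "v \<in> marked_points p p" using perfect_matching_block_subset[OF pm e] by blast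
    then obtain f where f: "f \<in> id_diagram p" "v \<in> f"
      by (rule perfect_matching_obtain_block[OF perfect_matching_id_diagram])
    then have "e = f" using perfect_matching_block_unique[OF pm e _ v f(2)] sub by blast
    then show "e \<in> id_diagram p" using f(1) by simp
  qed
  then show ?thesis using sub by blast
qed

section \<open>Factorising a diagram along its through strands\<close>

text \<open>Reflection plays the role of the adjoint. Loops are not counted here, so \<open>u\<close> is inverted from the
  left only up to powers of the central generator once loops are recorded.\<close>

definition isometry :: "nat \<Rightarrow> nat \<Rightarrow> (nat \<times> nat) set set \<Rightarrow> bool" where
  "isometry k n u \<longleftrightarrow> u \<in> crossingless k n \<and> glue k n k (flip u) u = id_diagram k"

lemma isometry_perfect_matching: "isometry k n u \<Longrightarrow> matching k n u"
  by (simp add: isometry_def crossingless_perfect_matching)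

lemma isometry_crossingless: "isometry k n u \<Longrightarrow> u \<in> crossingless k n"
  by (simp add: isometry_def)

lemma isometry_iff:
  "isometry k n u \<longleftrightarrow> u \<in> crossingless k n \<and>
     colourings k n u O (colourings k n u)\<inverse> = Id_on (Pow {1..k})"
proof (cases "u \<in> crossingless k n")
  case True
  then have u: "matching k n u" by (rule crossingless_perfect_matching)
  note f = perfect_matching_flip[OF u]
  have col: "colourings k k (glue k n k (flip u) u) = colourings k n u O (colourings k n u)\<inverse>"
    unfolding colourings_glue[OF f u] colourings_flip[OF u] ..
  have "glue k n k (flip u) u = id_diagram k \<longleftrightarrow>
      colourings k k (glue k n k (flip u) u) = colourings k k (id_diagram k)"
    using colourings_inject[OF perfect_matching_glue[OF f u] perfect_matching_id_diagram] by metis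
  then show ?thesis using True unfolding isometry_def col colourings_id_diagram by (simp only:)
qed (simp add: isometry_def)

lemma Id_on_colourings_comp:
  "Id_on (Pow {1..p}) O colourings p q a O Y = colourings p q a O Y"
  "Id_on (Pow {1..q}) O (colourings p q a)\<inverse> = (colourings p q a)\<inverse>"
  "Id_on (Pow {1..q}) O (colourings p q a)\<inverse> O Y = (colourings p q a)\<inverse> O Y"
  using colourings_subset[of p q a] by blast+

lemma isometry_cancel:
  assumes "isometry k n u"
  shows "colourings k n u O (colourings k n u)\<inverse> = Id_on (Pow {1..k})"
    "colourings k n u O (colourings k n u)\<inverse> O Y = Id_on (Pow {1..k}) O Y"
  using assms unfolding isometry_iff by (auto simp only: O_assoc[symmetric])

text \<open>Relations are normalised to right-nested products, in which \<open>isometry_cancel\<close> removes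
  a relation followed by its converse.\<close>

lemmas relation_simps =
  O_assoc converse_relcomp converse_converse Id_on_colourings_comp colourings_id_left colourings_id_right

lemma isometry_id_diagram: "isometry n n (id_diagram n)"
proof -
  have "Id_on (Pow {1..n}) O (Id_on (Pow {1..n}))\<inverse> = Id_on (Pow {1..n})" by blast
  then show ?thesis unfolding isometry_iff colourings_id_diagram by (intro conjI id_diagram_crossingless)
qed

lemma isometry_flip_cap:
  assumes i: "1 \<le> i" "i < p"
  shows "isometry (p - 2) p (flip (cap p i))"
  unfolding isometry_def flip_flip[OF perfect_matching_cap[OF i]]
  by (intro conjI cap_flip_cap[OF i] flip_crossingless[OF cap_crossingless[OF i]])

lemma isometry_glue:
  assumes u: "isometry k l u" and w: "isometry l n w"
  shows "isometry k n (glue k l n w u)"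
proof -
  note pm = isometry_perfect_matching[OF w] isometry_perfect_matching[OF u]
  have "colourings k n (glue k l n w u) O (colourings k n (glue k l n w u))\<inverse> = Id_on (Pow {1..k})"
    unfolding colourings_glue[OF pm]
    by (simp only: relation_simps isometry_cancel[OF u] isometry_cancel[OF w])
  then show ?thesis
    unfolding isometry_iff
    by (intro conjI glue_crossingless[OF isometry_crossingless[OF w] isometry_crossingless[OF u]])
qed

lemma isometry_exists:
  assumes "k \<in> strand_numbers n"
  obtains u where "isometry k n u"
proof -
  have "\<exists>u. isometry k n u" using assms
  proof (induction n rule: less_induct)
    case (less n)
    show ?case
    proof (cases "k = n")
      case True
      then show ?thesis using isometry_id_diagram by blast
    next
      case False
      have kn: "k \<le> n" "k mod 2 = n mod 2" using less.prems by (auto simp: strand_numbers_def)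
      have "n \<noteq> Suc k" using kn(2) by (auto simp: mod_Suc split: if_splits)
      then have "k + 2 \<le> n" using kn(1) False by linarith
      then have k: "k \<le> n - 2" "2 \<le> n" by linarith+
      then have "k mod 2 = (n - 2) mod 2" using kn(2) le_mod_geq[of 2 n] by simp
      with k obtain u where u: "isometry k (n - 2) u" using less.IH[of "n - 2"] k by (auto simp: strand_numbers_def)
      have "isometry (n - 2) n (flip (cap n 1))" using k by (intro isometry_flip_cap) auto
      then show ?thesis using isometry_glue[OF u] by blast
    qed
  qed
  then show ?thesis using that by blast
qed

text \<open>Induction on the number of points. An adjacent cap is split off by \<open>absorb_cap\<close>, and a cup by
  reflecting the diagram first. A diagram without caps and cups is an identity.\<close>

lemma crossingless_factorisation:
  assumes "a \<in> crossingless p q"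
  obtains k u v where "isometry k q u" "isometry k p v" "a = glue p k q u (flip v)"
proof -
  have "\<exists>k u v. isometry k q u \<and> isometry k p v \<and> a = glue p k q u (flip v)" using assms
  proof (induction "p + q" arbitrary: p q a rule: less_induct)
    case (less p q a)
    have remove_cap: "\<exists>k u v. isometry k q' u \<and> isometry k p' v \<and> a' = glue p' k q' u (flip v)"
      if sum: "p' + q' = p + q" and a': "a' \<in> crossingless p' q'" and x: "x \<in> {1..p'}" "x \<notin> through a'"
      for p' q' a' x
    proof -
      obtain i where i: "1 \<le> i" "i < p'" "{(i, 0), (i + 1, 0)} \<in> a'"
        using adjacent_cap_exists[OF a' x] .
      note pm = crossingless_perfect_matching[OF a'] and cp = perfect_matching_cap[OF i(1,2)]
      note fp = perfect_matching_flip[OF cp]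
      have "glue (p' - 2) p' q' a' (flip (cap p' i)) \<in> crossingless (p' - 2) q'"
        using glue_crossingless[OF a' flip_crossingless[OF cap_crossingless[OF i(1,2)]]] .
      moreover have "p' - 2 + q' < p + q" using sum i by linarith
      ultimately obtain k u v where uv: "isometry k q' u" "isometry k (p' - 2) v"
          "glue (p' - 2) p' q' a' (flip (cap p' i)) = glue (p' - 2) k q' u (flip v)"
        using less.hyps by blast
      note u = isometry_perfect_matching[OF uv(1)] and v = isometry_perfect_matching[OF uv(2)]
      have "a' = glue p' (p' - 2) q' (glue (p' - 2) k q' u (flip v)) (cap p' i)"
        using absorb_cap[OF i(1,2) pm i(3)] uv(3) by simp
      also have "\<dots> = glue p' k q' u (glue p' (p' - 2) k (flip v) (cap p' i))"
        by (rule glue_assoc[OF u perfect_matching_flip[OF v] cp])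
      also have "glue p' (p' - 2) k (flip v) (cap p' i) = flip (glue k (p' - 2) p' (flip (cap p' i)) v)"
        unfolding flip_glue[OF fp v] flip_flip[OF cp] ..
      finally have "a' = glue p' k q' u (flip (glue k (p' - 2) p' (flip (cap p' i)) v))" .
      then show ?thesis using uv(1) isometry_glue[OF uv(2) isometry_flip_cap[OF i(1,2)]] by blast
    qed
    note pm = crossingless_perfect_matching[OF less.prems]
    consider x where "x \<in> {1..p}" "x \<notin> through a" | x where "x \<in> {1..q}" "x \<notin> through (flip a)"
      | "through a = {1..p}" "through (flip a) = {1..q}"
      using through_subset[OF pm] through_subset[OF perfect_matching_flip[OF pm]] by blast
    then show ?case
    proof cases
      case 1
      then show ?thesis using remove_cap[OF refl less.prems] by blast
    next
      case 2
      then obtain k u v where uv: "isometry k p u" "isometry k q v" "flip a = glue q k p u (flip v)"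
        using remove_cap[OF add.commute flip_crossingless[OF less.prems]] by blast
      note u = isometry_perfect_matching[OF uv(1)] and v = isometry_perfect_matching[OF uv(2)]
      have "a = flip (flip a)" using flip_flip[OF pm] by simp
      also have "\<dots> = glue p k q v (flip u)"
        unfolding uv(3) flip_glue[OF u perfect_matching_flip[OF v]] flip_flip[OF v] ..
      finally show ?thesis using uv by blast
    next
      case 3
      then have "p = q" using through_number_flip[OF pm] by (simp add: through_number_def)
      then have "a = id_diagram p" using all_through_imp_id less.prems 3 by blast
      then have "a = glue p p q (id_diagram p) (flip (id_diagram p))"
        using glue_id_left(1)[OF perfect_matching_id_diagram] isometry_id_diagram[of p] glue_id_right(1)[OF perfect_matching_flip[OF perfect_matching_id_diagram]]
        unfolding isometry_def \<open>p = q\<close> by simp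
      then show ?thesis using isometry_id_diagram \<open>p = q\<close> by blast
    qed
  qed
  then show ?thesis using that by blast
qed

text \<open>This recovers the identity on \<open>k\<close> strands from a factorised diagram; it both computes the number of
  through strands and is the reason why \<open>k\<close> strands can be reached from it.\<close>

lemma isometry_sandwich:
  assumes u: "isometry k q u" and v: "isometry k p v"
  shows "glue k q k (flip u) (glue k p q (glue p k q u (flip v)) v) = id_diagram k"
proof (rule colourings_inject)
  note pu = isometry_perfect_matching[OF u] and pv = isometry_perfect_matching[OF v]
  note fu = perfect_matching_flip[OF pu] and fv = perfect_matching_flip[OF pv]
  note 1 = perfect_matching_glue[OF pu fv] note 2 = perfect_matching_glue[OF 1 pv]
  show "matching k k (glue k q k (flip u) (glue k p q (glue p k q u (flip v)) v))"
    by (rule perfect_matching_glue[OF fu 2])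
  show "matching k k (id_diagram k)" by (rule perfect_matching_id_diagram)
  show "colourings k k (glue k q k (flip u) (glue k p q (glue p k q u (flip v)) v)) =
      colourings k k (id_diagram k)"
    unfolding colourings_glue[OF fu 2] colourings_glue[OF 1 pv] colourings_glue[OF pu fv]
      colourings_flip[OF pu] colourings_flip[OF pv] colourings_id_diagram
    by (simp only: relation_simps isometry_cancel[OF u] isometry_cancel[OF v])
qed

lemma through_number_factorised:
  assumes u: "isometry k q u" and v: "isometry k p v"
  shows "through_number (glue p k q u (flip v)) = k"
proof (rule antisym)
  note pu = isometry_perfect_matching[OF u] and pv = isometry_perfect_matching[OF v]
  note fu = perfect_matching_flip[OF pu] and fv = perfect_matching_flip[OF pv]
  note 1 = perfect_matching_glue[OF pu fv] note 2 = perfect_matching_glue[OF 1 pv]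
  show "through_number (glue p k q u (flip v)) \<le> k"
    using through_number_glue_le_lower[OF pu fv] through_number_flip[OF pv] through_number_le[OF pv] by simp
  show "k \<le> through_number (glue p k q u (flip v))"
    using through_number_glue_le_lower[OF fu 2] through_number_glue_le_upper[OF 1 pv]
    unfolding isometry_sandwich[OF u v] through_number_id_diagram by simp
qed

lemma through_number_strand_numbers:
  assumes a: "matching n q a"
  shows "through_number a \<in> strand_numbers n"
proof -
  define K where "K = ({1..n} - through a) \<times> {0 :: nat}"
  have "e \<subseteq> K \<or> e \<inter> K = {}" if e: "e \<in> a" for e
  proof (cases "e \<inter> K = {}")
    case False
    then obtain z where z: "z \<in> e" "z \<in> K" by blast
    define x where "x = fst z"
    have x: "(x, 0) \<in> e" "x \<in> {1..n}" "x \<notin> through a"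
      using z by (auto simp: K_def x_def)
    then obtain y where y: "y \<in> {1..n}" "y \<noteq> x" "{(x, 0), (y, 0)} \<in> a" using not_through_iff[OF a x(2)] by blast
    have "e = {(x, 0), (y, 0)}"
      by (rule perfect_matching_block_unique[OF a e y(3) x(1)]) simp
    moreover have "y \<notin> through a"
      using not_through_iff[OF a y(1)] x(2) y by (metis insert_commute)
    ultimately show ?thesis using x y by (simp add: K_def)
  qed simp
  then have "card (K \<inter> marked_points n q) = 2 * card {e \<in> a. e \<subseteq> K}"
    by (intro card_inside_perfect_matching[OF a]) auto
  moreover have "K \<inter> marked_points n q = K" by (auto simp: K_def marked_points_def)
  moreover have "card K = n - through_number a"
    unfolding K_def through_number_def using through_subset[OF a]
    by (simp add: card_cartesian_product card_Diff_subset finite_subset)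
  ultimately have "n - through_number a = 2 * card {e \<in> a. e \<subseteq> K}" by simp
  then have "n = through_number a + 2 * card {e \<in> a. e \<subseteq> K}" using through_number_le[OF a] by linarith
  then have "n mod 2 = through_number a mod 2" by (metis mod_mult_self2)
  then show ?thesis using through_number_le[OF a] unfolding strand_numbers_def by simp
qed

text \<open>With \<open>a = u v*\<close> through \<open>k\<close> and \<open>b = u' v'*\<close> through \<open>l \<le> k\<close> strands, and an isometry \<open>w\<close> from \<open>l\<close> to \<open>k\<close>,
  the product \<open>(u' w* u*) (u v*) (v w v'*)\<close> collapses to \<open>u' v'*\<close>.\<close>

theorem crossingless_reachable:
  assumes a: "a \<in> crossingless n n" and b: "b \<in> crossingless n n"
    and le: "through_number b \<le> through_number a"
  obtains c d where "c \<in> crossingless n n" "d \<in> crossingless n n" "b = glue n n n c (glue n n n a d)"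
proof -
  obtain k u v where a_eq: "isometry k n u" "isometry k n v" "a = glue n k n u (flip v)"
    using crossingless_factorisation[OF a] .
  obtain l u' v' where b_eq: "isometry l n u'" "isometry l n v'" "b = glue n l n u' (flip v')"
    using crossingless_factorisation[OF b] .
  note pm = crossingless_perfect_matching
  have kl: "through_number a = k" "through_number b = l"
    using through_number_factorised a_eq b_eq by blast+
  then have "l \<in> strand_numbers k"
    using le through_number_strand_numbers[OF pm[OF a]] through_number_strand_numbers[OF pm[OF b]]
    by (simp add: strand_numbers_def)
  then obtain w where w: "isometry l k w" by (rule isometry_exists)
  note iso = isometry_crossingless
  note cu = iso[OF a_eq(1)] and cv = iso[OF a_eq(2)] and cu' = iso[OF b_eq(1)] and cv' = iso[OF b_eq(2)] and cw = iso[OF w]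
  note fu = flip_crossingless[OF cu] and fv = flip_crossingless[OF cv] and fv' = flip_crossingless[OF cv'] and fw = flip_crossingless[OF cw]
  define c where "c = glue n k n (glue k l n u' (flip w)) (flip u)"
  define d where "d = glue n k n v (glue n l k w (flip v'))"
  note c1 = glue_crossingless[OF cu' fw] note c2 = glue_crossingless[OF c1 fu]
  note d1 = glue_crossingless[OF cw fv'] note d2 = glue_crossingless[OF cv d1]
  have c: "c \<in> crossingless n n" and d: "d \<in> crossingless n n" unfolding c_def d_def by (rule c2, rule d2)
  note ad = glue_crossingless[OF a d]
  have "b = glue n n n c (glue n n n a d)"
  proof (rule colourings_inject[OF pm[OF b] pm[OF glue_crossingless[OF c ad]]])
    have "colourings n n c = (colourings k n u)\<inverse> O (colourings l k w)\<inverse> O colourings l n u'"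
      unfolding c_def colourings_glue[OF pm[OF c1] pm[OF fu]] colourings_glue[OF pm[OF cu'] pm[OF fw]]
        colourings_flip[OF pm[OF cu]] colourings_flip[OF pm[OF cw]] ..
    moreover have "colourings n n d = (colourings l n v')\<inverse> O colourings l k w O colourings k n v"
      unfolding d_def colourings_glue[OF pm[OF cv] pm[OF d1]] colourings_glue[OF pm[OF cw] pm[OF fv']]
        colourings_flip[OF pm[OF cv']] O_assoc ..
    moreover have "colourings n n a = (colourings k n v)\<inverse> O colourings k n u"
      unfolding a_eq(3) colourings_glue[OF pm[OF cu] pm[OF fv]] colourings_flip[OF pm[OF cv]] ..
    moreover have "colourings n n b = (colourings l n v')\<inverse> O colourings l n u'"
      unfolding b_eq(3) colourings_glue[OF pm[OF cu'] pm[OF fv']] colourings_flip[OF pm[OF cv']] ..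
    ultimately show "colourings n n b = colourings n n (glue n n n c (glue n n n a d))"
      unfolding colourings_glue[OF pm[OF c] pm[OF ad]] colourings_glue[OF pm[OF a] pm[OF d]]
      by (simp only: relation_simps isometry_cancel[OF a_eq(1)] isometry_cancel[OF a_eq(2)] isometry_cancel[OF w])
  qed
  then show ?thesis using that c d by blast
qed

text \<open>The projection is \<open>u u*\<close> for an isometry \<open>u\<close> from \<open>k\<close> strands. A product \<open>(u u*) s (u u*)\<close> depends only on the diagram
  \<open>u* s u\<close> on \<open>k\<close> strands, which is the identity if it has \<open>k\<close> through strands.\<close>

theorem projection_diagram:
  assumes k: "k \<in> strand_numbers n"
  obtains e where "e \<in> crossingless n n" "glue n n n e e = e" "through_number e = k"
    "\<And>s. s \<in> crossingless n n \<Longrightarrow> through_number (glue n n n e (glue n n n s e)) = k \<Longrightarrow>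
       glue n n n e (glue n n n s e) = e"
proof -
  note pm = crossingless_perfect_matching
  obtain u where u: "isometry k n u" using isometry_exists[OF k] .
  define e where "e = glue n k n u (flip u)"
  note cu = isometry_crossingless[OF u]
  note fu = flip_crossingless[OF cu]
  have e: "e \<in> crossingless n n" unfolding e_def by (rule glue_crossingless[OF cu fu])
  have col: "colourings n n e = (colourings k n u)\<inverse> O colourings k n u"
    unfolding e_def colourings_glue[OF pm[OF cu] pm[OF fu]] colourings_flip[OF pm[OF cu]] ..
  have idem: "glue n n n e e = e"
    by (rule colourings_inject[OF pm[OF glue_crossingless[OF e e]] pm[OF e]])
      (simp only: colourings_glue[OF pm[OF e] pm[OF e]] col relation_simps isometry_cancel[OF u])
  have "glue n n n e (glue n n n s e) = e"
    if s: "s \<in> crossingless n n" and th: "through_number (glue n n n e (glue n n n s e)) = k" for s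
  proof -
    note su = glue_crossingless[OF s cu]
    note x = glue_crossingless[OF fu su]
    let ?x = "glue k n k (flip u) (glue k n n s u)"
    note xf = glue_crossingless[OF x fu]
    note uxf = glue_crossingless[OF cu xf]
    note se = glue_crossingless[OF s e] note ese = glue_crossingless[OF e se]
    have eq: "glue n n n e (glue n n n s e) = glue n k n u (glue n k k ?x (flip u))"
      by (rule colourings_inject[OF pm[OF ese] pm[OF uxf]])
        (simp only: colourings_glue[OF pm[OF e] pm[OF se]] colourings_glue[OF pm[OF s] pm[OF e]]
          colourings_glue[OF pm[OF cu] pm[OF xf]] colourings_glue[OF pm[OF x] pm[OF fu]]
          colourings_glue[OF pm[OF fu] pm[OF su]] colourings_glue[OF pm[OF s] pm[OF cu]]
          colourings_flip[OF pm[OF cu]] col relation_simps)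
    have "through_number (glue n k n u (glue n k k ?x (flip u))) \<le> through_number ?x"
      using through_number_glue_le_lower[OF pm[OF cu] pm[OF xf]] through_number_glue_le_upper[OF pm[OF x] pm[OF fu]]
      by (rule order_trans)
    then have "k \<le> through_number ?x" using th unfolding eq by (simp only:)
    then have "card (through ?x) = card {1..k}"
      using through_number_le[OF pm[OF x]] by (simp add: through_number_def)
    then have "through ?x = {1..k}"
      by (rule card_subset_eq[OF finite_atLeastAtMost through_subset[OF pm[OF x]]])
    then have xid: "?x = id_diagram k" by (rule all_through_imp_id[OF x])
    show ?thesis unfolding eq xid glue_id_left(1)[OF pm[OF fu]] e_def[symmetric] ..
  qed
  moreover have "through_number e = k" unfolding e_def by (rule through_number_factorised[OF u u])
  ultimately show ?thesis using that e idem by blast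
qed


section \<open>Monoids with a chain of J-cells and cyclic maximal subgroups\<close>

text \<open>The abstract form of the two facts about diagrams: the rank orders the J-cells into a chain, and
  the maximal subgroup at the idempotent \<open>e k\<close> consists of the multiples of \<open>e k\<close> by powers of a
  central element \<open>z\<close> and is cyclic of order \<open>m\<close>.\<close>

locale cyclic_J_chain =
  fixes S :: "('s, 'x) monoid_scheme" (structure)
    and rk :: "'s \<Rightarrow> nat" and R :: "nat set" and e :: "nat \<Rightarrow> 's" and z :: 's and m :: nat
  assumes monoid: "Group.monoid S"
    and z_closed [simp]: "z \<in> carrier S"
    and z_central: "s \<in> carrier S \<Longrightarrow> z \<otimes> s = s \<otimes> z"
    and m_pos: "1 \<le> m"
    and z_order: "z [^] m = \<one>"
    and rk_range: "s \<in> carrier S \<Longrightarrow> rk s \<in> R"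
    and lr_le_iff: "s \<in> carrier S \<Longrightarrow> t \<in> carrier S \<Longrightarrow> lr_le S s t \<longleftrightarrow> rk t \<le> rk s"
    and e_closed: "k \<in> R \<Longrightarrow> e k \<in> carrier S"
    and e_idem: "k \<in> R \<Longrightarrow> e k \<otimes> e k = e k"
    and rk_e: "k \<in> R \<Longrightarrow> rk (e k) = k"
    and corner: "k \<in> R \<Longrightarrow> s \<in> carrier S \<Longrightarrow> rk (e k \<otimes> s \<otimes> e k) = k \<Longrightarrow> \<exists>i::nat. e k \<otimes> s \<otimes> e k = z [^] i \<otimes> e k"
    and corner_free: "k \<in> R \<Longrightarrow> i < m \<Longrightarrow> j < m \<Longrightarrow> z [^] i \<otimes> e k = z [^] j \<otimes> e k \<Longrightarrow> i = j"
begin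

sublocale Group.monoid S by (rule monoid)

definition cell :: "nat \<Rightarrow> 's set" where "cell k = {s \<in> carrier S. rk s = k}"

lemma J_cells_eq: "J_cells S = cell ` R"
proof -
  have class_eq: "{(a, b). a \<in> carrier S \<and> b \<in> carrier S \<and> lr_le S a b \<and> lr_le S b a} `` {s} = cell (rk s)"
    if "s \<in> carrier S" for s
    using that by (auto simp: cell_def lr_le_iff)
  have "J_cells S = (\<lambda>s. cell (rk s)) ` carrier S"
    unfolding J_cells_def quotient_def using class_eq by auto
  also have "\<dots> = cell ` R"
    using rk_range e_closed rk_e by (auto simp: image_iff) (metis rk_e e_closed)
  finally show ?thesis .
qed

lemma e_in_cell: "k \<in> R \<Longrightarrow> e k \<in> cell k"
  by (simp add: cell_def e_closed rk_e)

lemma cell_inject: "k \<in> R \<Longrightarrow> l \<in> R \<Longrightarrow> cell k = cell l \<longleftrightarrow> k = l"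
  using e_in_cell[of k] by (auto simp: cell_def)

lemma idempotent_J_cells_eq: "idempotent_J_cells S = cell ` R"
proof -
  have "\<exists>x\<in>cell k. x \<otimes> x = x" if "k \<in> R" for k
    using e_in_cell[OF that] e_idem[OF that] by blast
  then show ?thesis unfolding idempotent_J_cells_def J_cells_eq by blast
qed

lemma J_cell_le_cell: "k \<in> R \<Longrightarrow> l \<in> R \<Longrightarrow> J_cell_le S (cell k) (cell l) \<longleftrightarrow> l \<le> k"
  unfolding J_cell_le_def using e_in_cell lr_le_iff by (fastforce simp: cell_def)

lemma rk_mult:
  assumes "s \<in> carrier S" "t \<in> carrier S"
  shows "rk (s \<otimes> t) \<le> rk s" "rk (s \<otimes> t) \<le> rk t"
proof -
  have "lr_le S s (s \<otimes> t)" unfolding lr_le_def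
    using assms by (intro bexI[of _ \<one>] bexI[of _ t]) auto
  then show "rk (s \<otimes> t) \<le> rk s" using lr_le_iff assms by simp
  have "lr_le S t (s \<otimes> t)" unfolding lr_le_def
    using assms by (intro bexI[of _ s] bexI[of _ \<one>]) auto
  then show "rk (s \<otimes> t) \<le> rk t" using lr_le_iff assms by simp
qed

lemma z_pow_central: "s \<in> carrier S \<Longrightarrow> z [^] (i :: nat) \<otimes> s = s \<otimes> z [^] i"
proof (induction i)
  case (Suc i)
  have "z [^] Suc i \<otimes> s = z [^] i \<otimes> (z \<otimes> s)" using Suc.prems by (simp add: m_assoc)
  also have "\<dots> = (z [^] i \<otimes> s) \<otimes> z" using Suc.prems by (simp add: z_central m_assoc)
  also have "\<dots> = s \<otimes> z [^] Suc i" using Suc by (simp add: m_assoc)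
  finally show ?case .
qed simp

lemma z_pow_mod: "z [^] (i mod m) = z [^] (i :: nat)"
proof -
  have "z [^] i = z [^] (m * (i div m) + i mod m)" by simp
  also have "\<dots> = z [^] (m * (i div m)) \<otimes> z [^] (i mod m)" by (simp add: nat_pow_mult)
  also have "z [^] (m * (i div m)) = \<one>" by (simp add: nat_pow_pow[symmetric] z_order)
  finally show ?thesis by simp
qed

lemma rk_z_pow:
  assumes s: "s \<in> carrier S"
  shows "rk (z [^] (i :: nat) \<otimes> s) = rk s"
proof (rule antisym)
  show "rk (z [^] i \<otimes> s) \<le> rk s" using s by (intro rk_mult) auto
  have "i + (m * i - i) = m * i" using m_pos by (simp add: algebra_simps)
  then have "z [^] (m * i - i) \<otimes> z [^] i = \<one>"
    by (simp add: nat_pow_mult add.commute nat_pow_pow[symmetric] z_order)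
  then have "z [^] (m * i - i) \<otimes> (z [^] i \<otimes> s) = s" using s by (simp add: m_assoc[symmetric])
  then show "rk s \<le> rk (z [^] i \<otimes> s)"
    using rk_mult(2)[of "z [^] (m * i - i)" "z [^] i \<otimes> s"] s by simp
qed

lemma monom_minus_one_nonzero: "(monom 1 m - 1 :: 'k::field poly) \<noteq> 0"
proof
  assume "(monom 1 m - 1 :: 'k poly) = 0"
  then have "coeff (monom 1 m - 1 :: 'k poly) m = 0" by simp
  then show False using m_pos by (simp add: one_pCons coeff_pCons split: nat.splits)
qed

lemma corner_cong: "k \<in> R \<Longrightarrow> z [^] i \<otimes> e k = z [^] j \<otimes> e k \<longleftrightarrow> i mod m = j mod m"
  using corner_free[of k "i mod m" "j mod m"] m_pos z_pow_mod[of i] z_pow_mod[of j] by force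

end

section \<open>Polynomials in an operator\<close>

text \<open>The operator \<open>P(f)\<close> applied to \<open>v\<close>, by the Horner scheme. Only linearity of \<open>f\<close> on an invariant subspace is
  available, so this is developed for vectors of such a subspace.\<close>

definition poly_act :: "('k::field \<Rightarrow> 'v::ab_group_add \<Rightarrow> 'v) \<Rightarrow> ('v \<Rightarrow> 'v) \<Rightarrow> 'k poly \<Rightarrow> 'v \<Rightarrow> 'v" where
  "poly_act smul f P v = fold_coeffs (\<lambda>a w. smul a v + f w) P 0"

definition annihilating_polys ::
  "('k::field \<Rightarrow> 'v::ab_group_add \<Rightarrow> 'v) \<Rightarrow> ('v \<Rightarrow> 'v) \<Rightarrow> 'v set \<Rightarrow> 'k poly set" where
  "annihilating_polys smul f V = {P. \<forall>v\<in>V. poly_act smul f P v = 0}"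

definition action_combination ::
  "('k::field \<Rightarrow> 'v::ab_group_add \<Rightarrow> 'v) \<Rightarrow> ('s \<Rightarrow> 'v \<Rightarrow> 'v) \<Rightarrow> 'v \<Rightarrow> ('k \<times> 's) list \<Rightarrow> 'v" where
  "action_combination smul \<rho> v xs = (\<Sum>(a, s)\<leftarrow>xs. smul a (\<rho> s v))"

locale monoid_rep = cyclic_J_chain S rk R e z m + vector_space smul
  for S :: "('s, 'x) monoid_scheme" (structure) and rk R e z m
    and smul :: "'k::field \<Rightarrow> 'v::ab_group_add \<Rightarrow> 'v" +
  fixes V :: "'v set" and \<rho> :: "'s \<Rightarrow> 'v \<Rightarrow> 'v"
  assumes rep: "Defs.representation smul S (V, \<rho>)"
begin

lemma subspace_V: "subspace V"
  and \<rho>_closed [simp]: "s \<in> carrier S \<Longrightarrow> v \<in> V \<Longrightarrow> \<rho> s v \<in> V"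
  and \<rho>_add: "s \<in> carrier S \<Longrightarrow> v \<in> V \<Longrightarrow> w \<in> V \<Longrightarrow> \<rho> s (v + w) = \<rho> s v + \<rho> s w"
  and \<rho>_scale: "s \<in> carrier S \<Longrightarrow> v \<in> V \<Longrightarrow> \<rho> s (smul c v) = smul c (\<rho> s v)"
  and \<rho>_one [simp]: "v \<in> V \<Longrightarrow> \<rho> \<one> v = v"
  and \<rho>_mult: "s \<in> carrier S \<Longrightarrow> t \<in> carrier S \<Longrightarrow> v \<in> V \<Longrightarrow> \<rho> (s \<otimes> t) v = \<rho> s (\<rho> t v)"
  using rep unfolding Defs.representation_def linear_between_def by (auto simp: image_subset_iff)

lemma V_0 [simp]: "0 \<in> V" and V_add [simp]: "v \<in> V \<Longrightarrow> w \<in> V \<Longrightarrow> v + w \<in> V"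
  and V_scale [simp]: "v \<in> V \<Longrightarrow> smul c v \<in> V"
  using subspace_V by (auto simp: subspace_0 subspace_add subspace_scale)

lemma \<rho>_0 [simp]: "s \<in> carrier S \<Longrightarrow> \<rho> s 0 = 0"
  using \<rho>_add[of s 0 0] by simp

lemma subrepI:
  assumes "W \<subseteq> V" "subspace W" "\<And>s v. s \<in> carrier S \<Longrightarrow> v \<in> W \<Longrightarrow> \<rho> s v \<in> W"
  shows "Defs.representation smul S (W, \<rho>)"
  using assms \<rho>_add \<rho>_scale \<rho>_mult \<rho>_one unfolding Defs.representation_def linear_between_def
  by (auto simp: subset_iff)

abbreviation "act \<equiv> poly_act smul (\<rho> z)"

lemma act_0 [simp]: "act 0 v = 0"
  by (simp add: poly_act_def)

lemma act_pCons [simp]: "v \<in> V \<Longrightarrow> act (pCons a P) v = smul a v + \<rho> z (act P v)"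
  by (cases "P = 0"; cases "a = 0") (simp_all add: poly_act_def)

lemma act_1 [simp]: "v \<in> V \<Longrightarrow> act 1 v = v"
  by (simp add: one_pCons)

lemma act_closed [simp]: "v \<in> V \<Longrightarrow> act P v \<in> V"
  by (induction P) auto

lemma act_add: "v \<in> V \<Longrightarrow> act (P + Q) v = act P v + act Q v"
proof (induction P Q rule: poly_induct2)
  case (pCons a P b Q)
  then show ?case by (simp add: scale_left_distrib \<rho>_add)
qed simp

lemma act_smult: "v \<in> V \<Longrightarrow> act (smult c P) v = smul c (act P v)"
  by (induction P) (simp_all add: scale_right_distrib \<rho>_scale)

lemma act_mult: "v \<in> V \<Longrightarrow> act (P * Q) v = act P (act Q v)"
  by (induction P) (simp_all add: act_add act_smult)

lemma act_commute: "s \<in> carrier S \<Longrightarrow> v \<in> V \<Longrightarrow> \<rho> s (act P v) = act P (\<rho> s v)"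
proof (induction P)
  case (pCons a P)
  have "\<rho> s (\<rho> z (act P v)) = \<rho> z (\<rho> s (act P v))"
    using pCons.prems by (simp add: \<rho>_mult[symmetric] z_central)
  then show ?case using pCons by (simp add: \<rho>_add \<rho>_scale)
qed simp

lemma act_arg_add: "v \<in> V \<Longrightarrow> w \<in> V \<Longrightarrow> act P (v + w) = act P v + act P w"
  by (induction P) (simp_all add: scale_right_distrib \<rho>_add)

lemma act_arg_scale: "v \<in> V \<Longrightarrow> act P (smul c v) = smul c (act P v)"
  by (induction P) (simp_all add: scale_right_distrib \<rho>_scale scale_left_commute)

lemma act_arg_0 [simp]: "act P 0 = 0"
  by (induction P) simp_all

lemma act_monom: "v \<in> V \<Longrightarrow> act (monom 1 i) v = \<rho> (z [^] i) v"
proof (induction i)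
  case (Suc i)
  have "z [^] Suc i = z \<otimes> z [^] i" using z_pow_central[of z i] by simp
  then show ?case using Suc by (simp add: monom_Suc \<rho>_mult)
qed (simp add: monom_0)

lemma act_minimal: "v \<in> V \<Longrightarrow> act (monom 1 m - 1) v = 0"
proof -
  assume v: "v \<in> V"
  have eq: "monom 1 m - 1 = monom 1 m + smult (- 1) (1 :: 'k poly)" by (simp add: one_pCons)
  show ?thesis unfolding eq act_add[OF v] act_smult[OF v] using v by (simp add: act_monom z_order)
qed

abbreviation "annihilator \<equiv> annihilating_polys smul (\<rho> z) V"

abbreviation "combination \<equiv> action_combination smul \<rho>"

lemma combination_simps [simp]:
  "combination v [] = 0" "combination v ((a, s) # xs) = smul a (\<rho> s v) + combination v xs"
  "combination v (xs @ ys) = combination v xs + combination v ys"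
  by (simp_all add: action_combination_def)

lemma combination_closed [simp]:
  "v \<in> V \<Longrightarrow> snd ` set xs \<subseteq> carrier S \<Longrightarrow> combination v xs \<in> V"
  by (induction xs) auto

lemma combination_scale: "smul c (combination v xs) = combination v (map (\<lambda>(a, s). (c * a, s)) xs)"
  by (induction xs) (auto simp: scale_right_distrib)

lemma \<rho>_combination:
  "v \<in> V \<Longrightarrow> t \<in> carrier S \<Longrightarrow> snd ` set xs \<subseteq> carrier S \<Longrightarrow>
     \<rho> t (combination v xs) = combination v (map (\<lambda>(a, s). (a, t \<otimes> s)) xs)"
  by (induction xs) (auto simp: \<rho>_add \<rho>_scale \<rho>_mult)

end

locale simple_monoid_rep = monoid_rep S rk R e z m smul V \<rho>
  for S :: "('s, 'x) monoid_scheme" (structure) and rk R e z m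
    and smul :: "'k::field \<Rightarrow> 'v::ab_group_add \<Rightarrow> 'v" and V :: "'v set" and \<rho> +
  assumes nontrivial: "V \<noteq> {0}"
    and irreducible: "W \<subseteq> V \<Longrightarrow> Defs.representation smul S (W, \<rho>) \<Longrightarrow> W = {0} \<or> W = V"
begin

text \<open>The combinations of the orbit of \<open>v\<close> form a subrepresentation that contains \<open>v\<close>.\<close>

lemma combinations_exhaust:
  assumes "v \<in> V" "v \<noteq> 0" "w \<in> V"
  obtains xs where "snd ` set xs \<subseteq> carrier S" "w = combination v xs"
proof -
  define W where "W = combination v ` {xs. snd ` set xs \<subseteq> carrier S}"
  have "W \<subseteq> V" using assms(1) by (auto simp: W_def)
  moreover have "subspace W"
    unfolding subspace_def
  proof (intro conjI ballI allI)
    show "0 \<in> W" unfolding W_def by (rule image_eqI[of _ _ "[]"]) auto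
  next
    fix x y assume "x \<in> W" "y \<in> W"
    then obtain xs ys where "x = combination v xs" "y = combination v ys"
      "snd ` set xs \<subseteq> carrier S" "snd ` set ys \<subseteq> carrier S" by (auto simp: W_def)
    then show "x + y \<in> W" unfolding W_def by (intro image_eqI[of _ _ "xs @ ys"]) auto
  next
    fix c x assume "x \<in> W"
    then obtain xs where "x = combination v xs" "snd ` set xs \<subseteq> carrier S" by (auto simp: W_def)
    then show "smul c x \<in> W" unfolding W_def
      by (intro image_eqI[of _ _ "map (\<lambda>(a, s). (c * a, s)) xs"]) (auto simp: combination_scale)
  qed
  moreover have "\<rho> t x \<in> W" if t: "t \<in> carrier S" and x: "x \<in> W" for t x
  proof -
    obtain xs where "x = combination v xs" "snd ` set xs \<subseteq> carrier S" using x by (auto simp: W_def)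
    then show ?thesis unfolding W_def using t assms(1)
      by (intro image_eqI[of _ _ "map (\<lambda>(a, s). (a, t \<otimes> s)) xs"]) (auto simp: \<rho>_combination)
  qed
  ultimately have "W = {0} \<or> W = V" by (intro irreducible subrepI) auto
  moreover have "v \<in> W" unfolding W_def using assms(1) by (intro image_eqI[of _ _ "[(1, \<one>)]"]) auto
  ultimately have "W = V" using assms(2) by blast
  then have "w \<in> W" using assms(3) by simp
  then show ?thesis using that unfolding W_def by blast
qed

text \<open>As \<open>z\<close> is central, the kernel of \<open>P(z)\<close> is a subrepresentation.\<close>

lemma act_eq_0_imp_annihilator:
  assumes v: "v \<in> V" "v \<noteq> 0" "act P v = 0"
  shows "P \<in> annihilator"
proof -
  define W where "W = {v \<in> V. act P v = 0}"
  have "subspace W"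
    unfolding subspace_def W_def by (simp add: act_arg_add act_arg_scale)
  moreover have "\<rho> s x \<in> W" if "s \<in> carrier S" "x \<in> W" for s x
    using that unfolding W_def by (simp add: act_commute[symmetric])
  ultimately have "W = {0} \<or> W = V" unfolding W_def by (intro irreducible subrepI) auto
  then have "W = V" using v unfolding W_def by blast
  then show ?thesis unfolding annihilating_polys_def W_def by blast
qed

lemma annihilator_generator: "\<exists>f. \<forall>P. P \<in> annihilator \<longleftrightarrow> f dvd P"
proof -
  have "monom 1 m - 1 \<in> annihilator" by (simp add: annihilating_polys_def act_minimal)
  with monom_minus_one_nonzero have ex: "\<exists>d f. f \<in> annihilator \<and> f \<noteq> 0 \<and> degree f = d" by blast
  define d where "d = (LEAST d. \<exists>f. f \<in> annihilator \<and> f \<noteq> 0 \<and> degree f = d)"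
  have "\<exists>f. f \<in> annihilator \<and> f \<noteq> 0 \<and> degree f = d" unfolding d_def by (rule LeastI_ex[OF ex])
  then obtain f where f: "f \<in> annihilator" "f \<noteq> 0" "degree f = d" by blast
  have least: "d \<le> degree g" if "g \<in> annihilator" "g \<noteq> 0" for g
    unfolding d_def by (rule Least_le) (use that in blast)
  have "P \<in> annihilator \<longleftrightarrow> f dvd P" for P
  proof
    assume P: "P \<in> annihilator"
    have "P mod f \<in> annihilator"
      unfolding annihilating_polys_def mem_Collect_eq
    proof
      fix v assume v: "v \<in> V"
      have "act P v = act (P div f * f + P mod f) v" by simp
      also have "\<dots> = act (P div f) (act f v) + act (P mod f) v" using v by (simp only: act_add act_mult)
      finally show "act (P mod f) v = 0" using v P f(1) by (simp add: annihilating_polys_def)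
    qed
    then have "P mod f = 0" using degree_mod_less[OF f(2), of P] least[of "P mod f"] f(3) by fastforce
    then show "f dvd P" by auto
  next
    assume "f dvd P"
    then obtain g where "P = g * f" by (metis dvdE mult.commute)
    then show "P \<in> annihilator" using f(1) by (simp add: annihilating_polys_def act_mult)
  qed
  then show ?thesis by blast
qed

lemma annihilator_prime:
  assumes "P * Q \<in> annihilator"
  shows "P \<in> annihilator \<or> Q \<in> annihilator"
proof (rule ccontr)
  assume neg: "\<not> ?thesis"
  then obtain v where v: "v \<in> V" "act Q v \<noteq> 0" by (auto simp: annihilating_polys_def)
  have "act P (act Q v) = 0" using assms v by (simp add: annihilating_polys_def act_mult)
  then show False using act_eq_0_imp_annihilator[of "act Q v" P] v neg by simp
qed

lemma one_notin_annihilator: "1 \<notin> annihilator"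
proof
  assume "1 \<in> annihilator"
  then have "V \<subseteq> {0}" by (auto simp: annihilating_polys_def)
  then show False using nontrivial V_0 by blast
qed

end

section \<open>Simple representations with a given apex\<close>

context cyclic_J_chain
begin

definition apex_rank :: "nat \<Rightarrow> 'v::zero set \<Rightarrow> ('s \<Rightarrow> 'v \<Rightarrow> 'v) \<Rightarrow> bool" where
  "apex_rank k V \<rho> \<longleftrightarrow> k \<in> R \<and> (\<forall>s\<in>carrier S. rk s < k \<longrightarrow> (\<forall>v\<in>V. \<rho> s v = 0)) \<and> (\<exists>v\<in>V. \<rho> (e k) v \<noteq> 0)"

text \<open>The power of \<open>X\<close> that represents an element of the maximal subgroup at \<open>e k\<close>, and 0 for the elements of
  lower rank, which act as 0 on a representation of apex \<open>k\<close>. The exponent is determined only modulo \<open>m\<close>, and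
  any choice acts in the same way.\<close>

definition corner_poly :: "nat \<Rightarrow> 's \<Rightarrow> 'k::field poly" where
  "corner_poly k x = (if \<exists>i::nat. x = z [^] i \<otimes> e k then monom 1 (SOME i::nat. x = z [^] i \<otimes> e k) else 0)"

end

context monoid_rep
begin

lemma not_annihilates_cell_imp:
  assumes k: "k \<in> R" and na: "\<not> annihilates (cell k) (V, \<rho>)"
  shows "\<exists>v\<in>V. \<rho> (e k) v \<noteq> 0"
proof -
  from na obtain s v where s: "s \<in> carrier S" "rk s = k" "v \<in> V" "\<rho> s v \<noteq> 0"
    by (auto simp: annihilates_def cell_def)
  have "lr_le S (e k) s" using lr_le_iff[OF e_closed[OF k] s(1)] rk_e[OF k] s(2) by simp
  then obtain c d where cd: "c \<in> carrier S" "d \<in> carrier S" "s = c \<otimes> e k \<otimes> d"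
    unfolding lr_le_def by blast
  have "\<rho> s v = \<rho> c (\<rho> (e k) (\<rho> d v))" using cd s(3) e_closed[OF k] by (simp add: \<rho>_mult)
  then have "\<rho> (e k) (\<rho> d v) \<noteq> 0" using s(4) cd by auto
  then show ?thesis using cd(2) s(3) by (intro bexI[of _ "\<rho> d v"]) simp_all
qed

lemma is_apex_cell:
  assumes k: "k \<in> R"
  shows "is_apex smul S (V, \<rho>) (cell k) \<longleftrightarrow> apex_rank k V \<rho>"
proof
  assume ap: "is_apex smul S (V, \<rho>) (cell k)"
  have "\<rho> s v = 0" if s: "s \<in> carrier S" "rk s < k" "v \<in> V" for s v
  proof (rule ccontr)
    assume "\<rho> s v \<noteq> 0"
    then have "\<not> annihilates (cell (rk s)) (V, \<rho>)" using s by (auto simp: annihilates_def cell_def)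
    moreover have "rk s \<in> R" using rk_range s by blast
    moreover have "J_cell_le S (cell k) (cell (rk s))" using J_cell_le_cell[OF k \<open>rk s \<in> R\<close>] s by simp
    ultimately have "cell (rk s) = cell k"
      using ap unfolding is_apex_def idempotent_J_cells_eq by blast
    then show False using cell_inject[OF \<open>rk s \<in> R\<close> k] s by simp
  qed
  moreover have "\<exists>v\<in>V. \<rho> (e k) v \<noteq> 0"
    using ap not_annihilates_cell_imp[OF k] by (simp add: is_apex_def)
  ultimately show "apex_rank k V \<rho>" using k by (simp add: apex_rank_def)
next
  assume ap: "apex_rank k V \<rho>"
  have "\<not> annihilates (cell k) (V, \<rho>)"
    using ap e_in_cell[OF k] by (auto simp: annihilates_def apex_rank_def)
  moreover have "J = cell k"
    if J: "J \<in> idempotent_J_cells S" "\<not> annihilates J (V, \<rho>)" "J_cell_le S (cell k) J" for J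
  proof -
    obtain l where l: "l \<in> R" "J = cell l" using J(1) unfolding idempotent_J_cells_eq by blast
    have "l \<le> k" using J(3) J_cell_le_cell[OF k l(1)] l(2) by simp
    moreover have "\<not> l < k" using J(2) ap l(2) by (auto simp: annihilates_def cell_def apex_rank_def)
    ultimately show ?thesis using l(2) by simp
  qed
  ultimately show "is_apex smul S (V, \<rho>) (cell k)"
    unfolding is_apex_def idempotent_J_cells_eq using k by blast
qed

lemma \<rho>_corner:
  assumes ap: "apex_rank k V \<rho>" and w: "w \<in> V" "\<rho> (e k) w = w" and s: "s \<in> carrier S"
  shows "\<rho> (e k \<otimes> s \<otimes> e k) w = act (corner_poly k (e k \<otimes> s \<otimes> e k)) w"
proof -
  let ?x = "e k \<otimes> s \<otimes> e k"
  have k: "k \<in> R" using ap by (simp add: apex_rank_def)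
  note ek = e_closed[OF k]
  show ?thesis
  proof (cases "\<exists>i::nat. ?x = z [^] i \<otimes> e k")
    case True
    define i where "i = (SOME i::nat. ?x = z [^] i \<otimes> e k)"
    have i: "?x = z [^] i \<otimes> e k" unfolding i_def by (rule someI_ex[OF True])
    have "corner_poly k ?x = (monom 1 i :: 'k poly)" using True unfolding corner_poly_def i_def by simp
    then show ?thesis using w ek by (simp add: i \<rho>_mult act_monom)
  next
    case False
    then have "rk ?x \<noteq> k" using corner[OF k s] by blast
    moreover have "rk ?x \<le> k" using rk_mult(2)[of "e k \<otimes> s" "e k"] s ek rk_e[OF k] by simp
    ultimately have "\<rho> ?x w = 0" using ap s ek w unfolding apex_rank_def by simp
    moreover have "corner_poly k ?x = (0 :: 'k poly)" using False unfolding corner_poly_def by simp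
    ultimately show ?thesis by simp
  qed
qed

lemma \<rho>_corner_combination:
  assumes ap: "apex_rank k V \<rho>" and w: "w \<in> V" "\<rho> (e k) w = w" and t: "t \<in> carrier S"
    and xs: "snd ` set xs \<subseteq> carrier S"
  shows "\<rho> (e k) (\<rho> t (combination w xs)) =
     act (\<Sum>(a, s)\<leftarrow>xs. smult a (corner_poly k (e k \<otimes> (t \<otimes> s) \<otimes> e k))) w"
  using xs
proof (induction xs)
  case Nil
  have "e k \<in> carrier S" using ap e_closed by (simp add: apex_rank_def)
  then show ?case using t by simp
next
  case (Cons as xs)
  obtain a s where as: "as = (a, s)" by (cases as)
  have ek: "e k \<in> carrier S" using ap e_closed by (simp add: apex_rank_def)
  have s: "s \<in> carrier S" using Cons.prems as by simp
  have "\<rho> (e k) (\<rho> t (\<rho> s w)) = \<rho> (e k) (\<rho> t (\<rho> s (\<rho> (e k) w)))" using w by simp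
  also have "\<dots> = \<rho> (e k \<otimes> (t \<otimes> s) \<otimes> e k) w" using w(1) ek s t by (simp add: \<rho>_mult)
  also have "\<dots> = act (corner_poly k (e k \<otimes> (t \<otimes> s) \<otimes> e k)) w"
    using s t by (intro \<rho>_corner[OF ap w]) simp
  finally have step: "\<rho> (e k) (\<rho> t (\<rho> s w)) = act (corner_poly k (e k \<otimes> (t \<otimes> s) \<otimes> e k)) w" .
  have "combination w xs \<in> V" using w Cons.prems by (intro combination_closed) auto
  then show ?case
    using Cons step s t ek w(1) by (simp add: as \<rho>_add \<rho>_scale act_add act_smult)
qed

end

context simple_monoid_rep
begin

lemma corner_detects:
  assumes ap: "apex_rank k V \<rho>" and u: "u \<in> V" "u \<noteq> 0"
  obtains t where "t \<in> carrier S" "\<rho> (e k) (\<rho> t u) \<noteq> 0"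
proof -
  have ek: "e k \<in> carrier S" using ap e_closed by (simp add: apex_rank_def)
  have "\<exists>t\<in>carrier S. \<rho> (e k) (\<rho> t u) \<noteq> 0"
  proof (rule ccontr)
    assume "\<not> ?thesis"
    then have zero: "\<And>t. t \<in> carrier S \<Longrightarrow> \<rho> (e k) (\<rho> t u) = 0" by blast
    obtain v where v: "v \<in> V" "\<rho> (e k) v \<noteq> 0" using ap by (auto simp: apex_rank_def)
    obtain xs where xs: "snd ` set xs \<subseteq> carrier S" "v = combination u xs" by (rule combinations_exhaust[OF u v(1)])
    have "\<rho> (e k) (combination u xs) = 0"
      using xs(1)
    proof (induction xs)
      case (Cons as xs)
      then show ?case using zero u ek by (cases as) (simp add: \<rho>_add \<rho>_scale)
    qed (use ek in simp)
    then show False using v(2) xs(2) by simp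
  qed
  then show ?thesis using that by blast
qed

text \<open>If the combination of the orbit of \<open>w\<close> does not vanish, some \<open>e k t\<close> keeps it nonzero. The result is \<open>P(z) w\<close>
  for a polynomial \<open>P\<close> that depends only on the coefficients and the monoid. The same \<open>P\<close> kills \<open>v\<close>, so it is an annihilating
  polynomial of both representations.\<close>

lemma combination_zero_transfer:
  assumes W: "simple_monoid_rep S rk R e z m smul W \<sigma>"
    and ap: "apex_rank k V \<rho>" "apex_rank k W \<sigma>"
    and ann: "annihilating_polys smul (\<rho> z) V \<subseteq> annihilating_polys smul (\<sigma> z) W"
    and v: "v \<in> V" "v \<noteq> 0" "\<rho> (e k) v = v" and w: "w \<in> W" "\<sigma> (e k) w = w"
    and xs: "snd ` set xs \<subseteq> carrier S" and zero: "combination v xs = 0"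
  shows "action_combination smul \<sigma> w xs = 0"
proof (rule ccontr)
  interpret W: simple_monoid_rep S rk R e z m smul W \<sigma> by (rule W)
  have ek: "e k \<in> carrier S" using ap e_closed by (simp add: apex_rank_def)
  assume nz: "action_combination smul \<sigma> w xs \<noteq> 0"
  then obtain t where t: "t \<in> carrier S" "\<sigma> (e k) (\<sigma> t (action_combination smul \<sigma> w xs)) \<noteq> 0"
    using W.corner_detects[OF ap(2)] W.combination_closed[OF w(1) xs] by blast
  let ?P = "\<Sum>(a, s)\<leftarrow>xs. smult a (corner_poly k (e k \<otimes> (t \<otimes> s) \<otimes> e k)) :: 'k poly"
  have "act ?P v = \<rho> (e k) (\<rho> t (combination v xs))"
    by (rule \<rho>_corner_combination[OF ap(1) v(1,3) t(1) xs, symmetric])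
  then have "act ?P v = 0" using zero t ek by simp
  then have "?P \<in> annihilator" by (rule act_eq_0_imp_annihilator[OF v(1,2)])
  then have "poly_act smul (\<sigma> z) ?P w = 0" using ann w(1) by (auto simp: annihilating_polys_def)
  then show False using W.\<rho>_corner_combination[OF ap(2) w t(1) xs] t(2) by simp
qed

text \<open>Both representations are spanned by the orbit of a vector fixed by \<open>e k\<close>, and by
  \<open>combination_zero_transfer\<close> the two orbits satisfy the same linear relations.\<close>

lemma rep_iso_of_annihilator_eq:
  assumes W: "simple_monoid_rep S rk R e z m smul W \<sigma>"
    and ap: "apex_rank k V \<rho>" "apex_rank k W \<sigma>"
    and ann: "annihilating_polys smul (\<rho> z) V = annihilating_polys smul (\<sigma> z) W"
  shows "((V, \<rho>), (W, \<sigma>)) \<in> rep_iso smul S"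
proof -
  interpret W: simple_monoid_rep S rk R e z m smul W \<sigma> by (rule W)
  have V: "simple_monoid_rep S rk R e z m smul V \<rho>" by unfold_locales
  have k: "k \<in> R" using ap by (simp add: apex_rank_def)
  note ek = e_closed[OF k]
  obtain v' where v': "v' \<in> V" "\<rho> (e k) v' \<noteq> 0" using ap by (auto simp: apex_rank_def)
  define v where "v = \<rho> (e k) v'"
  have v: "v \<in> V" "v \<noteq> 0" "\<rho> (e k) v = v"
    using v' ek e_idem[OF k] \<rho>_mult[OF ek ek v'(1)] by (simp_all add: v_def)
  obtain w' where w': "w' \<in> W" "\<sigma> (e k) w' \<noteq> 0" using ap by (auto simp: apex_rank_def)
  define w where "w = \<sigma> (e k) w'"
  have w: "w \<in> W" "w \<noteq> 0" "\<sigma> (e k) w = w"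
    using w' ek e_idem[OF k] W.\<rho>_mult[OF ek ek w'(1)] by (simp_all add: w_def)
  let ?L = "{xs :: ('k \<times> 's) list. snd ` set xs \<subseteq> carrier S}"
  let ?f = "action_combination smul \<rho> v" and ?g = "action_combination smul \<sigma> w"
  define neg :: "('k \<times> 's) list \<Rightarrow> ('k \<times> 's) list" where "neg = map (\<lambda>(a, s). (- 1 * a, s))"
  have negL: "neg xs \<in> ?L" if "xs \<in> ?L" for xs using that by (auto simp: neg_def)
  have zero_iff: "?f xs = 0 \<longleftrightarrow> ?g xs = 0" if "xs \<in> ?L" for xs
    using combination_zero_transfer[OF W ap _ v w(1,3), of xs] that ann
      W.combination_zero_transfer[OF V ap(2,1) _ w v(1,3), of xs] by blast
  have eq_iff: "?f xs = ?f ys \<longleftrightarrow> ?g xs = ?g ys" if "xs \<in> ?L" "ys \<in> ?L" for xs ys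
  proof -
    have "?f (xs @ neg ys) = ?f xs - ?f ys" "?g (xs @ neg ys) = ?g xs - ?g ys"
      unfolding neg_def combination_simps W.combination_simps combination_scale[symmetric] W.combination_scale[symmetric]
      by simp_all
    moreover have "xs @ neg ys \<in> ?L" using that negL[of ys] by auto
    ultimately show ?thesis using zero_iff[of "xs @ neg ys"] by simp
  qed
  have fV: "?f ` ?L = V"
  proof
    show "?f ` ?L \<subseteq> V" using combination_closed[OF v(1)] by auto
    show "V \<subseteq> ?f ` ?L"
    proof
      fix x assume "x \<in> V"
      then obtain xs where "snd ` set xs \<subseteq> carrier S" "x = ?f xs" by (rule combinations_exhaust[OF v(1,2)])
      then show "x \<in> ?f ` ?L" by blast
    qed
  qed
  have gW: "?g ` ?L = W"
  proof
    show "?g ` ?L \<subseteq> W" using W.combination_closed[OF w(1)] by auto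
    show "W \<subseteq> ?g ` ?L"
    proof
      fix x assume "x \<in> W"
      then obtain xs where "snd ` set xs \<subseteq> carrier S" "x = ?g xs" by (rule W.combinations_exhaust[OF w(1,2)])
      then show "x \<in> ?g ` ?L" by blast
    qed
  qed
  define h where "h x = ?g (SOME xs. xs \<in> ?L \<and> x = ?f xs)" for x
  have h: "h (?f xs) = ?g xs" if "xs \<in> ?L" for xs
  proof -
    define ys where "ys = (SOME ys. ys \<in> ?L \<and> ?f xs = ?f ys)"
    have "\<exists>ys. ys \<in> ?L \<and> ?f xs = ?f ys" using that by blast
    then have ys: "ys \<in> ?L \<and> ?f xs = ?f ys" unfolding ys_def by (rule someI_ex)
    then have "?g xs = ?g ys" using eq_iff[OF that, of ys] by blast
    then show ?thesis unfolding h_def ys_def by (rule sym)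
  qed
  have "linear_between smul V W h"
    unfolding linear_between_def
  proof (intro conjI ballI allI)
    show "h ` V \<subseteq> W"
    proof
      fix y assume "y \<in> h ` V"
      then obtain xs where "xs \<in> ?L" "y = h (?f xs)" unfolding fV[symmetric] by blast
      then show "y \<in> W" using h gW by auto
    qed
  next
    fix x y assume "x \<in> V" "y \<in> V"
    then obtain xs ys where xy: "xs \<in> ?L" "x = ?f xs" "ys \<in> ?L" "y = ?f ys" unfolding fV[symmetric] by blast
    then have "xs @ ys \<in> ?L" by auto
    then have "h (?f (xs @ ys)) = ?g (xs @ ys)" by (rule h)
    then show "h (x + y) = h x + h y" using xy h by simp
  next
    fix c x assume "x \<in> V"
    then obtain xs where xs: "xs \<in> ?L" "x = ?f xs" unfolding fV[symmetric] by blast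
    then have "map (\<lambda>(a, s). (c * a, s)) xs \<in> ?L" by auto
    then have "h (?f (map (\<lambda>(a, s). (c * a, s)) xs)) = ?g (map (\<lambda>(a, s). (c * a, s)) xs)" by (rule h)
    then show "h (smul c x) = smul c (h x)"
      unfolding combination_scale[symmetric] W.combination_scale[symmetric] using xs h by simp
  qed
  moreover have "bij_betw h V W"
    unfolding bij_betw_def
  proof
    show "inj_on h V"
    proof (rule inj_onI)
      fix x y assume "x \<in> V" "y \<in> V" and eq: "h x = h y"
      then obtain xs ys where xy: "xs \<in> ?L" "x = ?f xs" "ys \<in> ?L" "y = ?f ys" unfolding fV[symmetric] by blast
      then have "?g xs = ?g ys" using eq h by simp
      then show "x = y" using eq_iff[OF xy(1,3)] xy(2,4) by simp
    qed
    show "h ` V = W" unfolding fV[symmetric] gW[symmetric] image_image using h by (intro image_cong refl) blast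
  qed
  moreover have "h (\<rho> s x) = \<sigma> s (h x)" if s: "s \<in> carrier S" and "x \<in> V" for s x
  proof -
    obtain xs where xs: "xs \<in> ?L" "x = ?f xs" using \<open>x \<in> V\<close> unfolding fV[symmetric] by blast
    let ?ys = "map (\<lambda>(a, t). (a, s \<otimes> t)) xs"
    have "?ys \<in> ?L" using xs(1) s by auto
    then have "h (?f ?ys) = ?g ?ys" by (rule h)
    then show ?thesis using \<rho>_combination[OF v(1) s] W.\<rho>_combination[OF w(1) s] xs h by simp
  qed
  ultimately show ?thesis using rep W.rep unfolding rep_iso_def by blast
qed

end

section \<open>Counting the simple representations of an apex\<close>

text \<open>Pairwise non-associated primes can be divided out of \<open>Q\<close> one after the other, and each of them has
  positive degree.\<close>

lemma card_prime_divisors_le_degree: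
  fixes F :: "'k::field poly set"
  assumes "finite F" "Q \<noteq> 0" "\<And>f. f \<in> F \<Longrightarrow> prime_elem f" "\<And>f. f \<in> F \<Longrightarrow> f dvd Q"
    and "\<And>f g. f \<in> F \<Longrightarrow> g \<in> F \<Longrightarrow> f dvd g \<Longrightarrow> g dvd f \<Longrightarrow> f = g"
  shows "card F \<le> degree Q"
  using assms
proof (induction F arbitrary: Q rule: finite_induct)
  case (insert f F)
  then obtain P where P: "Q = f * P" by blast
  have nz: "P \<noteq> 0" "f \<noteq> 0" using insert.prems(1) P by auto
  have pf: "prime_elem f" using insert.prems by blast
  have "card F \<le> degree P"
  proof (rule insert.IH[OF nz(1)])
    fix g assume g: "g \<in> F"
    have pg: "prime_elem g" using insert.prems(2) g by blast
    have "g dvd f * P" using insert.prems(3)[of g] g P by simp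
    then have "g dvd f \<or> g dvd P" using pg by (simp add: prime_elem_dvd_mult_iff)
    moreover have "\<not> g dvd f"
    proof
      assume gf: "g dvd f"
      then have "f dvd g \<or> g dvd 1" using irreducibleD'[OF prime_elem_imp_irreducible[OF pf]] by blast
      then have "f dvd g" using pg by (auto simp: prime_elem_def)
      then have "f = g" by (rule insert.prems(4)[OF insertI1 insertI2[OF g] _ gf])
      then show False using g insert.hyps(2) by simp
    qed
    ultimately show "g dvd P" by blast
  qed (rule insert.prems(2,4); simp)+
  moreover have "degree f \<noteq> 0" using pf is_unit_iff_degree[OF nz(2)] by (auto simp: prime_elem_def)
  ultimately show ?case using insert.hyps nz by (simp add: P degree_mult_eq)
qed simp

context vector_space
begin

lemma rep_iso_sym:
  assumes "(M, N) \<in> rep_iso scale S"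
  shows "(N, M) \<in> rep_iso scale S"
proof -
  obtain V \<rho> W \<sigma> where MN: "M = (V, \<rho>)" "N = (W, \<sigma>)" by (cases M, cases N)
  with assms obtain f where V: "Defs.representation scale S (V, \<rho>)" and W: "Defs.representation scale S (W, \<sigma>)"
    and f: "linear_between scale V W f" "bij_betw f V W"
      "\<And>s v. s \<in> carrier S \<Longrightarrow> v \<in> V \<Longrightarrow> f (\<rho> s v) = \<sigma> s (f v)"
    unfolding rep_iso_def by blast
  define g where "g = the_inv_into V f"
  have g1: "bij_betw g W V" unfolding g_def by (rule bij_betw_the_inv_into[OF f(2)])
  have g: "bij_betw g W V" "\<And>v. v \<in> V \<Longrightarrow> g (f v) = v" "\<And>w. w \<in> W \<Longrightarrow> f (g w) = w" "\<And>w. w \<in> W \<Longrightarrow> g w \<in> V"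
    using g1 bij_betwE[OF g1] the_inv_into_f_f[OF bij_betw_imp_inj_on[OF f(2)]]
      f_the_inv_into_f_bij_betw[OF f(2)] unfolding g_def by blast+
  have sub: "subspace V" "\<And>s v. s \<in> carrier S \<Longrightarrow> v \<in> V \<Longrightarrow> \<rho> s v \<in> V"
    using V unfolding Defs.representation_def linear_between_def by (auto simp: image_subset_iff)
  have f_add: "f (x + y) = f x + f y" if "x \<in> V" "y \<in> V" for x y
    using f(1) that unfolding linear_between_def by auto
  have f_scale: "f (scale c x) = scale c (f x)" if "x \<in> V" for x c
    using f(1) that unfolding linear_between_def by auto
  have "linear_between scale W V g"
    unfolding linear_between_def
  proof (intro conjI ballI allI)
    show "g ` W \<subseteq> V" using g(4) by blast
  next
    fix x y assume xy: "x \<in> W" "y \<in> W"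
    have "g (x + y) = g (f (g x) + f (g y))" using xy g(3) by simp
    also have "\<dots> = g (f (g x + g y))" using xy g(4) f_add by simp
    also have "\<dots> = g x + g y" using xy g(4) sub(1) by (intro g(2) subspace_add)
    finally show "g (x + y) = g x + g y" .
  next
    fix c x assume x: "x \<in> W"
    have "g (scale c x) = g (scale c (f (g x)))" using x g(3) by simp
    also have "\<dots> = g (f (scale c (g x)))" using x g(4) f_scale by simp
    also have "\<dots> = scale c (g x)" using x g(4) sub(1) by (intro g(2) subspace_scale)
    finally show "g (scale c x) = scale c (g x)" .
  qed
  moreover have "g (\<sigma> s w) = \<rho> s (g w)" if "s \<in> carrier S" "w \<in> W" for s w
  proof -
    have "g (\<sigma> s w) = g (\<sigma> s (f (g w)))" using that g(3) by simp
    also have "\<dots> = g (f (\<rho> s (g w)))" using that g(4) f(3) by simp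
    also have "\<dots> = \<rho> s (g w)" using that by (intro g(2) sub(2) g(4))
    finally show ?thesis .
  qed
  ultimately show ?thesis using V W g(1) unfolding MN rep_iso_def by blast
qed

lemma rep_iso_trans:
  assumes "(L, M) \<in> rep_iso scale S" "(M, N) \<in> rep_iso scale S"
  shows "(L, N) \<in> rep_iso scale S"
proof -
  obtain U \<pi> V \<rho> W \<sigma> where LMN: "L = (U, \<pi>)" "M = (V, \<rho>)" "N = (W, \<sigma>)" by (cases L, cases M, cases N)
  from assms(1) obtain f where U: "Defs.representation scale S (U, \<pi>)"
    and f: "linear_between scale U V f" "bij_betw f U V"
      "\<And>s v. s \<in> carrier S \<Longrightarrow> v \<in> U \<Longrightarrow> f (\<pi> s v) = \<rho> s (f v)"
    unfolding LMN rep_iso_def by blast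
  from assms(2) obtain g where W: "Defs.representation scale S (W, \<sigma>)"
    and g: "linear_between scale V W g" "bij_betw g V W"
      "\<And>s v. s \<in> carrier S \<Longrightarrow> v \<in> V \<Longrightarrow> g (\<rho> s v) = \<sigma> s (g v)"
    unfolding LMN rep_iso_def by blast
  have fU: "f v \<in> V" if "v \<in> U" for v using f(1) that by (auto simp: linear_between_def)
  have "linear_between scale U W (g \<circ> f)"
    using f(1) g(1) fU unfolding linear_between_def by (auto simp: image_subset_iff)
  moreover have "bij_betw (g \<circ> f) U W" using f(2) g(2) by (rule bij_betw_trans)
  moreover have "\<forall>s\<in>carrier S. \<forall>v\<in>U. (g \<circ> f) (\<pi> s v) = \<sigma> s ((g \<circ> f) v)"
    using f(3) g(3) fU by simp
  ultimately show ?thesis using U W unfolding LMN rep_iso_def by blast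
qed

lemma rep_iso_class_eq: "(M, N) \<in> rep_iso scale S \<Longrightarrow> rep_iso scale S `` {M} = rep_iso scale S `` {N}"
  using rep_iso_sym rep_iso_trans by blast

end

locale cyclic_J_chain_space = cyclic_J_chain S rk R e z m + vector_space smul
  for S :: "('s, 'x) monoid_scheme" (structure) and rk R e z m
    and smul :: "'k::field \<Rightarrow> 'v::ab_group_add \<Rightarrow> 'v"
begin

lemma simple_rep_iff:
  "simple_rep smul S (V, \<rho>) \<longleftrightarrow> simple_monoid_rep S rk R e z m smul V \<rho>"
proof
  assume s: "simple_rep smul S (V, \<rho>)"
  show "simple_monoid_rep S rk R e z m smul V \<rho>"
    by unfold_locales (use s in \<open>auto simp: simple_rep_def\<close>)
next
  assume "simple_monoid_rep S rk R e z m smul V \<rho>"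
  then interpret simple_monoid_rep S rk R e z m smul V \<rho> .
  show "simple_rep smul S (V, \<rho>)"
    using rep nontrivial irreducible by (auto simp: simple_rep_def)
qed

definition simples :: "nat \<Rightarrow> ('s, 'v) rep set" where
  "simples k = {M. simple_rep smul S M \<and> is_apex smul S M (cell k)}"

lemma simples_iff:
  assumes "k \<in> R"
  shows "(V, \<rho>) \<in> simples k \<longleftrightarrow> simple_monoid_rep S rk R e z m smul V \<rho> \<and> apex_rank k V \<rho>"
proof -
  have "is_apex smul S (V, \<rho>) (cell k) \<longleftrightarrow> apex_rank k V \<rho>" if "simple_monoid_rep S rk R e z m smul V \<rho>"
  proof -
    interpret simple_monoid_rep S rk R e z m smul V \<rho> by (rule that)
    show ?thesis by (rule is_apex_cell[OF assms])
  qed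
  then show ?thesis unfolding simples_def by (auto simp: simple_rep_iff)
qed

definition rep_annihilator :: "('s, 'v) rep \<Rightarrow> 'k poly set" where
  "rep_annihilator M = annihilating_polys smul (snd M z) (fst M)"

text \<open>A generator of the annihilator, chosen as a function of the annihilator alone. It is the minimal
  polynomial of \<open>z\<close> up to a unit.\<close>

definition rep_prime :: "('s, 'v) rep \<Rightarrow> 'k poly" where
  "rep_prime M = (SOME f. \<forall>P. P \<in> rep_annihilator M \<longleftrightarrow> f dvd P)"

lemma rep_prime:
  assumes k: "k \<in> R" and M: "M \<in> simples k"
  shows "P \<in> rep_annihilator M \<longleftrightarrow> rep_prime M dvd P" "rep_prime M dvd monom 1 m - 1" "prime_elem (rep_prime M)"
proof -
  obtain V \<rho> where Meq: "M = (V, \<rho>)" by (cases M)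
  interpret simple_monoid_rep S rk R e z m smul V \<rho> using M simples_iff[OF k] unfolding Meq by blast
  have ann: "rep_annihilator M = annihilator" by (simp add: rep_annihilator_def Meq)
  have "\<exists>f. \<forall>P. P \<in> rep_annihilator M \<longleftrightarrow> f dvd P" unfolding ann by (rule annihilator_generator)
  then have all: "\<forall>P. P \<in> rep_annihilator M \<longleftrightarrow> rep_prime M dvd P" unfolding rep_prime_def by (rule someI_ex)
  then show "P \<in> rep_annihilator M \<longleftrightarrow> rep_prime M dvd P" by blast
  have Q: "monom 1 m - 1 \<in> annihilator" by (simp add: annihilating_polys_def act_minimal)
  then show dv: "rep_prime M dvd monom 1 m - 1" using all unfolding ann by blast
  show "prime_elem (rep_prime M)"
    unfolding prime_elem_def
  proof (intro conjI allI impI)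
    show "rep_prime M \<noteq> 0" using dv monom_minus_one_nonzero by auto
    show "\<not> rep_prime M dvd 1" using all one_notin_annihilator unfolding ann by blast
    show "rep_prime M dvd P \<or> rep_prime M dvd Q" if "rep_prime M dvd P * Q" for P Q
      using all annihilator_prime[of P Q] that unfolding ann by blast
  qed
qed

lemma rep_iso_of_rep_annihilator_eq:
  assumes k: "k \<in> R" and MN: "M \<in> simples k" "N \<in> simples k" and eq: "rep_annihilator M = rep_annihilator N"
  shows "(M, N) \<in> rep_iso smul S"
proof -
  obtain V \<rho> W \<sigma> where *: "M = (V, \<rho>)" "N = (W, \<sigma>)" by (cases M, cases N)
  interpret simple_monoid_rep S rk R e z m smul V \<rho> using MN(1) simples_iff[OF k] unfolding * by blast
  show ?thesis
    using rep_iso_of_annihilator_eq[of W \<sigma> k] MN eq simples_iff[OF k]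
    unfolding * rep_annihilator_def by simp
qed

lemma simple_classes_le:
  assumes k: "k \<in> R"
  shows "finite (simple_classes smul S (cell k)) \<and> card (simple_classes smul S (cell k)) \<le> m"
proof (rule finite_if_finite_subsets_card_bdd)
  fix G assume G: "G \<subseteq> simple_classes smul S (cell k)" "finite G"
  have "\<forall>C\<in>G. \<exists>M. M \<in> simples k \<and> C = rep_iso smul S `` {M}"
    using G(1) unfolding simple_classes_def simples_def quotient_def by blast
  then obtain \<mu> where \<mu>: "\<And>C. C \<in> G \<Longrightarrow> \<mu> C \<in> simples k" "\<And>C. C \<in> G \<Longrightarrow> C = rep_iso smul S `` {\<mu> C}"
    by metis
  have inj: "C = D" if "C \<in> G" "D \<in> G" and dv: "rep_prime (\<mu> C) dvd rep_prime (\<mu> D)" "rep_prime (\<mu> D) dvd rep_prime (\<mu> C)" for C D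
  proof -
    have "rep_annihilator (\<mu> C) = rep_annihilator (\<mu> D)"
      using rep_prime(1)[OF k \<mu>(1)[OF that(1)]] rep_prime(1)[OF k \<mu>(1)[OF that(2)]] dv dvd_trans by blast
    then have "(\<mu> C, \<mu> D) \<in> rep_iso smul S" using \<mu>(1) that by (intro rep_iso_of_rep_annihilator_eq[OF k])
    then show ?thesis using rep_iso_class_eq \<mu>(2) that by metis
  qed
  have "inj_on (\<lambda>C. rep_prime (\<mu> C)) G" by (rule inj_onI) (use inj in auto)
  then have "card G = card ((\<lambda>C. rep_prime (\<mu> C)) ` G)" by (simp add: card_image)
  also have "\<dots> \<le> degree (monom 1 m - 1 :: 'k poly)"
    using G(2) monom_minus_one_nonzero rep_prime(2,3)[OF k \<mu>(1)] inj
    by (intro card_prime_divisors_le_degree) auto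
  also have "\<dots> \<le> m" by (intro degree_diff_le) (auto simp: degree_monom_le)
  finally show "card G \<le> m" .
qed

end

section \<open>A simple representation on which the central generator is a scalar\<close>

text \<open>The representation lives on functions on the monoid, with \<open>t\<close> acting by \<open>(t f)(s) = f(s t)\<close>. Let \<open>\<chi>\<close>
  send an element \<open>s\<close> to \<open>c^i\<close> if \<open>e k s e k = z^i e k\<close>, and to 0 if the rank of \<open>e k s e k\<close> is less than \<open>k\<close>.
  The space is generated by \<open>\<chi>\<close>, hence it is spanned by the functions \<open>\<chi>(s x)\<close> of \<open>s\<close>. The independent
  vectors \<open>b\<close> carry these functions into the given vector space.\<close>

locale scalar_model = cyclic_J_chain_space S rk R e z m smul
  for S :: "('s, 'x) monoid_scheme" (structure) and rk R e z m
    and smul :: "'k::field \<Rightarrow> 'v::ab_group_add \<Rightarrow> 'v" +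
  fixes k :: nat and c :: 'k and b :: "'s \<Rightarrow> 'v"
  assumes k: "k \<in> R" and c: "c ^ m = 1"
    and finite_S: "finite (carrier S)"
    and b_inj: "inj_on b (carrier S)" and b_independent: "independent (b ` carrier S)"
begin

definition corner_char :: "'s \<Rightarrow> 'k" where
  "corner_char y = (if \<exists>i::nat. e k \<otimes> y \<otimes> e k = z [^] i \<otimes> e k
     then c ^ (SOME i::nat. e k \<otimes> y \<otimes> e k = z [^] i \<otimes> e k) else 0)"

text \<open>The function given by a combination of translates of the corner character.\<close>

definition matrix_coeff :: "('k \<times> 's) list \<Rightarrow> 's \<Rightarrow> 'k" where
  "matrix_coeff xs s = (\<Sum>(a, x)\<leftarrow>xs. a * corner_char (s \<otimes> x))"

definition vec :: "('k \<times> 's) list \<Rightarrow> 'v" where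
  "vec xs = (\<Sum>s\<in>carrier S. smul (matrix_coeff xs s) (b s))"

definition shift :: "'s \<Rightarrow> ('k \<times> 's) list \<Rightarrow> ('k \<times> 's) list" where
  "shift t = map (\<lambda>(a, x). (a, t \<otimes> x))"

definition combinations :: "('k \<times> 's) list set" where
  "combinations = {xs. snd ` set xs \<subseteq> carrier S}"

definition space :: "'v set" where "space = vec ` combinations"

text \<open>The choice of a combination is harmless, because translating on the right can be done on the
  function itself.\<close>

definition translate :: "'s \<Rightarrow> 'v \<Rightarrow> 'v" where
  "translate t v = vec (shift t (SOME xs. xs \<in> combinations \<and> v = vec xs))"

lemma ek: "e k \<in> carrier S" and ekek: "e k \<otimes> e k = e k" and rk_ek: "rk (e k) = k"
  using k by (simp_all add: e_closed e_idem rk_e)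

lemma pow_c_mod: "c ^ (i mod m) = c ^ i"
proof -
  have "c ^ i = c ^ (m * (i div m) + i mod m)" by simp
  also have "\<dots> = c ^ (i mod m)" unfolding power_add power_mult c by simp
  finally show ?thesis by simp
qed

lemma corner_char_eq:
  assumes "e k \<otimes> y \<otimes> e k = z [^] (i :: nat) \<otimes> e k"
  shows "corner_char y = c ^ i"
proof -
  define j where "j = (SOME i::nat. e k \<otimes> y \<otimes> e k = z [^] i \<otimes> e k)"
  have "e k \<otimes> y \<otimes> e k = z [^] j \<otimes> e k" unfolding j_def by (rule someI[where P = "\<lambda>i::nat. e k \<otimes> y \<otimes> e k = z [^] i \<otimes> e k", OF assms])
  then have "i mod m = j mod m" using corner_cong[OF k, of i j] assms by simp
  then have "c ^ i = c ^ j" using pow_c_mod[of i] pow_c_mod[of j] by simp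
  moreover have "corner_char y = c ^ j" unfolding corner_char_def j_def using assms by auto
  ultimately show ?thesis by simp
qed

lemma corner_char_eq_0:
  assumes "rk (e k \<otimes> y \<otimes> e k) < k"
  shows "corner_char y = 0"
proof -
  have "rk (e k \<otimes> y \<otimes> e k) = k" if "e k \<otimes> y \<otimes> e k = z [^] i \<otimes> e k" for i :: nat
    using rk_z_pow[OF ek, of i] that rk_ek by simp
  then show ?thesis using assms unfolding corner_char_def by auto
qed

lemma corner_cases:
  assumes y: "y \<in> carrier S"
  obtains i :: nat where "e k \<otimes> y \<otimes> e k = z [^] i \<otimes> e k" | "rk (e k \<otimes> y \<otimes> e k) < k"
proof (cases "rk (e k \<otimes> y \<otimes> e k) = k")
  case True
  then show ?thesis using corner[OF k y True] that(1) by blast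
next
  case False
  have "rk (e k \<otimes> y \<otimes> e k) \<le> k" using rk_mult(2)[of "e k \<otimes> y" "e k"] y ek rk_ek by simp
  then show ?thesis using False that(2) by simp
qed

text \<open>The character is multiplicative on the corner \<open>e k S e k\<close>: powers of \<open>z\<close> add up, and a factor of lower rank
  makes the product have lower rank.\<close>

lemma corner_char_mult:
  assumes s: "s \<in> carrier S" and t: "t \<in> carrier S"
  shows "corner_char (s \<otimes> (e k \<otimes> t)) = corner_char s * corner_char t"
proof -
  have split: "e k \<otimes> (s \<otimes> (e k \<otimes> t)) \<otimes> e k = (e k \<otimes> s \<otimes> e k) \<otimes> (e k \<otimes> t \<otimes> e k)"
  proof -
    have "(e k \<otimes> s \<otimes> e k) \<otimes> (e k \<otimes> t \<otimes> e k) = e k \<otimes> s \<otimes> (e k \<otimes> e k) \<otimes> (t \<otimes> e k)"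
      using s t ek by (simp only: m_assoc m_closed)
    then show ?thesis unfolding ekek using s t ek by (simp add: m_assoc)
  qed
  have le: "rk (e k \<otimes> (s \<otimes> (e k \<otimes> t)) \<otimes> e k) \<le> rk (e k \<otimes> s \<otimes> e k)"
    "rk (e k \<otimes> (s \<otimes> (e k \<otimes> t)) \<otimes> e k) \<le> rk (e k \<otimes> t \<otimes> e k)"
    unfolding split using s t ek by (intro rk_mult; simp)+
  show ?thesis
  proof (cases rule: corner_cases[OF s])
    case (1 i)
    show ?thesis
    proof (cases rule: corner_cases[OF t])
      case (1 j)
      have "e k \<otimes> (s \<otimes> (e k \<otimes> t)) \<otimes> e k = (z [^] i \<otimes> e k) \<otimes> (z [^] j \<otimes> e k)"
        unfolding split 1 \<open>e k \<otimes> s \<otimes> e k = z [^] i \<otimes> e k\<close> ..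
      also have "\<dots> = z [^] i \<otimes> (e k \<otimes> z [^] j) \<otimes> e k" using ek by (simp add: m_assoc)
      also have "\<dots> = z [^] i \<otimes> (z [^] j \<otimes> e k) \<otimes> e k" using z_pow_central[OF ek, of j] by simp
      also have "\<dots> = z [^] (i + j) \<otimes> e k" using ek ekek by (simp add: m_assoc nat_pow_mult[symmetric])
      finally have "corner_char (s \<otimes> (e k \<otimes> t)) = c ^ (i + j)" by (rule corner_char_eq)
      then show ?thesis
        using corner_char_eq[OF 1] corner_char_eq[OF \<open>e k \<otimes> s \<otimes> e k = z [^] i \<otimes> e k\<close>] by (simp add: power_add)
    next
      case 2
      then show ?thesis using corner_char_eq_0 le by fastforce
    qed
  next
    case 2
    then show ?thesis using corner_char_eq_0 le by fastforce
  qed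
qed

lemma corner_char_z:
  assumes y: "y \<in> carrier S"
  shows "corner_char (z \<otimes> y) = c * corner_char y"
proof -
  have eq: "e k \<otimes> (z \<otimes> y) \<otimes> e k = z \<otimes> (e k \<otimes> y \<otimes> e k)"
    using y ek z_central[OF ek] by (metis m_assoc m_closed z_closed)
  show ?thesis
  proof (cases rule: corner_cases[OF y])
    case (1 i)
    have "e k \<otimes> (z \<otimes> y) \<otimes> e k = z [^] Suc i \<otimes> e k"
      unfolding eq 1 using ek z_pow_central[of z i] by (simp add: m_assoc)
    then show ?thesis using corner_char_eq[of "z \<otimes> y" "Suc i"] corner_char_eq[OF 1] by simp
  next
    case 2
    moreover have "rk (e k \<otimes> (z \<otimes> y) \<otimes> e k) \<le> rk (e k \<otimes> y \<otimes> e k)"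
      unfolding eq using y ek by (intro rk_mult) auto
    ultimately show ?thesis using corner_char_eq_0 by fastforce
  qed
qed

lemma corner_char_one: "corner_char \<one> = 1" and corner_char_e: "corner_char (e k) = 1"
  using corner_char_eq[of \<one> 0] corner_char_eq[of "e k" 0] ek ekek by simp_all

lemma corner_char_low:
  assumes "s \<in> carrier S" "t \<in> carrier S" "y \<in> carrier S" "rk t < k"
  shows "corner_char (s \<otimes> (t \<otimes> y)) = 0"
proof (rule corner_char_eq_0)
  have "e k \<otimes> (s \<otimes> (t \<otimes> y)) \<otimes> e k = (e k \<otimes> s) \<otimes> (t \<otimes> (y \<otimes> e k))"
    using assms ek by (simp add: m_assoc)
  then have "rk (e k \<otimes> (s \<otimes> (t \<otimes> y)) \<otimes> e k) \<le> rk (t \<otimes> (y \<otimes> e k))"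
    using assms ek by (simp add: rk_mult)
  also have "\<dots> \<le> rk t" using assms ek by (simp add: rk_mult)
  finally show "rk (e k \<otimes> (s \<otimes> (t \<otimes> y)) \<otimes> e k) < k" using assms(4) by simp
qed

lemma matrix_coeff_simps [simp]:
  "matrix_coeff [] s = 0" "matrix_coeff ((a, x) # xs) s = a * corner_char (s \<otimes> x) + matrix_coeff xs s"
  "matrix_coeff (xs @ ys) s = matrix_coeff xs s + matrix_coeff ys s"
  by (simp_all add: matrix_coeff_def)

lemma matrix_coeff_scale: "matrix_coeff (map (\<lambda>(a, x). (d * a, x)) xs) s = d * matrix_coeff xs s"
  by (induction xs) (auto simp: distrib_left mult.assoc)

lemma matrix_coeff_shift:
  "xs \<in> combinations \<Longrightarrow> t \<in> carrier S \<Longrightarrow> s \<in> carrier S \<Longrightarrow> matrix_coeff (shift t xs) s = matrix_coeff xs (s \<otimes> t)"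
  by (induction xs) (auto simp: shift_def combinations_def m_assoc)

lemma combinations_simps [simp]:
  "[] \<in> combinations" "(a, x) # xs \<in> combinations \<longleftrightarrow> x \<in> carrier S \<and> xs \<in> combinations"
  "xs @ ys \<in> combinations \<longleftrightarrow> xs \<in> combinations \<and> ys \<in> combinations"
  by (auto simp: combinations_def)

lemma combinations_shift: "xs \<in> combinations \<Longrightarrow> t \<in> carrier S \<Longrightarrow> shift t xs \<in> combinations"
  by (auto simp: combinations_def shift_def)

lemma combinations_scale: "xs \<in> combinations \<Longrightarrow> map (\<lambda>(a, x). (d * a, x)) xs \<in> combinations"
  by (auto simp: combinations_def)

lemma vec_eq_iff: "vec xs = vec ys \<longleftrightarrow> (\<forall>s\<in>carrier S. matrix_coeff xs s = matrix_coeff ys s)"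
proof
  assume eq: "vec xs = vec ys"
  let ?u = "\<lambda>v. matrix_coeff xs (the_inv_into (carrier S) b v) - matrix_coeff ys (the_inv_into (carrier S) b v)"
  have "(\<Sum>v\<in>b ` carrier S. smul (?u v) v) = (\<Sum>s\<in>carrier S. smul (matrix_coeff xs s - matrix_coeff ys s) (b s))"
    using b_inj by (subst sum.reindex) (auto simp: the_inv_into_f_f)
  also have "\<dots> = vec xs - vec ys"
    by (simp add: vec_def scale_left_diff_distrib sum_subtractf)
  finally have zero: "(\<Sum>v\<in>b ` carrier S. smul (?u v) v) = 0" using eq by simp
  show "\<forall>s\<in>carrier S. matrix_coeff xs s = matrix_coeff ys s"
  proof
    fix s assume s: "s \<in> carrier S"
    have "?u (b s) = 0"
      using independentD[OF b_independent _ subset_refl zero, of "b s"] finite_S s by blast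
    then show "matrix_coeff xs s = matrix_coeff ys s" using b_inj s by (simp add: the_inv_into_f_f)
  qed
qed (simp add: vec_def)

lemma vec_append: "vec (xs @ ys) = vec xs + vec ys"
  by (simp add: vec_def scale_left_distrib sum.distrib)

lemma vec_Nil: "vec [] = 0"
  by (simp add: vec_def)

lemma vec_scale: "vec (map (\<lambda>(a, x). (d * a, x)) xs) = smul d (vec xs)"
  by (simp add: vec_def matrix_coeff_scale scale_sum_right)

lemma translate_vec:
  assumes xs: "xs \<in> combinations" and t: "t \<in> carrier S"
  shows "translate t (vec xs) = vec (shift t xs)"
proof -
  define ys where "ys = (SOME ys. ys \<in> combinations \<and> vec xs = vec ys)"
  have "\<exists>ys. ys \<in> combinations \<and> vec xs = vec ys" using xs by blast
  then have ys: "ys \<in> combinations \<and> vec xs = vec ys" unfolding ys_def by (rule someI_ex)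
  have "vec (shift t ys) = vec (shift t xs)"
    unfolding vec_eq_iff using ys xs t matrix_coeff_shift by (simp add: vec_eq_iff)
  then show ?thesis unfolding translate_def ys_def .
qed

lemma representation_translate: "Defs.representation smul S (space, translate)"
  unfolding Defs.representation_def prod.case
proof (intro conjI ballI)
  show "subspace space"
    unfolding subspace_def
  proof (intro conjI ballI allI)
    show "0 \<in> space" unfolding space_def using vec_Nil by (metis combinations_simps(1) imageI)
    fix v assume "v \<in> space"
    then obtain xs where xs: "xs \<in> combinations" "v = vec xs" unfolding space_def by blast
    show "smul d v \<in> space" for d
      unfolding space_def xs(2) vec_scale[symmetric] using combinations_scale[OF xs(1)] by blast
    fix w assume "w \<in> space"
    then obtain ys where ys: "ys \<in> combinations" "w = vec ys" unfolding space_def by blast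
    have "xs @ ys \<in> combinations" using xs ys by simp
    then show "v + w \<in> space" unfolding space_def xs(2) ys(2) vec_append[symmetric] by blast
  qed
next
  fix t assume t: "t \<in> carrier S"
  show "linear_between smul space space (translate t)"
    unfolding linear_between_def
  proof (intro conjI ballI allI)
    show "translate t ` space \<subseteq> space"
      unfolding space_def using translate_vec[OF _ t] combinations_shift[OF _ t] by auto
    fix v assume "v \<in> space"
    then obtain xs where xs: "xs \<in> combinations" "v = vec xs" unfolding space_def by blast
    have "shift t (map (\<lambda>(a, x). (d * a, x)) xs) = map (\<lambda>(a, x). (d * a, x)) (shift t xs)" for d
      by (auto simp: shift_def)
    then show "translate t (smul d v) = smul d (translate t v)" for d
      unfolding xs(2) vec_scale[symmetric] translate_vec[OF xs(1) t] translate_vec[OF combinations_scale[OF xs(1)] t]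
      by (simp add: vec_scale)
    fix w assume "w \<in> space"
    then obtain ys where ys: "ys \<in> combinations" "w = vec ys" unfolding space_def by blast
    have "xs @ ys \<in> combinations" using xs ys by simp
    moreover have "shift t (xs @ ys) = shift t xs @ shift t ys" by (simp add: shift_def)
    ultimately show "translate t (v + w) = translate t v + translate t w"
      unfolding xs(2) ys(2) vec_append[symmetric] translate_vec[OF xs(1) t] translate_vec[OF ys(1) t]
      by (simp add: translate_vec[OF _ t])
  qed
next
  fix v assume "v \<in> space"
  then obtain xs where xs: "xs \<in> combinations" "v = vec xs" unfolding space_def by blast
  show "translate \<one> v = v"
    unfolding xs(2) translate_vec[OF xs(1) one_closed] vec_eq_iff using xs(1) by (simp add: matrix_coeff_shift)
next
  fix s t v assume st: "s \<in> carrier S" "t \<in> carrier S" and "v \<in> space"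
  then obtain xs where xs: "xs \<in> combinations" "v = vec xs" unfolding space_def by blast
  show "translate (s \<otimes> t) v = translate s (translate t v)"
    unfolding xs(2) using st xs(1)
    by (simp add: translate_vec combinations_shift vec_eq_iff matrix_coeff_shift m_assoc)
qed

lemma vec_singleton_nonzero: "vec [(1, \<one>)] \<noteq> 0"
proof
  assume "vec [(1, \<one>)] = 0"
  then have "vec [(1, \<one>)] = vec []" by (simp add: vec_Nil)
  then have "matrix_coeff [(1, \<one>)] \<one> = matrix_coeff [] \<one>" unfolding vec_eq_iff using one_closed by blast
  then show False by (simp add: corner_char_one)
qed

text \<open>For a nonzero function \<open>f\<close> with \<open>f(s) \<noteq> 0\<close>, the translate by \<open>e k s\<close> is \<open>f(s) \<chi>\<close>, so every nonzero
  subrepresentation contains the generator.\<close>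

lemma simple_translate: "simple_monoid_rep S rk R e z m smul space translate"
proof -
  interpret T: monoid_rep S rk R e z m smul space translate
    by unfold_locales (rule representation_translate)
  show ?thesis
  proof unfold_locales
    have "vec [(1, \<one>)] \<in> space" unfolding space_def by (rule imageI) simp
    then show "space \<noteq> {0}" using vec_singleton_nonzero by blast
    fix W assume W: "W \<subseteq> space" "Defs.representation smul S (W, translate)"
    show "W = {0} \<or> W = space"
    proof (cases "W = {0}")
      case False
      interpret W: monoid_rep S rk R e z m smul W translate by unfold_locales (rule W(2))
      obtain w where w: "w \<in> W" "w \<noteq> 0" using False W.V_0 by blast
      then obtain xs where xs: "xs \<in> combinations" "w = vec xs" using W(1) unfolding space_def by blast
      have "vec xs \<noteq> vec []" using w xs by (simp add: vec_Nil)
      then obtain s where s: "s \<in> carrier S" "matrix_coeff xs s \<noteq> 0" unfolding vec_eq_iff by auto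
      let ?d = "matrix_coeff xs s"
      have fact: "matrix_coeff ys (t \<otimes> (e k \<otimes> s)) = corner_char t * matrix_coeff ys s"
        if "ys \<in> combinations" "t \<in> carrier S" for ys t
        using that
      proof (induction ys)
        case (Cons p ys)
        obtain a x where p: "p = (a, x)" by (cases p)
        have x: "x \<in> carrier S" using Cons.prems p by simp
        have "t \<otimes> (e k \<otimes> s) \<otimes> x = t \<otimes> (e k \<otimes> (s \<otimes> x))" using x s(1) ek Cons.prems(2) by (simp add: m_assoc)
        then have "corner_char (t \<otimes> (e k \<otimes> s) \<otimes> x) = corner_char t * corner_char (s \<otimes> x)"
          using corner_char_mult[OF Cons.prems(2), of "s \<otimes> x"] x s(1) by simp
        then show ?case using Cons p by (simp add: distrib_left mult.left_commute)
      qed simp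
      have es: "e k \<otimes> s \<in> carrier S" using ek s(1) by simp
      have "translate (e k \<otimes> s) w = smul ?d (vec [(1, \<one>)])"
        unfolding xs(2) translate_vec[OF xs(1) es] vec_scale[symmetric] vec_eq_iff
        using fact[OF xs(1)] xs(1) es by (simp add: matrix_coeff_shift)
      moreover have "translate (e k \<otimes> s) w \<in> W" using w es by simp
      ultimately have "smul ?d (vec [(1, \<one>)]) \<in> W" by simp
      then have "smul (inverse ?d) (smul ?d (vec [(1, \<one>)])) \<in> W" by (rule W.V_scale)
      then have gen: "vec [(1, \<one>)] \<in> W" using s(2) by simp
      have "vec ys \<in> W" if "ys \<in> combinations" for ys
        using that
      proof (induction ys)
        case (Cons p ys)
        obtain a x where p: "p = (a, x)" by (cases p)
        have x: "x \<in> carrier S" using Cons.prems p by simp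
        have "vec (p # ys) = vec (map (\<lambda>(d, x). (a * d, x)) [(1, x)] @ ys)" by (simp add: p)
        also have "\<dots> = smul a (vec [(1, x)]) + vec ys" unfolding vec_append vec_scale ..
        also have "vec [(1, x)] = translate x (vec [(1, \<one>)])"
          using x translate_vec[of "[(1, \<one>)]" x] by (simp add: shift_def)
        finally show ?case using gen x Cons p by simp
      qed (simp add: vec_Nil)
      then have "W = space" using W(1) unfolding space_def by blast
      then show ?thesis ..
    qed simp
  qed
qed

lemma apex_translate: "apex_rank k space translate"
  unfolding apex_rank_def
proof (intro conjI ballI impI)
  show "k \<in> R" by (rule k)
  fix s v assume s: "s \<in> carrier S" "rk s < k" and "v \<in> space"
  then obtain xs where xs: "xs \<in> combinations" "v = vec xs" unfolding space_def by blast
  have "matrix_coeff (shift s xs) t = 0" if "t \<in> carrier S" for t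
    using xs(1) by (induction xs) (use that s corner_char_low in \<open>auto simp: shift_def\<close>)
  then have "vec (shift s xs) = vec []" unfolding vec_eq_iff by simp
  then show "translate s v = 0" using translate_vec[OF xs(1) s(1)] xs(2) by (simp add: vec_Nil)
next
  have "matrix_coeff (shift (e k) [(1, \<one>)]) \<one> = 1"
    using ek corner_char_e by (simp add: shift_def)
  then have "vec (shift (e k) [(1, \<one>)]) \<noteq> vec []" unfolding vec_eq_iff using one_closed by force
  then have "translate (e k) (vec [(1, \<one>)]) \<noteq> 0" using translate_vec[of "[(1, \<one>)]" "e k"] ek by (simp add: vec_Nil)
  moreover have "vec [(1, \<one>)] \<in> space" unfolding space_def by (rule imageI) simp
  ultimately show "\<exists>v\<in>space. translate (e k) v \<noteq> 0" by blast
qed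

lemma z_translate:
  assumes "v \<in> space"
  shows "translate z v = smul c v"
proof -
  obtain xs where xs: "xs \<in> combinations" "v = vec xs" using assms unfolding space_def by blast
  have "matrix_coeff (shift z xs) s = c * matrix_coeff xs s" if s: "s \<in> carrier S" for s
    using xs(1)
  proof (induction xs)
    case (Cons p xs)
    obtain a x where p: "p = (a, x)" by (cases p)
    have x: "x \<in> carrier S" using Cons.prems p by simp
    have "s \<otimes> (z \<otimes> x) = z \<otimes> (s \<otimes> x)" using s x z_central[OF s] by (simp add: m_assoc[symmetric])
    then have "corner_char (s \<otimes> (z \<otimes> x)) = c * corner_char (s \<otimes> x)" using corner_char_z[of "s \<otimes> x"] s x by simp
    then show ?case using Cons p by (simp add: shift_def distrib_left mult.left_commute)
  qed (simp add: shift_def)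
  then show ?thesis
    unfolding xs(2) translate_vec[OF xs(1) z_closed] vec_scale[symmetric] vec_eq_iff by (simp add: matrix_coeff_scale)
qed

end


section \<open>Apexes and the number of simple representations\<close>

context cyclic_J_chain_space
begin

lemma scalar_simple_exists:
  assumes k: "k \<in> R" and c: "c ^ m = 1" and fin: "finite (carrier S)" and inf: "infinite_dimensional smul"
  obtains M where "M \<in> simples k" "\<And>v. v \<in> fst M \<Longrightarrow> snd M z v = smul c v"
proof -
  obtain B where B: "independent B" "UNIV \<subseteq> span B"
    using maximal_independent_subset[of UNIV] by metis
  have "infinite B"
  proof
    assume "finite B"
    then show False using inf B(2) unfolding infinite_dimensional_def by blast
  qed
  then obtain T where T: "finite T" "card T = card (carrier S)" "T \<subseteq> B"
    using infinite_arbitrarily_large by blast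
  then obtain b where b: "bij_betw b (carrier S) T" using finite_same_card_bij[OF fin T(1)] by auto
  interpret scalar_model S rk R e z m smul k c b
  proof unfold_locales
    show "inj_on b (carrier S)" using b by (simp add: bij_betw_def)
    have "b ` carrier S = T" using b by (simp add: bij_betw_def)
    then show "independent (b ` carrier S)" using independent_mono[OF B(1) T(3)] by simp
  qed (fact k c fin)+
  show ?thesis
  proof (rule that[of "(space, translate)"])
    show "(space, translate) \<in> simples k"
      using simples_iff[OF k] simple_translate apex_translate by blast
  qed (simp add: z_translate)
qed

lemma rep_iso_refl:
  assumes "Defs.representation smul S M"
  shows "(M, M) \<in> rep_iso smul S"
proof -
  obtain V \<rho> where M: "M = (V, \<rho>)" by (cases M)
  have "linear_between smul V V id" by (simp add: linear_between_def)
  then show ?thesis using assms unfolding M rep_iso_def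
    by (intro CollectI) (auto intro!: exI[of _ id])
qed

text \<open>An isomorphism intertwines the two actions of \<open>z\<close>, and the space contains a nonzero vector.\<close>

lemma rep_iso_scalar_eq:
  assumes k: "k \<in> R" and M: "M \<in> simples k" and iso: "(M, N) \<in> rep_iso smul S"
    and c: "\<And>v. v \<in> fst M \<Longrightarrow> snd M z v = smul c v" and d: "\<And>v. v \<in> fst N \<Longrightarrow> snd N z v = smul d v"
  shows "c = d"
proof -
  obtain V \<rho> W \<sigma> where MN: "M = (V, \<rho>)" "N = (W, \<sigma>)" by (cases M, cases N)
  interpret simple_monoid_rep S rk R e z m smul V \<rho> using M simples_iff[OF k] unfolding MN by blast
  from iso obtain f where f: "linear_between smul V W f" "bij_betw f V W"
      "\<And>s v. s \<in> carrier S \<Longrightarrow> v \<in> V \<Longrightarrow> f (\<rho> s v) = \<sigma> s (f v)"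
    unfolding MN rep_iso_def by blast
  obtain v where v: "v \<in> V" "v \<noteq> 0" using nontrivial V_0 by blast
  have fv: "f v \<in> W" using f(2) v(1) by (auto simp: bij_betw_def)
  have f_scale: "f (smul a u) = smul a (f u)" if "u \<in> V" for a u
    using f(1) that by (simp add: linear_between_def)
  have "f 0 = 0" using f_scale[OF V_0, of 0] by simp
  then have nz: "f v \<noteq> 0" using f(2) v V_0 unfolding bij_betw_def inj_on_def by metis
  have "smul c (f v) = f (\<rho> z v)" using c[of v] v(1) f_scale by (simp add: MN)
  also have "\<dots> = smul d (f v)" using f(3)[OF z_closed v(1)] d[of "f v"] fv by (simp add: MN)
  finally show ?thesis using nz by simp
qed

lemma simple_classes_ge:
  assumes k: "k \<in> R" and fin: "finite (carrier S)" and inf: "infinite_dimensional smul"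
    and \<zeta>: "primitive_root_of_unity m (\<zeta> :: 'k)"
  shows "m \<le> card (simple_classes smul S (cell k))"
proof -
  have "\<exists>M. M \<in> simples k \<and> (\<forall>v\<in>fst M. snd M z v = smul (\<zeta> ^ i) v)" for i
  proof -
    have "(\<zeta> ^ i) ^ m = 1" using \<zeta> unfolding primitive_root_of_unity_def
      by (metis mult.commute power_mult power_one)
    then show ?thesis using scalar_simple_exists[OF k _ fin inf] by metis
  qed
  then obtain M where M: "\<And>i. M i \<in> simples k" "\<And>i v. v \<in> fst (M i) \<Longrightarrow> snd (M i) z v = smul (\<zeta> ^ i) v"
    by metis
  have \<zeta>0: "\<zeta> \<noteq> 0" using \<zeta> m_pos unfolding primitive_root_of_unity_def by (metis power_0_left not_one_le_zero zero_neq_one)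
  have pow_inj: False if "i < j" "j < m" "\<zeta> ^ i = \<zeta> ^ j" for i j
  proof -
    have "\<zeta> ^ i * \<zeta> ^ (j - i) = \<zeta> ^ (i + (j - i))" by (simp only: power_add)
    also have "\<dots> = \<zeta> ^ i * 1" using that by simp
    finally have "\<zeta> ^ i * \<zeta> ^ (j - i) = \<zeta> ^ i * 1" .
    then have "\<zeta> ^ (j - i) = 1" using \<zeta>0 by simp
    moreover have "0 < j - i" "j - i < m" using that by auto
    ultimately show False using \<zeta> unfolding primitive_root_of_unity_def by blast
  qed
  have "inj_on (\<lambda>i. rep_iso smul S `` {M i}) {..<m}"
  proof (rule inj_onI)
    fix i j assume ij: "i \<in> {..<m}" "j \<in> {..<m}" and eq: "rep_iso smul S `` {M i} = rep_iso smul S `` {M j}"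
    have "Defs.representation smul S (M j)" using M(1)[of j] by (cases "M j") (simp add: simples_def simple_rep_def)
    then have "M j \<in> rep_iso smul S `` {M j}" using rep_iso_refl by blast
    then have "(M i, M j) \<in> rep_iso smul S" using eq by blast
    then have "\<zeta> ^ i = \<zeta> ^ j" using rep_iso_scalar_eq[OF k M(1) _ M(2) M(2)] by blast
    then show "i = j" using pow_inj[of i j] pow_inj[of j i] ij by (metis lessThan_iff linorder_neqE_nat)
  qed
  then have "card {..<m} = card ((\<lambda>i. rep_iso smul S `` {M i}) ` {..<m})" by (simp add: card_image)
  also have "\<dots> \<le> card (simple_classes smul S (cell k))"
  proof (rule card_mono)
    show "finite (simple_classes smul S (cell k))" using simple_classes_le[OF k] by blast
    show "(\<lambda>i. rep_iso smul S `` {M i}) ` {..<m} \<subseteq> simple_classes smul S (cell k)"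
      using M(1) unfolding simple_classes_def simples_def quotient_def by blast
  qed
  finally show ?thesis by simp
qed

lemma simple_apexes_eq:
  assumes fin: "finite (carrier S)" and inf: "infinite_dimensional smul"
  shows "simple_apexes smul S = cell ` R"
proof
  show "simple_apexes smul S \<subseteq> cell ` R"
    unfolding simple_apexes_def is_apex_def idempotent_J_cells_eq by blast
  show "cell ` R \<subseteq> simple_apexes smul S"
  proof
    fix J assume "J \<in> cell ` R"
    then obtain k where k: "k \<in> R" "J = cell k" by blast
    obtain M where "M \<in> simples k" using scalar_simple_exists[OF k(1) power_one fin inf] .
    then show "J \<in> simple_apexes smul S" unfolding simple_apexes_def simples_def k(2) by blast
  qed
qed

theorem apexes_and_simple_classes:
  assumes fin: "finite (carrier S)" and inf: "infinite_dimensional smul"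
  shows "(\<exists>\<iota>. bij_betw \<iota> R (simple_apexes smul S) \<and>
            (\<forall>k\<in>R. \<forall>l\<in>R. J_cell_le S (\<iota> k) (\<iota> l) \<longleftrightarrow> l \<le> k)) \<and>
         (\<forall>J\<in>simple_apexes smul S.
            finite (simple_classes smul S J) \<and> card (simple_classes smul S J) \<le> m \<and>
            ((\<exists>z::'k. primitive_root_of_unity m z) \<longrightarrow> card (simple_classes smul S J) = m))"
proof
  have "bij_betw cell R (simple_apexes smul S)"
    unfolding simple_apexes_eq[OF fin inf] bij_betw_def by (auto simp: inj_on_def cell_inject)
  then show "\<exists>\<iota>. bij_betw \<iota> R (simple_apexes smul S) \<and>
      (\<forall>k\<in>R. \<forall>l\<in>R. J_cell_le S (\<iota> k) (\<iota> l) \<longleftrightarrow> l \<le> k)"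
    using J_cell_le_cell by blast
  show "\<forall>J\<in>simple_apexes smul S.
      finite (simple_classes smul S J) \<and> card (simple_classes smul S J) \<le> m \<and>
      ((\<exists>z::'k. primitive_root_of_unity m z) \<longrightarrow> card (simple_classes smul S J) = m)"
    unfolding simple_apexes_eq[OF fin inf]
    using simple_classes_le simple_classes_ge[OF _ fin inf] by (auto intro: antisym)
qed

end

section \<open>The cyclic Temperley--Lieb monoid\<close>

lemma mod_add_inner:
  fixes x y w M :: int
  shows "(y mod M + x + w) mod M = (y + x + w) mod M" "(x + y mod M + w) mod M = (x + y + w) mod M"
proof -
  have "(y mod M + (x + w)) mod M = (y + (x + w)) mod M" by (rule mod_add_left_eq)
  then show "(y mod M + x + w) mod M = (y + x + w) mod M" "(x + y mod M + w) mod M = (x + y + w) mod M"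
    by (simp_all only: ac_simps)
qed

lemma finite_crossingless: "finite (crossingless p q)"
proof (rule finite_subset)
  show "crossingless p q \<subseteq> Pow (Pow (marked_points p q))"
    using crossingless_perfect_matching perfect_matching_block_subset by blast
qed simp

lemma carrier_cyclic_TL:
  "1 \<le> m \<Longrightarrow> carrier (cyclic_TL m n) = crossingless n n \<times> {0..<int m}"
  by (simp add: cyclic_TL_def carrier_integer_mod_group)

lemma mult_cyclic_TL:
  "(a, i) \<otimes>\<^bsub>cyclic_TL m n\<^esub> (b, j) = (glue n n n a b, (i + j + int (loops n n n a b)) mod int m)"
  by (simp add: cyclic_TL_def)

lemma one_cyclic_TL: "\<one>\<^bsub>cyclic_TL m n\<^esub> = (id_diagram n, 0)"
  by (simp add: cyclic_TL_def)

lemma monoid_cyclic_TL: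
  assumes m: "1 \<le> m"
  shows "Group.monoid (cyclic_TL m n)"
proof (rule Group.monoidI)
  note pm = crossingless_perfect_matching
  fix x y w assume "x \<in> carrier (cyclic_TL m n)" "y \<in> carrier (cyclic_TL m n)" "w \<in> carrier (cyclic_TL m n)"
  then obtain a i b j c l where *: "x = (a, i)" "y = (b, j)" "w = (c, l)"
    "a \<in> crossingless n n" "b \<in> crossingless n n" "c \<in> crossingless n n"
    by (auto simp: carrier_cyclic_TL[OF m])
  have "int (loops n n n a b) + int (loops n n n (glue n n n a b) c) =
      int (loops n n n b c) + int (loops n n n a (glue n n n b c))"
    using loops_cocycle[OF pm[OF *(4)] pm[OF *(5)] pm[OF *(6)]] by linarith
  then have sum: "i + j + int (loops n n n a b) + l + int (loops n n n (glue n n n a b) c) =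
      i + (j + l + int (loops n n n b c)) + int (loops n n n a (glue n n n b c))"
    by linarith
  have "((i + j + int (loops n n n a b)) mod int m + l + int (loops n n n (glue n n n a b) c)) mod int m =
      (i + j + int (loops n n n a b) + l + int (loops n n n (glue n n n a b) c)) mod int m"
    by (rule mod_add_inner(1))
  also have "\<dots> = (i + (j + l + int (loops n n n b c)) mod int m + int (loops n n n a (glue n n n b c))) mod int m"
    unfolding sum by (rule mod_add_inner(2)[symmetric])
  finally show "x \<otimes>\<^bsub>cyclic_TL m n\<^esub> y \<otimes>\<^bsub>cyclic_TL m n\<^esub> w = x \<otimes>\<^bsub>cyclic_TL m n\<^esub> (y \<otimes>\<^bsub>cyclic_TL m n\<^esub> w)"
    by (simp add: * mult_cyclic_TL glue_assoc[OF pm[OF *(4)] pm[OF *(5)] pm[OF *(6)]])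
next
  note pm = crossingless_perfect_matching
  show "\<one>\<^bsub>cyclic_TL m n\<^esub> \<in> carrier (cyclic_TL m n)"
    using m by (simp add: one_cyclic_TL carrier_cyclic_TL id_diagram_crossingless)
  fix x assume "x \<in> carrier (cyclic_TL m n)"
  then obtain a i where *: "x = (a, i)" "a \<in> crossingless n n" "0 \<le> i" "i < int m"
    by (auto simp: carrier_cyclic_TL[OF m])
  show "\<one>\<^bsub>cyclic_TL m n\<^esub> \<otimes>\<^bsub>cyclic_TL m n\<^esub> x = x" "x \<otimes>\<^bsub>cyclic_TL m n\<^esub> \<one>\<^bsub>cyclic_TL m n\<^esub> = x"
    using * glue_id_left[OF pm[OF *(2)]] glue_id_right[OF pm[OF *(2)]]
    by (simp_all add: one_cyclic_TL mult_cyclic_TL)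
  fix y assume "y \<in> carrier (cyclic_TL m n)"
  then show "x \<otimes>\<^bsub>cyclic_TL m n\<^esub> y \<in> carrier (cyclic_TL m n)"
    using * m glue_crossingless by (cases y) (auto simp: carrier_cyclic_TL mult_cyclic_TL)
qed

text \<open>The diagrams are handled by \<open>crossingless_reachable\<close>, and the second component can be corrected
  by a power of the central element.\<close>

lemma lr_le_cyclic_TL:
  assumes m: "1 \<le> m" and s: "s \<in> carrier (cyclic_TL m n)" and t: "t \<in> carrier (cyclic_TL m n)"
  shows "lr_le (cyclic_TL m n) s t \<longleftrightarrow> through_number (fst t) \<le> through_number (fst s)"
proof -
  interpret Group.monoid "cyclic_TL m n" by (rule monoid_cyclic_TL[OF m])
  note pm = crossingless_perfect_matching
  obtain a i b j where *: "s = (a, i)" "t = (b, j)" "a \<in> crossingless n n" "b \<in> crossingless n n" "0 \<le> j" "j < int m"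
    using s t by (auto simp: carrier_cyclic_TL[OF m])
  show ?thesis
  proof
    assume "lr_le (cyclic_TL m n) s t"
    then obtain c l d l' where cd: "c \<in> crossingless n n" "d \<in> crossingless n n"
        "t = (c, l) \<otimes>\<^bsub>cyclic_TL m n\<^esub> s \<otimes>\<^bsub>cyclic_TL m n\<^esub> (d, l')"
      unfolding lr_le_def by (auto simp: carrier_cyclic_TL[OF m])
    then have b: "b = glue n n n (glue n n n c a) d" by (simp add: * mult_cyclic_TL)
    have "through_number b \<le> through_number (glue n n n c a)"
      unfolding b by (rule through_number_glue_le_upper[OF pm[OF glue_crossingless[OF cd(1) *(3)]] pm[OF cd(2)]])
    also have "\<dots> \<le> through_number a" by (rule through_number_glue_le_lower[OF pm[OF cd(1)] pm[OF *(3)]])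
    finally show "through_number (fst t) \<le> through_number (fst s)" by (simp add: *)
  next
    assume "through_number (fst t) \<le> through_number (fst s)"
    then obtain c d where cd: "c \<in> crossingless n n" "d \<in> crossingless n n" "b = glue n n n c (glue n n n a d)"
      using crossingless_reachable[OF *(3,4)] by (auto simp: *)
    define \<phi> where "\<phi> = i + int (loops n n n a d) + int (loops n n n c (glue n n n a d))"
    define x where "x = (j - \<phi>) mod int m"
    have C: "(c, x) \<in> carrier (cyclic_TL m n)" and D: "(d, 0) \<in> carrier (cyclic_TL m n)"
      using cd m by (simp_all add: carrier_cyclic_TL x_def)
    have "(c, x) \<otimes>\<^bsub>cyclic_TL m n\<^esub> s \<otimes>\<^bsub>cyclic_TL m n\<^esub> (d, 0) =
        (c, x) \<otimes>\<^bsub>cyclic_TL m n\<^esub> (s \<otimes>\<^bsub>cyclic_TL m n\<^esub> (d, 0))"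
      by (rule m_assoc[OF C s D])
    also have "\<dots> = (b, (x + (i + int (loops n n n a d)) mod int m + int (loops n n n c (glue n n n a d))) mod int m)"
      by (simp add: * mult_cyclic_TL cd(3)[symmetric])
    also have "(x + (i + int (loops n n n a d)) mod int m + int (loops n n n c (glue n n n a d))) mod int m =
        (x + \<phi>) mod int m"
      unfolding mod_add_inner(2) \<phi>_def by (simp only: ac_simps)
    also have "\<dots> = j" using *(5,6) by (simp add: x_def mod_simps)
    finally have "t = (c, x) \<otimes>\<^bsub>cyclic_TL m n\<^esub> s \<otimes>\<^bsub>cyclic_TL m n\<^esub> (d, 0)" by (simp add: *)
    then show "lr_le (cyclic_TL m n) s t" unfolding lr_le_def using C D by blast
  qed
qed

lemma cyclic_TL_cyclic_J_chain:
  assumes m: "1 \<le> m"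
  obtains e z where "cyclic_J_chain (cyclic_TL m n) (\<lambda>s. through_number (fst s)) (strand_numbers n) e z m"
proof -
  let ?S = "cyclic_TL m n"
  interpret Group.monoid ?S by (rule monoid_cyclic_TL[OF m])
  note pm = crossingless_perfect_matching
  have "\<forall>k\<in>strand_numbers n. \<exists>\<epsilon>. \<epsilon> \<in> crossingless n n \<and> glue n n n \<epsilon> \<epsilon> = \<epsilon> \<and> through_number \<epsilon> = k \<and>
      (\<forall>s\<in>crossingless n n. through_number (glue n n n \<epsilon> (glue n n n s \<epsilon>)) = k \<longrightarrow> glue n n n \<epsilon> (glue n n n s \<epsilon>) = \<epsilon>)"
    using projection_diagram by metis
  then obtain \<epsilon> where \<epsilon>: "\<And>k. k \<in> strand_numbers n \<Longrightarrow> \<epsilon> k \<in> crossingless n n \<and> glue n n n (\<epsilon> k) (\<epsilon> k) = \<epsilon> k \<and>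
      through_number (\<epsilon> k) = k \<and>
      (\<forall>s\<in>crossingless n n. through_number (glue n n n (\<epsilon> k) (glue n n n s (\<epsilon> k))) = k \<longrightarrow>
         glue n n n (\<epsilon> k) (glue n n n s (\<epsilon> k)) = \<epsilon> k)"
    by metis
  \<comment> \<open>The second component of an idempotent has to cancel the loops that arise when the diagram is squared.\<close>
  define \<delta> where "\<delta> k = (- int (loops n n n (\<epsilon> k) (\<epsilon> k))) mod int m" for k
  define e where "e k = (\<epsilon> k, \<delta> k)" for k
  define z where "z = (id_diagram n, 1 mod int m)"
  have z: "z \<in> carrier ?S" using m by (simp add: z_def carrier_cyclic_TL id_diagram_crossingless)
  have z_mult: "z \<otimes>\<^bsub>?S\<^esub> (a, i) = (a, (1 + i) mod int m)" and mult_z: "(a, i) \<otimes>\<^bsub>?S\<^esub> z = (a, (1 + i) mod int m)"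
    if "a \<in> crossingless n n" for a i
    using glue_id_left[OF pm[OF that]] glue_id_right[OF pm[OF that]]
    by (simp_all add: z_def mult_cyclic_TL mod_simps add.commute)
  have z_pow: "z [^]\<^bsub>?S\<^esub> i = (id_diagram n, int i mod int m)" for i :: nat
  proof (induction i)
    case (Suc i)
    then show ?case by (simp add: mult_z[OF id_diagram_crossingless] mod_simps)
  qed (simp add: one_cyclic_TL)
  have z_pow_mult: "z [^]\<^bsub>?S\<^esub> i \<otimes>\<^bsub>?S\<^esub> (a, j) = (a, (int i + j) mod int m)" if "a \<in> crossingless n n" for i :: nat and a j
    using glue_id_left[OF pm[OF that]] by (simp add: z_pow mult_cyclic_TL mod_simps)
  have e: "e k \<in> carrier ?S" if "k \<in> strand_numbers n" for k
    using \<epsilon>[OF that] m by (simp add: e_def \<delta>_def carrier_cyclic_TL)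
  have "cyclic_J_chain ?S (\<lambda>s. through_number (fst s)) (strand_numbers n) e z m"
  proof (rule cyclic_J_chain.intro)
    show "Group.monoid ?S" by (rule monoid_cyclic_TL[OF m])
    show "1 \<le> m" by (rule m)
    show "z \<in> carrier ?S" by (rule z)
    show "z \<otimes>\<^bsub>?S\<^esub> s = s \<otimes>\<^bsub>?S\<^esub> z" if "s \<in> carrier ?S" for s
      using that by (cases s) (auto simp: carrier_cyclic_TL[OF m] z_mult mult_z)
    show "z [^]\<^bsub>?S\<^esub> m = \<one>\<^bsub>?S\<^esub>" by (simp add: z_pow one_cyclic_TL)
    show "through_number (fst s) \<in> strand_numbers n" if "s \<in> carrier ?S" for s
      using that by (auto simp: carrier_cyclic_TL[OF m] intro: through_number_strand_numbers[OF pm])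
    show "lr_le ?S s t \<longleftrightarrow> through_number (fst t) \<le> through_number (fst s)"
      if "s \<in> carrier ?S" "t \<in> carrier ?S" for s t
      by (rule lr_le_cyclic_TL[OF m that])
  next
    fix k assume k: "k \<in> strand_numbers n"
    show "e k \<in> carrier ?S" by (rule e[OF k])
    show "through_number (fst (e k)) = k" using \<epsilon>[OF k] by (simp add: e_def)
    have "(\<delta> k + \<delta> k + int (loops n n n (\<epsilon> k) (\<epsilon> k))) mod int m = \<delta> k"
      unfolding \<delta>_def mod_add_inner by simp
    then show "e k \<otimes>\<^bsub>?S\<^esub> e k = e k" using \<epsilon>[OF k] by (simp add: e_def mult_cyclic_TL)
    show "\<exists>i::nat. e k \<otimes>\<^bsub>?S\<^esub> s \<otimes>\<^bsub>?S\<^esub> e k = z [^]\<^bsub>?S\<^esub> i \<otimes>\<^bsub>?S\<^esub> e k"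
      if s: "s \<in> carrier ?S" and rk: "through_number (fst (e k \<otimes>\<^bsub>?S\<^esub> s \<otimes>\<^bsub>?S\<^esub> e k)) = k" for s
    proof -
      obtain a i where a: "s = (a, i)" "a \<in> crossingless n n" using s by (auto simp: carrier_cyclic_TL[OF m])
      have assoc: "e k \<otimes>\<^bsub>?S\<^esub> s \<otimes>\<^bsub>?S\<^esub> e k = e k \<otimes>\<^bsub>?S\<^esub> (s \<otimes>\<^bsub>?S\<^esub> e k)"
        by (rule m_assoc[OF e[OF k] s e[OF k]])
      then have fst_eq: "fst (e k \<otimes>\<^bsub>?S\<^esub> s \<otimes>\<^bsub>?S\<^esub> e k) = glue n n n (\<epsilon> k) (glue n n n a (\<epsilon> k))"
        by (simp add: a e_def mult_cyclic_TL)
      then have "fst (e k \<otimes>\<^bsub>?S\<^esub> s \<otimes>\<^bsub>?S\<^esub> e k) = \<epsilon> k" using \<epsilon>[OF k] a(2) rk by simp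
      moreover have "e k \<otimes>\<^bsub>?S\<^esub> s \<otimes>\<^bsub>?S\<^esub> e k \<in> carrier ?S" using e[OF k] s by simp
      ultimately obtain j where j: "e k \<otimes>\<^bsub>?S\<^esub> s \<otimes>\<^bsub>?S\<^esub> e k = (\<epsilon> k, j)" "0 \<le> j" "j < int m"
        by (cases "e k \<otimes>\<^bsub>?S\<^esub> s \<otimes>\<^bsub>?S\<^esub> e k") (auto simp: carrier_cyclic_TL[OF m])
      define l where "l = nat ((j - \<delta> k) mod int m)"
      have "int l = (j - \<delta> k) mod int m" using m by (simp add: l_def)
      then have "(int l + \<delta> k) mod int m = j" using j(2,3) by (simp add: mod_simps)
      then have "z [^]\<^bsub>?S\<^esub> l \<otimes>\<^bsub>?S\<^esub> e k = (\<epsilon> k, j)" using z_pow_mult \<epsilon>[OF k] by (simp add: e_def)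
      then show ?thesis using j(1) by metis
    qed
    show "i = j" if ij: "i < m" "j < m" and eq: "z [^]\<^bsub>?S\<^esub> i \<otimes>\<^bsub>?S\<^esub> e k = z [^]\<^bsub>?S\<^esub> j \<otimes>\<^bsub>?S\<^esub> e k" for i j :: nat
    proof -
      have "(int i + \<delta> k) mod int m = (int j + \<delta> k) mod int m"
        using eq z_pow_mult \<epsilon>[OF k] by (simp add: e_def)
      then have "(int i + \<delta> k - \<delta> k) mod int m = (int j + \<delta> k - \<delta> k) mod int m" by (rule mod_diff_cong) simp
      then show ?thesis using ij by simp
    qed
  qed
  then show ?thesis using that by blast
qed

theorem proposition3p3p5:
  fixes n m :: nat
    and smul :: "'k::field \<Rightarrow> 'v::ab_group_add \<Rightarrow> 'v"
  assumes "n \<ge> 1" and "m \<ge> 1"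
    and "vector_space smul"
    and "infinite_dimensional smul"
  shows "(\<exists>\<iota>. bij_betw \<iota> (strand_numbers n) (simple_apexes smul (cyclic_TL m n)) \<and>
              (\<forall>k\<in>strand_numbers n. \<forall>l\<in>strand_numbers n. J_cell_le (cyclic_TL m n) (\<iota> k) (\<iota> l) \<longleftrightarrow> l \<le> k)) \<and>
         (\<forall>J\<in>simple_apexes smul (cyclic_TL m n).
              finite (simple_classes smul (cyclic_TL m n) J) \<and>
              card (simple_classes smul (cyclic_TL m n) J) \<le> m \<and>
              ((\<exists>z::'k. primitive_root_of_unity m z) \<longrightarrow>
                 card (simple_classes smul (cyclic_TL m n) J) = m))"
proof -
  obtain e z where chain: "cyclic_J_chain (cyclic_TL m n) (\<lambda>s. through_number (fst s)) (strand_numbers n) e z m"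
    using cyclic_TL_cyclic_J_chain[OF assms(2)] .
  interpret cyclic_J_chain_space "cyclic_TL m n" "\<lambda>s. through_number (fst s)" "strand_numbers n" e z m smul
    using chain assms(3) by (rule cyclic_J_chain_space.intro)
  have "finite (carrier (cyclic_TL m n))"
    using assms(2) finite_crossingless by (simp add: carrier_cyclic_TL)
  then show ?thesis using assms(4) by (rule apexes_and_simple_classes)
qed

end
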